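(* Let $G=(U,W,E)$ be a graph in $\mathcal{X}$. Then the complement $\overline{G}$ of $G$ is a unit disk graph.
   Context: All graphs are finite and simple. A graph $G=(V,E)$ is a unit disk graph if there is a function $f:V\to\mathbb{R}^2$ such that for distinct $u,v\in V$, $uv\in E$ if and only if the Euclidean distance between $f(u)$ and $f(v)$ is at most $1$. $(U,W,E)$ denotes a bipartite graph with fixed partition of the vertex set into independent sets $U,W$ and edge set $E$. The class $\mathcal{X}$ consists of all graphs (necessarily bipartite) containing none of the following graphs as an induced subgraph: the cycles $C_n$ for $n\ge 3$, $n\neq 6$; the tree $S_{3,3,3}$ (one centre vertex with three attached disjoint paths of length 3); the graph $C_6^{+3c}$ ($C_6$ with one pendant vertex attached to each of three consecutive vertices of the cycle); the graph $C_6^{+3nc}$ ($C_6$ with one pendant vertex attached to each of three pairwise non-adjacent vertices of the cycle); the graph $C_6^{+2l2}$ ($C_6$ with a path of length 2 attached at each of two adjacent vertices of the cycle, i.e. with $C_6=c_1\dots c_6$, new vertices $x,x',y,y'$ and new edges $c_1x,xx',c_2y,yy'$). *)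

theory Defs
  imports "HOL-Analysis.Analysis"
begin

record 'a graph =
  verts :: "'a set"
  edges :: "'a set set"

definition simple_graph :: "'a graph \<Rightarrow> bool" where
  "simple_graph G \<longleftrightarrow> finite (verts G) \<and> (\<forall>e\<in>edges G. e \<subseteq> verts G \<and> card e = 2)"

definition complement :: "'a graph \<Rightarrow> 'a graph" where
  "complement G = \<lparr>verts = verts G,
     edges = {{u, v} | u v. u \<in> verts G \<and> v \<in> verts G \<and> u \<noteq> v \<and> {u, v} \<notin> edges G}\<rparr>"

definition independent_set :: "'a graph \<Rightarrow> 'a set \<Rightarrow> bool" where
  "independent_set G S \<longleftrightarrow> S \<subseteq> verts G \<and> (\<forall>u\<in>S. \<forall>v\<in>S. {u, v} \<notin> edges G)"

text \<open>The parts \<open>U\<close> and \<open>W\<close> may be empty.\<close>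

definition bipartite_graph :: "'a set \<Rightarrow> 'a set \<Rightarrow> 'a graph \<Rightarrow> bool" where
  "bipartite_graph U W G \<longleftrightarrow> simple_graph G \<and> verts G = U \<union> W \<and> U \<inter> W = {} \<and>
     independent_set G U \<and> independent_set G W"

definition unit_disk_graph :: "'a graph \<Rightarrow> bool" where
  "unit_disk_graph G \<longleftrightarrow> simple_graph G \<and>
     (\<exists>f :: 'a \<Rightarrow> real ^ 2. \<forall>u\<in>verts G. \<forall>v\<in>verts G. u \<noteq> v \<longrightarrow>
        ({u, v} \<in> edges G \<longleftrightarrow> dist (f u) (f v) \<le> 1))"

definition induced_subgraph :: "'a graph \<Rightarrow> 'a set \<Rightarrow> 'a graph" where
  "induced_subgraph G S = \<lparr>verts = S, edges = {e \<in> edges G. e \<subseteq> S}\<rparr>"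

definition graph_iso :: "'a graph \<Rightarrow> 'b graph \<Rightarrow> bool" where
  "graph_iso G H \<longleftrightarrow> (\<exists>\<phi>. bij_betw \<phi> (verts G) (verts H) \<and>
     (\<forall>u\<in>verts G. \<forall>v\<in>verts G. {u, v} \<in> edges G \<longleftrightarrow> {\<phi> u, \<phi> v} \<in> edges H))"

definition contains_induced :: "'a graph \<Rightarrow> 'b graph \<Rightarrow> bool" where
  "contains_induced G H \<longleftrightarrow> (\<exists>S \<subseteq> verts G. graph_iso H (induced_subgraph G S))"

text \<open>\<open>cycle_graph n\<close> is the cycle \<open>C\<^sub>n\<close> only for \<open>n \<ge> 3\<close>.\<close>

definition cycle_graph :: "nat \<Rightarrow> nat graph" where
  "cycle_graph n = \<lparr>verts = {..<n}, edges = {{i, Suc i mod n} | i. i < n}\<rparr>"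

definition S_3_3_3 :: "nat graph" where
  "S_3_3_3 = \<lparr>verts = {..<10},
     edges = {{0, 1}, {1, 2}, {2, 3}, {0, 4}, {4, 5}, {5, 6}, {0, 7}, {7, 8}, {8, 9}}\<rparr>"

text \<open>In the next three graphs the vertices \<open>0, \<dots>, 5\<close> form the cycle \<open>C\<^sub>6\<close>, in this cyclic order.\<close>

definition C6_3c :: "nat graph" where
  "C6_3c = \<lparr>verts = {..<9},
     edges = edges (cycle_graph 6) \<union> {{0, 6}, {1, 7}, {2, 8}}\<rparr>"

definition C6_3nc :: "nat graph" where
  "C6_3nc = \<lparr>verts = {..<9},
     edges = edges (cycle_graph 6) \<union> {{0, 6}, {2, 7}, {4, 8}}\<rparr>"

definition C6_2l2 :: "nat graph" where
  "C6_2l2 = \<lparr>verts = {..<10},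
     edges = edges (cycle_graph 6) \<union> {{0, 6}, {6, 7}, {1, 8}, {8, 9}}\<rparr>"

definition class_X :: "'a graph set" where
  "class_X = {G. simple_graph G \<and>
     (\<forall>n\<ge>3. n \<noteq> 6 \<longrightarrow> \<not> contains_induced G (cycle_graph n)) \<and>
     \<not> contains_induced G S_3_3_3 \<and>
     \<not> contains_induced G C6_3c \<and>
     \<not> contains_induced G C6_3nc \<and>
     \<not> contains_induced G C6_2l2}"

end

theory Submission
  imports Defs
begin

text \<open>
  Assign to every vertex \<open>z\<close> real numbers \<open>x z\<close> and \<open>h z\<close> such that \<open>u \<in> U\<close> and \<open>w \<in> W\<close> are adjacent
  iff \<open>h u + h w + x u * x w > 0\<close>, all these values being nonzero.  Putting \<open>U\<close> and \<open>W\<close> into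
  infinitesimal neighbourhoods of two points at distance 1, with \<open>x\<close> as transversal and \<open>h\<close> as a
  second-order longitudinal coordinate, then represents the complement by unit disks.  Equivalently,
  \<open>U\<close> is a set of points, \<open>W\<close> a set of lines, and adjacency means that a point lies above a line.

  Such layouts can be glued.  Call a set of vertices exposed if its members are exactly those with
  positive \<open>x\<close>.  A layout may be shrunk into an arbitrarily small region around one point and its
  tangent.  A vertex far away then sees, of the shrunk part, exactly an exposed set.

  Forbidding \<open>S\<^sub>3\<^sub>,\<^sub>3\<^sub>,\<^sub>3\<close> and the three extensions of \<open>C\<^sub>6\<close> makes the graphs of the class linear.  All but at most
  two of the branches at a vertex are stars.  A hexagon lies in a theta graph, whose two poles are
  joined by paths of length 3, and the rest of the graph is attached at two disjoint edges, one at
  each pole.  So a layout can be built by induction, gluing towards a hexagon or a vertex from two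
  sides.
\<close>

section \<open>Layouts and their gluing\<close>

text \<open>Shrinking a layout by a factor \<open>d\<close> moves its form to order
  \<open>d^2\<close>. To place the shrunk part away from the origin, \<open>h0\<close> and
  \<open>h1\<close> are chosen so that orders 0 and 1 cancel inside it, since a translation of
  \<open>x\<close> is absorbed by \<open>h\<close>; this is the origin of most constants below.
  Against another vertex, order 0 either decides or vanishes, and then order 1 is the exposed
  coordinate. Both ends of an edge can read one exposed set, because they look at opposite sides of
  it. So gluing works at vertices and at edges, but only one complicated part can be passed on. At a
  vertex this is ensured by S_{3,3,3}: three branches that are not stars would contain its legs. An
  induction into one branch must remember a leg outside it, hence \<open>tail\<close>. At an edge,
  C_6^{+2l2} prevents deep parts at both ends. A branch attached to its vertex by two edges closes a
  hexagon and is then seen through the open edge of a theta graph, while a part at an open edge may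
  consist of branches; so both kinds of claim need one common induction on size.\<close>

definition lexpos :: "real \<Rightarrow> real \<Rightarrow> real \<Rightarrow> bool" where
  "lexpos a b c \<longleftrightarrow> 0 < a \<or> (a = 0 \<and> (0 < b \<or> (b = 0 \<and> 0 < c)))"

lemma lexpos_eventually:
  assumes "lexpos a b c"
  shows "\<forall>\<^sub>F d in at_right 0. 0 < a + d * b + d\<^sup>2 * c"
proof -
  have pos: "\<forall>\<^sub>F d in at_right 0. (0::real) < d"
    by (simp add: eventually_at_right_less)
  have lim: "((\<lambda>d. p + d * q + d\<^sup>2 * r) \<longlongrightarrow> p + 0 * q + 0\<^sup>2 * r) (at_right 0)" for p q r :: real
    by (intro tendsto_intros)
  consider "0 < a" | "a = 0" "0 < b" | "a = 0" "b = 0" "0 < c"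
    using assms unfolding lexpos_def by blast
  then show ?thesis
  proof cases
    case 1
    then show ?thesis using order_tendstoD(1)[OF lim[of a b c], of 0] by simp
  next
    case 2
    have "\<forall>\<^sub>F d in at_right 0. 0 < b + d * c + d\<^sup>2 * 0"
      using order_tendstoD(1)[OF lim[of b c 0], of 0] 2 by simp
    with pos show ?thesis
    proof eventually_elim
      case (elim d)
      then have "0 < d * (b + d * c)" by simp
      then show ?case using 2 by (simp add: algebra_simps power2_eq_square)
    qed
  next
    case 3
    from pos show ?thesis by eventually_elim (use 3 in simp)
  qed
qed

section \<open>Layouts of a bipartite graph and exposed sets\<close>

locale bip_graph =
  fixes U :: "'a set" and E :: "'a \<Rightarrow> 'a \<Rightarrow> bool"
  assumes sym: "E x y \<Longrightarrow> E y x"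
    and bip: "E x y \<Longrightarrow> (x \<in> U) \<noteq> (y \<in> U)"
begin

definition opp :: "'a \<Rightarrow> 'a \<Rightarrow> bool" where
  "opp x y \<longleftrightarrow> (x \<in> U) \<noteq> (y \<in> U)"

definition layout :: "'a set \<Rightarrow> ('a \<Rightarrow> real) \<Rightarrow> ('a \<Rightarrow> real) \<Rightarrow> bool" where
  "layout A x h \<longleftrightarrow> (\<forall>u\<in>A. \<forall>w\<in>A. opp u w \<longrightarrow>
     (if E u w then 0 < h u + h w + x u * x w else h u + h w + x u * x w < 0))"

text \<open>Only \<open>N \<inter> A\<close> matters, so \<open>N\<close> can be a whole
  neighbourhood such as \<open>{z. E v z}\<close>, the same for parts of any size.\<close>

definition rep :: "'a set \<Rightarrow> 'a set \<Rightarrow> bool" where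
  "rep A N \<longleftrightarrow> finite A \<and> (\<exists>x h. layout A x h \<and>
     (\<forall>z\<in>A. if z \<in> N then 0 < x z else x z < 0))"

lemma E_opp: "E x y \<Longrightarrow> opp x y"
  using bip unfolding opp_def by blast

lemma opp_commute: "opp x y \<longleftrightarrow> opp y x"
  unfolding opp_def by blast

lemma E_commute: "E x y \<longleftrightarrow> E y x"
  using sym by blast

lemma rep_cong: "rep A N \<Longrightarrow> N \<inter> A = N' \<inter> A \<Longrightarrow> rep A N'"
  unfolding rep_def by (smt (verit) IntD1 IntI)

lemma rep_layout_cases:
  assumes "layout A x h" "u \<in> A" "w \<in> A"
  shows "E u w \<Longrightarrow> 0 < h u + h w + x u * x w"
    and "opp u w \<Longrightarrow> \<not> E u w \<Longrightarrow> h u + h w + x u * x w < 0"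
  using assms E_opp unfolding layout_def by (metis (full_types))+

text \<open>Translating the \<open>x\<close>-coordinates of the two sides by independent amounts can be absorbed
  into \<open>h\<close>, since the form is bilinear.\<close>

lemma rep_threshold:
  assumes "finite A" "layout A x h"
    and N: "\<And>z. z \<in> A \<Longrightarrow> if z \<in> N then c (z \<in> U) < x z else x z < c (z \<in> U)"
  shows "rep A N"
proof -
  define x' where "x' z = x z - c (z \<in> U)" for z
  define h' where "h' z = h z + c (z \<notin> U) * x z - c True * c False / 2" for z
  have "h' u + h' w + x' u * x' w = h u + h w + x u * x w" if "opp u w" for u w
    using that unfolding opp_def h'_def x'_def
    by (cases "u \<in> U") (auto simp: algebra_simps)
  then have "layout A x' h'"
    using assms(2) unfolding layout_def by simp
  moreover have "\<forall>z\<in>A. if z \<in> N then 0 < x' z else x' z < 0"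
    using N unfolding x'_def by (metis (full_types) diff_gt_0_iff_gt diff_less_0_iff_less)
  ultimately show ?thesis
    using assms(1) unfolding rep_def by blast
qed

definition lexsgn :: "bool \<Rightarrow> real \<Rightarrow> real \<Rightarrow> real \<Rightarrow> bool" where
  "lexsgn p a b c \<longleftrightarrow> (if p then lexpos a b c else lexpos (- a) (- b) (- c))"

text \<open>The arguments are the coefficients of \<open>1\<close>, \<open>d\<close> and
  \<open>d^2\<close> in the form for \<open>x = x0 + d * x1\<close> and
  \<open>h = h0 + d * h1 + d^2 * h2\<close>.\<close>

definition pair_ok :: "('a \<Rightarrow> real) \<Rightarrow> ('a \<Rightarrow> real) \<Rightarrow> ('a \<Rightarrow> real) \<Rightarrow> ('a \<Rightarrow> real) \<Rightarrow> ('a \<Rightarrow> real) \<Rightarrow> 'a \<Rightarrow> 'a \<Rightarrow> bool" where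
  "pair_ok x0 x1 h0 h1 h2 u w \<longleftrightarrow> lexsgn (E u w)
     (h0 u + h0 w + x0 u * x0 w)
     (h1 u + h1 w + x0 u * x1 w + x1 u * x0 w)
     (h2 u + h2 w + x1 u * x1 w)"

lemma pair_ok_commute: "pair_ok x0 x1 h0 h1 h2 u w \<longleftrightarrow> pair_ok x0 x1 h0 h1 h2 w u"
  by (simp only: pair_ok_def E_commute[of u w] ac_simps)

text \<open>The layouts below are first-order deformations of degenerate ones.  The leading
  nonzero coefficient in the deformation parameter decides each sign.\<close>

lemma rep_perturb:
  fixes x0 x1 h0 h1 h2 :: "'a \<Rightarrow> real"
  assumes fin: "finite A"
    and ok: "\<And>u w. u \<in> A \<Longrightarrow> w \<in> A \<Longrightarrow> opp u w \<Longrightarrow>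
      pair_ok x0 x1 h0 h1 h2 u w \<or> pair_ok x0 x1 h0 h1 h2 w u"
    and N: "\<And>z. z \<in> A \<Longrightarrow> lexsgn (z \<in> N) (x0 z - c (z \<in> U)) (x1 z) 0"
  shows "rep A N"
proof -
  define x where "x d z = x0 z + d * x1 z" for d z
  define h where "h d z = h0 z + d * h1 z + d\<^sup>2 * h2 z" for d z
  define P where "P d u w \<longleftrightarrow> (opp u w \<longrightarrow>
     (if E u w then 0 < h d u + h d w + x d u * x d w else h d u + h d w + x d u * x d w < 0))"
    for d u w
  define Q where "Q d z \<longleftrightarrow> (if z \<in> N then c (z \<in> U) < x d z else x d z < c (z \<in> U))" for d z
  have sgn: "\<forall>\<^sub>F d in at_right 0. if p then 0 < a + d * b + d\<^sup>2 * c else a + d * b + d\<^sup>2 * c < 0"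
    if "lexsgn p a b c" for p a b c
  proof (cases p)
    case True
    then show ?thesis using lexpos_eventually[of a b c] that unfolding lexsgn_def by simp
  next
    case False
    then have "\<forall>\<^sub>F d in at_right 0. 0 < - a + d * - b + d\<^sup>2 * - c"
      using lexpos_eventually[of "- a" "- b" "- c"] that unfolding lexsgn_def by simp
    then show ?thesis by eventually_elim (use False in \<open>simp add: algebra_simps\<close>)
  qed
  have expand: "h d u + h d w + x d u * x d w =
      (h0 u + h0 w + x0 u * x0 w) + d * (h1 u + h1 w + x0 u * x1 w + x1 u * x0 w)
      + d\<^sup>2 * (h2 u + h2 w + x1 u * x1 w)" for d u w
    unfolding h_def x_def by (simp add: algebra_simps power2_eq_square)
  have "\<forall>\<^sub>F d in at_right 0. P d u w" if "u \<in> A" "w \<in> A" for u w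
  proof (cases "opp u w")
    case True
    then have "pair_ok x0 x1 h0 h1 h2 u w"
      using ok[OF that] pair_ok_commute by blast
    from sgn[OF this[unfolded pair_ok_def]] show ?thesis
      unfolding P_def expand by eventually_elim simp
  qed (simp add: P_def)
  then have "\<forall>\<^sub>F d in at_right 0. \<forall>u\<in>A. \<forall>w\<in>A. P d u w"
    using fin by (simp add: eventually_ball_finite)
  moreover have "\<forall>\<^sub>F d in at_right 0. Q d z" if "z \<in> A" for z
    using sgn[OF N[OF that]]
    by eventually_elim (auto simp: Q_def x_def split: if_splits)
  then have "\<forall>\<^sub>F d in at_right 0. \<forall>z\<in>A. Q d z"
    using fin by (simp add: eventually_ball_finite)
  ultimately have "\<forall>\<^sub>F d in at_right (0::real). (\<forall>u\<in>A. \<forall>w\<in>A. P d u w) \<and> (\<forall>z\<in>A. Q d z)"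
    by (rule eventually_conj)
  then obtain d where "\<forall>u\<in>A. \<forall>w\<in>A. P d u w" "\<forall>z\<in>A. Q d z"
    using eventually_happens[of _ "at_right (0::real)"] trivial_limit_at_right_real by blast
  then show ?thesis
    using rep_threshold[OF fin, of "x d" "h d" N c] unfolding layout_def P_def Q_def by blast
qed

section \<open>Gluing operations\<close>

lemma rep_empty: "rep {} N"
  unfolding rep_def layout_def by simp

text \<open>At the new vertex the form is \<open>-1\<close> at order 0 whatever the sign of its
  \<open>x\<close>, so the vertex can be exposed or hidden at will.\<close>

lemma rep_isolated:
  assumes "rep A N" "z \<notin> A" "\<And>y. y \<in> A \<Longrightarrow> \<not> E z y"
    and "N' \<inter> A = N \<inter> A"
  shows "rep (insert z A) N'"
proof -
  obtain x h where fin: "finite A" and lay: "layout A x h"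
    and N: "\<forall>z\<in>A. if z \<in> N then 0 < x z else x z < 0"
    using assms(1) unfolding rep_def by blast
  have N1: "0 < x z" if "z \<in> A" "z \<in> N" for z using N that by (metis (full_types))
  have N2: "x z < 0" if "z \<in> A" "z \<notin> N" for z using N that by (metis (full_types))
  note xh = rep_layout_cases[OF lay] N1 N2
  have ne: "y \<noteq> z" if "y \<in> A" for y using assms(2) that by blast
  have N': "y \<in> N' \<longleftrightarrow> y \<in> N" if "y \<in> A" for y using \<open>N' \<inter> A = N \<inter> A\<close> that by blast
  let ?x0 = "\<lambda>y. if y = z then (if z \<in> N' then 1 else -1) else (0::real)"
  let ?x1 = "\<lambda>y. if y = z then 0 else x y"
  let ?h0 = "\<lambda>y. if y = z then -1 else (0::real)"
  let ?h2 = "\<lambda>y. if y = z then 0 else h y"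
  show ?thesis
  proof (rule rep_perturb[where c="\<lambda>_. 0"])
    show "finite (insert z A)" using fin by simp
    fix u w assume uw: "u \<in> insert z A" "w \<in> insert z A" "opp u w"
    then consider "u \<in> A" "w \<in> A" | "u = z" "w \<in> A" | "w = z" "u \<in> A"
      unfolding opp_def by blast
    then show "pair_ok ?x0 ?x1 ?h0 (\<lambda>_. 0) ?h2 u w \<or> pair_ok ?x0 ?x1 ?h0 (\<lambda>_. 0) ?h2 w u"
    proof cases
      case 1
      then have "pair_ok ?x0 ?x1 ?h0 (\<lambda>_. 0) ?h2 u w"
        using xh(1,2)[of u w] uw(3) by (cases "E u w") (auto simp: pair_ok_def lexsgn_def lexpos_def ne)
      then show ?thesis ..
    qed (simp_all add: pair_ok_def lexsgn_def lexpos_def ne assms(3))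
  next
    fix y assume "y \<in> insert z A"
    then show "lexsgn (y \<in> N') (?x0 y - 0) (?x1 y) 0"
      using xh(3,4)[of y] N'[of y] ne[of y] by (auto simp: lexsgn_def lexpos_def)
  qed
qed

lemma rep_isolated_set:
  assumes "finite B" "rep A N" "A \<inter> B = {}" "\<And>z y. z \<in> B \<Longrightarrow> y \<in> A \<union> B \<Longrightarrow> \<not> E z y"
    and "N' \<inter> A = N \<inter> A"
  shows "rep (A \<union> B) N'"
  using assms
proof (induction B rule: finite_induct)
  case empty
  then show ?case using rep_cong by (metis sup_bot_right)
next
  case (insert z B)
  have "rep (A \<union> B) N'" using insert by auto
  then have "rep (insert z (A \<union> B)) N'"
    by (rule rep_isolated) (use insert in auto)
  then show ?case by simp
qed

text \<open>With \<open>A\<close> shrunk to \<open>x = 0\<close> and \<open>r\<close> at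
  \<open>x = 1\<close>, order 0 vanishes between them and order 1 is \<open>x z\<close>. So
  \<open>r\<close> sees exactly the exposed vertices opposite to it.\<close>

lemma rep_add_end:
  assumes "rep A N" "r \<notin> A" and adj: "\<And>z. z \<in> A \<Longrightarrow> opp z r \<Longrightarrow> E z r \<longleftrightarrow> z \<in> N"
  shows "rep (insert r A) (insert r {z \<in> N. \<not> opp z r})"
proof -
  obtain x h where fin: "finite A" and lay: "layout A x h"
    and N: "\<forall>z\<in>A. if z \<in> N then 0 < x z else x z < 0"
    using assms(1) unfolding rep_def by blast
  have N1: "0 < x z" if "z \<in> A" "z \<in> N" for z using N that by (metis (full_types))
  have N2: "x z < 0" if "z \<in> A" "z \<notin> N" for z using N that by (metis (full_types))
  note xh = rep_layout_cases[OF lay] N1 N2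
  have ne: "y \<noteq> r" if "y \<in> A" for y using assms(2) that by blast
  let ?x0 = "\<lambda>y. if y = r then 1 else (0::real)"
  let ?x1 = "\<lambda>y. if y = r then 0 else x y"
  let ?h2 = "\<lambda>y. if y = r then 0 else h y"
  let ?ok = "pair_ok ?x0 ?x1 (\<lambda>_. 0) (\<lambda>_. 0) ?h2"
  have okr: "?ok z r" if z: "z \<in> A" "opp z r" for z
    using adj[OF z] xh(3,4)[OF z(1)] by (auto simp: pair_ok_def lexsgn_def lexpos_def ne[OF z(1)])
  show ?thesis
  \<comment> \<open>On the side of \<open>r\<close> the threshold 0 keeps the old exposure and adds
    \<open>r\<close>; on the other side the threshold 1 lies above all of \<open>A\<close>.\<close>
  proof (rule rep_perturb[where c="\<lambda>s. if s = (r \<in> U) then 0 else 1"])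
    show "finite (insert r A)" using fin by simp
    fix u w assume uw: "u \<in> insert r A" "w \<in> insert r A" "opp u w"
    then consider "u \<in> A" "w \<in> A" | "u = r" "w \<in> A" | "w = r" "u \<in> A"
      unfolding opp_def by blast
    then show "?ok u w \<or> ?ok w u"
    proof cases
      case 1
      then have "?ok u w"
        using xh(1,2)[of u w] uw(3) by (cases "E u w") (auto simp: pair_ok_def lexsgn_def lexpos_def ne)
      then show ?thesis ..
    qed (use okr uw(3) opp_commute in blast)+
  next
    fix z assume "z \<in> insert r A"
    then show "lexsgn (z \<in> insert r {z \<in> N. \<not> opp z r})
        (?x0 z - (if (z \<in> U) = (r \<in> U) then 0 else 1)) (?x1 z) 0"
      using xh(3,4)[of z] ne[of z] by (auto simp: lexsgn_def lexpos_def opp_def)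
  qed
qed

text \<open>\<open>B\<close> moves to \<open>x = 1\<close>. There the product of two coordinates is
  \<open>1 + d * (x' u + x' w) + d^2 * (x' u * x' w)\<close>, and \<open>h0 = -1/2\<close>,
  \<open>h1 = - x'\<close> cancel the first two terms. Between \<open>A\<close> and \<open>B\<close>
  order 0 is \<open>-1/2\<close>.\<close>

lemma rep_join:
  assumes "rep A N" "rep B M" "A \<inter> B = {}"
    and no: "\<And>a b. a \<in> A \<Longrightarrow> b \<in> B \<Longrightarrow> \<not> E a b"
    and side: "\<And>z. z \<in> N \<Longrightarrow> z \<in> A \<Longrightarrow> (z \<in> U) = s"
  shows "rep (A \<union> B) (N \<inter> A \<union> {z \<in> B. (z \<in> U) = s})"
proof -
  obtain x h where fin: "finite A" and lay: "layout A x h"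
    and N: "\<forall>z\<in>A. if z \<in> N then 0 < x z else x z < 0"
    using assms(1) unfolding rep_def by blast
  have N1: "0 < x z" if "z \<in> A" "z \<in> N" for z using N that by (metis (full_types))
  have N2: "x z < 0" if "z \<in> A" "z \<notin> N" for z using N that by (metis (full_types))
  note xh = rep_layout_cases[OF lay] N1 N2
  obtain x' h' where fin': "finite B" and lay': "layout B x' h'"
    and N': "\<forall>z\<in>B. if z \<in> M then 0 < x' z else x' z < 0"
    using assms(2) unfolding rep_def by blast
  have N'1: "0 < x' z" if "z \<in> B" "z \<in> M" for z using N' that by (metis (full_types))
  have N'2: "x' z < 0" if "z \<in> B" "z \<notin> M" for z using N' that by (metis (full_types))
  note xh' = rep_layout_cases[OF lay'] N'1 N'2
  have d: "z \<notin> A" if "z \<in> B" for z using assms(3) that by blast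
  let ?x0 = "\<lambda>y. if y \<in> A then 0 else (1::real)"
  let ?x1 = "\<lambda>y. if y \<in> A then x y else x' y"
  let ?h0 = "\<lambda>y. if y \<in> A then 0 else (-1/2::real)"
  let ?h1 = "\<lambda>y. if y \<in> A then 0 else - x' y"
  let ?h2 = "\<lambda>y. if y \<in> A then h y else h' y"
  let ?ok = "pair_ok ?x0 ?x1 ?h0 ?h1 ?h2"
  have AB: "?ok a b" if "a \<in> A" "b \<in> B" for a b
    using that no[OF that] d[OF that(2)] by (simp add: pair_ok_def lexsgn_def lexpos_def)
  show ?thesis
  \<comment> \<open>Threshold 0 on side \<open>s\<close> preserves \<open>N\<close> and exposes all
    of \<open>B\<close> there; threshold 2 on the other side hides everything, which agrees with
    \<open>side\<close>.\<close>
  proof (rule rep_perturb[where c="\<lambda>t. if t = s then 0 else 2"])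
    show "finite (A \<union> B)" using fin fin' by simp
    fix u w assume uw: "u \<in> A \<union> B" "w \<in> A \<union> B" "opp u w"
    then consider "u \<in> A" "w \<in> A" | "u \<in> A" "w \<in> B" | "u \<in> B" "w \<in> A" | "u \<in> B" "w \<in> B"
      by blast
    then show "?ok u w \<or> ?ok w u"
    proof cases
      case 1
      then have "?ok u w"
        using xh(1,2)[of u w] uw(3) by (cases "E u w") (auto simp: pair_ok_def lexsgn_def lexpos_def)
      then show ?thesis ..
    next
      case 4
      then have "?ok u w"
        using xh'(1,2)[of u w] uw(3) d by (cases "E u w") (auto simp: pair_ok_def lexsgn_def lexpos_def)
      then show ?thesis ..
    qed (use AB in blast)+
  next
    fix z assume "z \<in> A \<union> B"
    then show "lexsgn (z \<in> N \<inter> A \<union> {z \<in> B. (z \<in> U) = s})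
        (?x0 z - (if (z \<in> U) = s then 0 else 2)) (?x1 z) 0"
      using xh(3,4)[of z] side[of z] d[of z] by (auto simp: lexsgn_def lexpos_def)
  qed
qed

text \<open>The vertices of \<open>T\<close> sit between \<open>A\<close> and the mirror image of \<open>B\<close>.\<close>

lemma rep_mid:
  assumes "rep A N" "rep B M" "finite T" "A \<inter> B = {}" "A \<inter> T = {}" "B \<inter> T = {}"
    and no: "\<And>a b. a \<in> A \<Longrightarrow> b \<in> B \<Longrightarrow> \<not> E a b"
    and T: "\<And>s t. s \<in> T \<Longrightarrow> t \<in> T \<Longrightarrow> opp s t \<Longrightarrow> E s t"
    and TA: "\<And>z t. z \<in> A \<Longrightarrow> t \<in> T \<Longrightarrow> opp z t \<Longrightarrow> E z t \<longleftrightarrow> z \<in> N"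
    and TB: "\<And>z t. z \<in> B \<Longrightarrow> t \<in> T \<Longrightarrow> opp z t \<Longrightarrow> E z t \<longleftrightarrow> z \<in> M"
  shows "rep (A \<union> B \<union> T) {}"
proof -
  obtain x h where fin: "finite A" and lay: "layout A x h"
    and N: "\<forall>z\<in>A. if z \<in> N then 0 < x z else x z < 0"
    using assms(1) unfolding rep_def by blast
  have N1: "0 < x z" if "z \<in> A" "z \<in> N" for z using N that by (metis (full_types))
  have N2: "x z < 0" if "z \<in> A" "z \<notin> N" for z using N that by (metis (full_types))
  note xh = rep_layout_cases[OF lay] N1 N2
  obtain x' h' where fin': "finite B" and lay': "layout B x' h'"
    and N': "\<forall>z\<in>B. if z \<in> M then 0 < x' z else x' z < 0"
    using assms(2) unfolding rep_def by blast
  have N'1: "0 < x' z" if "z \<in> B" "z \<in> M" for z using N' that by (metis (full_types))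
  have N'2: "x' z < 0" if "z \<in> B" "z \<notin> M" for z using N' that by (metis (full_types))
  note xh' = rep_layout_cases[OF lay'] N'1 N'2
  have dT: "t \<notin> A" "t \<notin> B" if "t \<in> T" for t using that assms(5,6) by blast+
  have dB: "z \<notin> A" if "z \<in> B" for z using that assms(4) by blast
  \<comment> \<open>Mirroring \<open>B\<close> changes the sign of \<open>x\<close> on both sides,
    which keeps the products. Order 0 is \<open>-2\<close> between \<open>A\<close> and
    \<open>B\<close> and \<open>1\<close> inside \<open>T\<close>; it vanishes inside
    \<open>A\<close>, inside \<open>B\<close> and towards \<open>T\<close>. Towards
    \<open>T\<close>, order 1 is then \<open>h1\<close>, the exposed coordinate.\<close>
  let ?x0 = "\<lambda>y. if y \<in> A then -1 else if y \<in> B then 1 else (0::real)"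
  let ?x1 = "\<lambda>y. if y \<in> A then x y else if y \<in> B then - x' y else 0"
  let ?h0 = "\<lambda>y. if y \<in> A then -1/2 else if y \<in> B then -1/2 else (1/2::real)"
  let ?h1 = "\<lambda>y. if y \<in> A then x y else if y \<in> B then x' y else 0"
  let ?h2 = "\<lambda>y. if y \<in> A then h y else if y \<in> B then h' y else 0"
  let ?ok = "pair_ok ?x0 ?x1 ?h0 ?h1 ?h2"
  have AB: "?ok a b" if "a \<in> A" "b \<in> B" for a b
    using that no[OF that] dB[OF that(2)] by (simp add: pair_ok_def lexsgn_def lexpos_def)
  have AT: "?ok a t" if "a \<in> A" "t \<in> T" "opp a t" for a t
    using that TA[OF that] dT[OF that(2)] xh(3,4)[OF that(1)]
    by (auto simp: pair_ok_def lexsgn_def lexpos_def)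
  have BT: "?ok b t" if "b \<in> B" "t \<in> T" "opp b t" for b t
    using that TB[OF that] dT[OF that(2)] dB[OF that(1)] xh'(3,4)[OF that(1)]
    by (auto simp: pair_ok_def lexsgn_def lexpos_def)
  show ?thesis
  proof (rule rep_perturb[where c="\<lambda>_. 2"])
    show "finite (A \<union> B \<union> T)" using fin fin' assms(3) by simp
    fix u w assume uw: "u \<in> A \<union> B \<union> T" "w \<in> A \<union> B \<union> T" "opp u w"
    then have wu: "opp w u" using opp_commute by blast
    consider "u \<in> A" "w \<in> A" | "u \<in> B" "w \<in> B" | "u \<in> T" "w \<in> T"
      | "u \<in> A" "w \<in> B" | "w \<in> A" "u \<in> B" | "u \<in> A" "w \<in> T" | "w \<in> A" "u \<in> T"
      | "u \<in> B" "w \<in> T" | "w \<in> B" "u \<in> T"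
      using uw by blast
    then show "?ok u w \<or> ?ok w u"
    proof cases
      case 1
      then have "?ok u w"
        using xh(1,2)[of u w] uw(3) by (cases "E u w") (auto simp: pair_ok_def lexsgn_def lexpos_def)
      then show ?thesis ..
    next
      case 2
      then have "?ok u w"
        using xh'(1,2)[of u w] uw(3) dB by (cases "E u w") (auto simp: pair_ok_def lexsgn_def lexpos_def)
      then show ?thesis ..
    next
      case 3
      then have "?ok u w"
        using T[of u w] uw(3) dT by (simp add: pair_ok_def lexsgn_def lexpos_def)
      then show ?thesis ..
    qed (use AB AT BT uw(3) wu in blast)+
  qed (auto simp: lexsgn_def lexpos_def)
qed

text \<open>With \<open>s\<close> and \<open>t\<close> the parameters of two paths, the form on an inner pair \<open>(a\<^sub>s, b\<^sub>t)\<close>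
  is \<open>- (s - t)\<^sup>2\<close>: the lines of the \<open>a\<close>'s are tangent to a parabola through the points of the
  \<open>b\<close>'s.\<close>

lemma rep_theta_step:
  assumes "rep L N" "finite A" "a1 \<in> A" "a2 \<in> A" "a1 \<noteq> a2" "inj_on g A"
    and side: "\<And>a. a \<in> A \<Longrightarrow> (a \<in> U) = (q \<in> U)" "\<And>a. a \<in> A \<Longrightarrow> (g a \<in> U) \<noteq> (q \<in> U)"
    and disj: "A \<inter> L = {}" "g ` A \<inter> L = {}" "q \<notin> L" "q \<notin> A"
    and ab: "\<And>a b. a \<in> A \<Longrightarrow> b \<in> A \<Longrightarrow> E a (g b) \<longleftrightarrow> a = b"
    and qb: "\<And>a. a \<in> A \<Longrightarrow> E q (g a)"
    and Lq: "\<And>z. z \<in> L \<Longrightarrow> opp z q \<Longrightarrow> E z q \<longleftrightarrow> z \<in> N"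
    and Lb2: "\<And>z. z \<in> L \<Longrightarrow> opp z (g a2) \<Longrightarrow> E z (g a2) \<longleftrightarrow> z \<in> N"
    and La: "\<And>z a. z \<in> L \<Longrightarrow> a \<in> A \<Longrightarrow> a \<noteq> a1 \<Longrightarrow> \<not> E z a"
    and Lb: "\<And>z a. z \<in> L \<Longrightarrow> a \<in> A \<Longrightarrow> a \<noteq> a2 \<Longrightarrow> \<not> E z (g a)"
  shows "rep (insert q (L \<union> g ` A \<union> (A - {a1}))) (insert (g a1) (A - {a1}))"
proof -
  obtain x h where fin: "finite L" and lay: "layout L x h"
    and N: "\<forall>z\<in>L. if z \<in> N then 0 < x z else x z < 0"
    using assms(1) unfolding rep_def by blast
  have N1: "0 < x z" if "z \<in> L" "z \<in> N" for z using N that by (metis (full_types))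
  have N2: "x z < 0" if "z \<in> L" "z \<notin> N" for z using N that by (metis (full_types))
  note xh = rep_layout_cases[OF lay] N1 N2
  obtain f :: "'a \<Rightarrow> nat" where f: "inj_on f A"
    using assms(2) finite_imp_inj_to_nat_seg by blast
  \<comment> \<open>Parameter 0 puts \<open>g a2\<close> where \<open>q\<close> is, to leading
    order, so both see \<open>L\<close> alike. \<open>g a1\<close> gets the largest parameter, so
    that a threshold can expose it alone. The others get distinct values in between, at most
    1/4.\<close>
  define t where "t a = (if a = a1 then 1/2 else if a = a2 then 0 else 1 / (4 + real (f a)))" for a
  have t2: "t a2 = 0" and t1: "t a1 = 1/2" using assms(5) unfolding t_def by auto
  have tpos: "0 < t a" if "a \<noteq> a2" for a using that unfolding t_def by (auto simp: add_pos_nonneg)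
  have t0: "0 \<le> t a" for a unfolding t_def by simp
  have tle: "t a \<le> 1/4" if "a \<noteq> a1" for a using that unfolding t_def by (simp add: field_simps)
  have tle2: "t a \<le> 1/2" for a using tle[of a] t1 by (cases "a = a1") auto
  have tinj: "t a \<noteq> t b" if "a \<in> A" "b \<in> A" "a \<noteq> b" for a b
  proof -
    consider "a = a1" | "b = a1" | "a = a2" | "b = a2" | "a \<notin> {a1, a2}" "b \<notin> {a1, a2}" by blast
    then show ?thesis
    proof cases
      case 5
      then show ?thesis using f that unfolding t_def inj_on_def by auto
    qed (use that tle[of a] tle[of b] tpos[of a] tpos[of b] t1 t2 in auto)
  qed
  define k where "k b = inv_into A g b" for b
  have k: "k (g a) = a" if "a \<in> A" for a
    using assms(6) that unfolding k_def by (rule inv_into_f_f)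
  have qg: "q \<notin> g ` A" "A \<inter> g ` A = {}" using side by blast+
  let ?B = "g ` A"
  \<comment> \<open>The points of the \<open>g a\<close> run along the parabola
    \<open>(1 + t, - (3/2 * t + t^2))\<close>, and the line of \<open>a\<close> is its tangent of
    slope \<open>- (3/2 + 2 * t)\<close>. The constant 3/2 exceeds the coordinate 1 of
    \<open>q\<close>, which separates every \<open>a\<close> from \<open>q\<close>, and it is small
    enough to keep \<open>q\<close> adjacent to every \<open>g a\<close> for
    \<open>t \<le> 1/2\<close>.\<close>
  define x0 where "x0 z = (if z \<in> L then 0 else if z = q then 1
      else if z \<in> ?B then 1 + t (k z) else 3/2 + 2 * t z)" for z
  define h0 where "h0 z = (if z \<in> L \<or> z = q then 0
      else if z \<in> ?B then - (3/2 * t (k z) + (t (k z))\<^sup>2) else - (3/2 + 2 * t z + (t z)\<^sup>2))" for z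
  define x1 where "x1 z = (if z \<in> L then x z else 0)" for z
  \<comment> \<open>At order 0 a matching pair \<open>a\<close>, \<open>g a\<close> is tangent;
    order 1 raises it to adjacency. All other opposite pairs with an \<open>a\<close> are strictly
    negative at order 0.\<close>
  define h1 where "h1 z = (if z \<in> A then 1 else (0::real))" for z
  define h2 where "h2 z = (if z \<in> L then h z else 0)" for z
  have vL: "x0 z = 0" "h0 z = 0" "x1 z = x z" "h1 z = 0" "h2 z = h z" if "z \<in> L" for z
    using that disj unfolding x0_def h0_def x1_def h1_def h2_def by auto
  have vq: "x0 q = 1" "h0 q = 0" "x1 q = 0" "h1 q = 0" "h2 q = 0"
    using disj unfolding x0_def h0_def x1_def h1_def h2_def by auto
  have vB: "x0 (g a) = 1 + t a" "h0 (g a) = - (3/2 * t a + (t a)\<^sup>2)"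
    "x1 (g a) = 0" "h1 (g a) = 0" "h2 (g a) = 0" if "a \<in> A" for a
  proof -
    have "g a \<notin> L" "g a \<noteq> q" "g a \<in> ?B" "g a \<notin> A" using that disj qg by auto
    then show "x0 (g a) = 1 + t a" "h0 (g a) = - (3/2 * t a + (t a)\<^sup>2)"
      "x1 (g a) = 0" "h1 (g a) = 0" "h2 (g a) = 0"
      using k[OF that] unfolding x0_def h0_def x1_def h1_def h2_def by auto
  qed
  have vA: "x0 a = 3/2 + 2 * t a" "h0 a = - (3/2 + 2 * t a + (t a)\<^sup>2)"
    "x1 a = 0" "h1 a = 1" "h2 a = 0" if "a \<in> A" for a
  proof -
    have "a \<notin> L" "a \<noteq> q" "a \<notin> ?B" using that disj qg by auto
    then show "x0 a = 3/2 + 2 * t a" "h0 a = - (3/2 + 2 * t a + (t a)\<^sup>2)"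
      "x1 a = 0" "h1 a = 1" "h2 a = 0"
      using that unfolding x0_def h0_def x1_def h1_def h2_def by auto
  qed
  let ?ok = "pair_ok x0 x1 h0 h1 h2"
  note ok_def = pair_ok_def lexsgn_def lexpos_def
  have okLL: "?ok u w" if "u \<in> L" "w \<in> L" "opp u w" for u w
    using xh(1,2)[OF that(1,2)] that(3) by (cases "E u w") (auto simp: ok_def vL that(1,2))
  have okLq: "?ok z q" if "z \<in> L" "opp z q" for z
    using Lq[OF that] xh(3,4)[OF that(1)] by (auto simp: ok_def vL[OF that(1)] vq)
  have okLB: "?ok z (g a)" if z: "z \<in> L" and a: "a \<in> A" and o: "opp z (g a)" for z a
  proof (cases "a = a2")
    case True
    then show ?thesis
      using Lb2[OF z] o xh(3,4)[OF z] by (auto simp: ok_def vL[OF z] vB[OF assms(4)] t2)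
  next
    case False
    then have "0 < 3/2 * t a + (t a)\<^sup>2" using tpos[OF False] by (simp add: add_pos_nonneg)
    then show ?thesis using Lb[OF z a False] by (simp add: ok_def vL[OF z] vB[OF a])
  qed
  have okLA: "?ok z a" if z: "z \<in> L" and a: "a \<in> A" "a \<noteq> a1" for z a
  proof -
    have "0 < 3/2 + 2 * t a + (t a)\<^sup>2" using t0[of a] by (simp add: add_pos_nonneg)
    then show ?thesis using La[OF z a] by (simp add: ok_def vL[OF z] vA[OF a(1)])
  qed
  have okqB: "?ok q (g a)" if a: "a \<in> A" for a
  proof -
    have "(t a)\<^sup>2 \<le> (1/2)\<^sup>2" using t0[of a] tle2[of a] by (intro power_mono)
    then have "0 < - (3/2 * t a + (t a)\<^sup>2) + (1 + t a)"
      using tle2[of a] by (simp add: power2_eq_square)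
    then show ?thesis using qb[OF a] by (simp add: ok_def vq vB[OF a])
  qed
  have okAB: "?ok a (g b)" if a: "a \<in> A" and b: "b \<in> A" for a b
  proof -
    have e: "h0 a + h0 (g b) + x0 a * x0 (g b) = - (t a - t b)\<^sup>2"
      unfolding vA[OF a] vB[OF b] by (simp add: power2_eq_square algebra_simps)
    show ?thesis
    proof (cases "a = b")
      case True
      then show ?thesis using ab[OF a b] e by (simp add: ok_def vA(3-5)[OF b] vB(3-5)[OF b])
    next
      case False
      then have "0 < (t a - t b)\<^sup>2" using tinj[OF a b] by simp
      then show ?thesis using ab[OF a b] e False by (simp add: ok_def)
    qed
  qed
  have noqA: "\<not> opp q a" if "a \<in> A" for a using side that unfolding opp_def by blast
  have noAA: "\<not> opp a b" if "a \<in> A" "b \<in> A" for a b using side that unfolding opp_def by blast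
  have noBB: "\<not> opp (g a) (g b)" if "a \<in> A" "b \<in> A" for a b
    using side that unfolding opp_def by blast
  show ?thesis
  \<comment> \<open>On the side of \<open>q\<close>, 5/4 separates \<open>q\<close> at 1 from the
    \<open>a\<close> at 3/2 or more. On the other side, 11/8 separates \<open>g a1\<close> at 3/2
    from the other \<open>g a\<close>, which are at most 5/4.\<close>
  proof (rule rep_perturb[where c="\<lambda>s. if s = (q \<in> U) then 5/4 else 11/8"])
    show "finite (insert q (L \<union> g ` A \<union> (A - {a1})))" using fin assms(2) by simp
    fix u w
    assume u: "u \<in> insert q (L \<union> g ` A \<union> (A - {a1}))" and w: "w \<in> insert q (L \<union> g ` A \<union> (A - {a1}))"
      and o: "opp u w"
    have o': "opp w u" using o opp_commute by blast
    have nqq: "\<not> opp q q" unfolding opp_def by blast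
    consider "u = q" | "u \<in> L" | a where "a \<in> A" "u = g a" | "u \<in> A" "u \<noteq> a1" using u by blast
    then show "?ok u w \<or> ?ok w u"
    proof cases
      case 1
      then show ?thesis using w o o' okLq okqB noqA nqq by blast
    next
      case 2
      then show ?thesis using w o o' okLL okLq okLB okLA by blast
    next
      case 3
      consider "w = q" | "w \<in> L" | b where "b \<in> A" "w = g b" | "w \<in> A" "w \<noteq> a1" using w by blast
      then show ?thesis using 3 o o' okqB okLB okAB noBB by cases blast+
    next
      case 4
      consider "w = q" | "w \<in> L" | b where "b \<in> A" "w = g b" | "w \<in> A" "w \<noteq> a1" using w by blast
      then show ?thesis using 4 o o' noqA okLA okAB noAA by cases blast+
    qed
  next
    fix z assume z: "z \<in> insert q (L \<union> g ` A \<union> (A - {a1}))"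
    let ?goal = "lexsgn (z \<in> insert (g a1) (A - {a1}))
      (x0 z - (if (z \<in> U) = (q \<in> U) then 5/4 else 11/8)) (x1 z) 0"
    from z consider "z = q" | "z \<in> L" | a where "a \<in> A" "z = g a" | "z \<in> A" "z \<noteq> a1" by blast
    then show ?goal
    proof cases
      case 1
      moreover have "q \<noteq> g a1" "q \<notin> A" using qg disj assms(3) by auto
      ultimately show ?thesis by (simp add: vq lexsgn_def lexpos_def)
    next
      case 2
      then have "z \<noteq> g a1" "z \<notin> A" using disj assms(3) by auto
      then show ?thesis by (simp add: vL[OF 2] lexsgn_def lexpos_def)
    next
      case 3
      have "g a \<notin> A" using 3 qg by auto
      moreover have "g a = g a1 \<longleftrightarrow> a = a1" using 3 assms(3,6) unfolding inj_on_def by blast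
      ultimately show ?thesis
        using 3 side(2)[of a] tle[of a] t1 by (auto simp: vB lexsgn_def lexpos_def)
    next
      case 4
      then show ?thesis using side(1)[of z] t0[of z] by (simp add: vA lexsgn_def lexpos_def)
    qed
  qed
qed

text \<open>The vertices on side \<open>s\<close> are leaves. If the stars are numbered by their
  centres, \<open>1/4 - (n u - n w)^2 / 2\<close> is positive exactly for equal numbers, because the
  numbers are integers.\<close>

lemma rep_star_forest:
  assumes "finite F"
    and one: "\<And>u y z. u \<in> F \<Longrightarrow> y \<in> F \<Longrightarrow> z \<in> F \<Longrightarrow> (u \<in> U) = s \<Longrightarrow> E u y \<Longrightarrow> E u z \<Longrightarrow> y = z"
  shows "rep F {}"
proof -
  obtain f :: "'a \<Rightarrow> nat" where f: "inj_on f F"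
    using assms(1) finite_imp_inj_to_nat_seg by blast
  \<comment> \<open>The shift by 1 reserves the number 0 for leaves without a centre.\<close>
  define n where "n z = (if (z \<in> U) = s
     then (if \<exists>w\<in>F. E z w then real (f (SOME w. w \<in> F \<and> E z w)) + 1 else 0) else real (f z) + 1)" for z
  define h where "h z = - (n z)\<^sup>2 / 2 + 1/8" for z
  have form: "h u + h w + n u * n w = 1/4 - (n u - n w)\<^sup>2 / 2" for u w
    unfolding h_def by (simp add: power2_eq_square field_simps)
  have nE: "n u = n w" if "u \<in> F" "w \<in> F" "E u w" "(u \<in> U) = s" for u w
  proof -
    have "(SOME w. w \<in> F \<and> E u w) = w"
      using that one by (intro some_equality) blast+
    moreover have "(w \<in> U) \<noteq> s" using bip[OF that(3)] that(4) by blast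
    ultimately show ?thesis using that unfolding n_def by auto
  qed
  have nN: "1 \<le> (n u - n w)\<^sup>2" if uw: "u \<in> F" "w \<in> F" "opp u w" "\<not> E u w" "(u \<in> U) = s" for u w
  proof -
    have wn: "n w = real (f w) + 1" using uw unfolding n_def opp_def by auto
    obtain k where k: "n u = real k" "k \<noteq> f w + 1"
    proof (cases "\<exists>v\<in>F. E u v")
      case True
      let ?v = "SOME v. v \<in> F \<and> E u v"
      have "?v \<in> F \<and> E u ?v" using True someI_ex[of "\<lambda>v. v \<in> F \<and> E u v"] by blast
      then have "f ?v \<noteq> f w" using f uw unfolding inj_on_def by blast
      then show ?thesis using that[of "f ?v + 1"] True uw unfolding n_def by auto
    next
      case False
      then show ?thesis using that[of 0] uw unfolding n_def by auto
    qed
    have "n u - n w = of_int (int k - int (f w + 1))" using k wn by simp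
    moreover have "1 \<le> (int k - int (f w + 1))\<^sup>2"
      using k(2) by (metis (no_types, lifting) diff_eq_diff_eq diff_self int_one_le_iff_zero_less
          of_nat_eq_iff zero_less_power2)
    ultimately show ?thesis
      by (metis of_int_1 of_int_le_iff of_int_power)
  qed
  have "layout F n h"
    unfolding layout_def form
  proof (intro ballI impI)
    fix u w assume uw: "u \<in> F" "w \<in> F" "opp u w"
    consider "(u \<in> U) = s" | "(w \<in> U) = s" using uw(3) unfolding opp_def by blast
    then show "if E u w then 0 < 1 / 4 - (n u - n w)\<^sup>2 / 2 else 1 / 4 - (n u - n w)\<^sup>2 / 2 < 0"
    proof cases
      case 1
      then show ?thesis using nE[of u w] nN[of u w] uw by (auto simp: power2_eq_square)
    next
      case 2
      then show ?thesis using nE[of w u] nN[of w u] uw E_commute[of u w] opp_commute[of u w]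
        by (auto simp: power2_commute[of "n u"])
    qed
  qed
  moreover obtain c where "\<forall>z\<in>F. n z < c"
  proof -
    obtain b where "\<forall>y\<in>n ` F. y \<le> b"
      using bdd_above_finite[OF finite_imageI[OF assms(1)], of n] unfolding bdd_above_def by blast
    then show ?thesis using that[of "b + 1"] by fastforce
  qed
  ultimately show ?thesis
    using rep_threshold[OF assms(1), of n h "{}" "\<lambda>_. c"] by simp
qed

end

section \<open>Induced cycles, hexagons and theta graphs\<close>

context bip_graph
begin

section \<open>Induced cycles assembled from two induced paths\<close>

definition icycle :: "'a list \<Rightarrow> bool" where
  "icycle xs \<longleftrightarrow> 3 \<le> length xs \<and> distinct xs \<and>
     (\<forall>i<length xs. \<forall>j<length xs. E (xs ! i) (xs ! j) \<longleftrightarrow>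
        j = Suc i mod length xs \<or> i = Suc j mod length xs)"

definition ipath :: "'a list \<Rightarrow> bool" where
  "ipath xs \<longleftrightarrow> xs \<noteq> [] \<and> distinct xs \<and>
     (\<forall>i<length xs. \<forall>j<length xs. E (xs ! i) (xs ! j) \<longleftrightarrow> j = Suc i \<or> i = Suc j)"

lemma irrefl: "\<not> E x x"
  using bip by blast

lemma no_triangle: "E x y \<Longrightarrow> E y z \<Longrightarrow> \<not> E x z"
  using bip by blast

lemma ipath_single: "ipath [x]"
  by (simp add: ipath_def irrefl)

lemma ipath_Cons:
  assumes "ipath xs" "x \<notin> set xs" "\<And>y. y \<in> set xs \<Longrightarrow> E x y \<longleftrightarrow> y = hd xs"
  shows "ipath (x # xs)"
proof -
  have "E ((x # xs) ! i) ((x # xs) ! j) \<longleftrightarrow> j = Suc i \<or> i = Suc j"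
    if "i < length (x # xs)" "j < length (x # xs)" for i j
  proof -
    have *: "E x (xs ! k) \<longleftrightarrow> k = 0" if "k < length xs" for k
      using assms(1,3) that
      by (auto simp: ipath_def hd_conv_nth nth_eq_iff_index_eq)
    show ?thesis
    proof (cases i)
      case 0
      then show ?thesis using * that irrefl by (cases j) auto
    next
      case (Suc i')
      then show ?thesis
        using * that assms(1) E_commute[of x] by (cases j) (auto simp: ipath_def)
    qed
  qed
  then show ?thesis using assms(1,2) by (auto simp: ipath_def)
qed

text \<open>In a ring formed by two induced paths only the pairs between the paths remain to be
  checked. Every later use of the forbidden cycles goes through this form.\<close>

lemma icycle_append:
  assumes xs: "ipath xs" and ys: "ipath ys" and disj: "set xs \<inter> set ys = {}"
    and len: "3 \<le> length xs + length ys"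
    and cross: "\<And>x y. x \<in> set xs \<Longrightarrow> y \<in> set ys \<Longrightarrow>
      E x y \<longleftrightarrow> x = last xs \<and> y = hd ys \<or> x = hd xs \<and> y = last ys"
  shows "icycle (xs @ ys)"
proof -
  let ?a = "length xs" and ?b = "length ys"
  let ?n = "length (xs @ ys)"
  have pos: "0 < ?a" "0 < ?b" and dist: "distinct xs" "distinct ys"
    using xs ys by (auto simp: ipath_def)
  have cr: "E (xs ! i) (ys ! j) \<longleftrightarrow> i = ?a - 1 \<and> j = 0 \<or> i = 0 \<and> j = ?b - 1"
    if "i < ?a" "j < ?b" for i j
    using cross[of "xs ! i" "ys ! j"] that pos dist
    by (simp add: last_conv_nth hd_conv_nth nth_eq_iff_index_eq)
  have md: "(j = Suc i mod n \<or> i = Suc j mod n) \<longleftrightarrow> j = Suc i \<or> i = 0 \<and> Suc j = n"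
    if "3 \<le> n" "j < n" "i \<le> j" for i j n :: nat
  proof -
    have m: "Suc k mod n = (if Suc k = n then 0 else Suc k)" if "k < n" for k
      using that by auto
    show ?thesis using that m[of i] m[of j] by auto
  qed
  have half: "E ((xs @ ys) ! i) ((xs @ ys) ! j) \<longleftrightarrow> j = Suc i mod ?n \<or> i = Suc j mod ?n"
    if "i < ?n" "j < ?n" "i \<le> j" for i j
  proof -
    have n: "?n = ?a + ?b" by simp
    have 3: "3 \<le> ?n" using len by simp
    consider "j < ?a" | "i < ?a" "?a \<le> j" | "?a \<le> i" using that by linarith
    then show ?thesis
    proof cases
      case 1
      then have *: "E ((xs @ ys) ! i) ((xs @ ys) ! j) \<longleftrightarrow> j = Suc i \<or> i = Suc j"
        using xs that by (simp add: nth_append ipath_def)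
      show ?thesis
        unfolding md[OF 3 that(2,3)] * using 1 that(3) pos n by arith
    next
      case 2
      then have *: "E ((xs @ ys) ! i) ((xs @ ys) ! j) \<longleftrightarrow>
          i = ?a - 1 \<and> j - ?a = 0 \<or> i = 0 \<and> j - ?a = ?b - 1"
        using cr[of i "j - ?a"] that by (auto simp: nth_append)
      show ?thesis
        unfolding md[OF 3 that(2,3)] * using 2 that pos n by arith
    next
      case 3
      then have *: "E ((xs @ ys) ! i) ((xs @ ys) ! j) \<longleftrightarrow> j - ?a = Suc (i - ?a) \<or> i - ?a = Suc (j - ?a)"
        using ys that by (simp add: nth_append ipath_def)
      show ?thesis
        unfolding md[OF \<open>3 \<le> ?n\<close> that(2,3)] * using 3 that pos n by arith
    qed
  qed
  have "E ((xs @ ys) ! i) ((xs @ ys) ! j) \<longleftrightarrow> j = Suc i mod ?n \<or> i = Suc j mod ?n"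
    if "i < ?n" "j < ?n" for i j
  proof (cases "i \<le> j")
    case False
    then show ?thesis using half[of j i] that sym by (meson nat_le_linear)
  qed (use half that in blast)
  then show ?thesis
    using len dist disj unfolding icycle_def by auto
qed

section \<open>Components and shortest paths\<close>

definition rel :: "'a set \<Rightarrow> ('a \<times> 'a) set" where
  "rel K = {(x, y). E x y \<and> x \<in> K \<and> y \<in> K}"

definition conn :: "'a set \<Rightarrow> bool" where
  "conn K \<longleftrightarrow> (\<forall>x\<in>K. \<forall>y\<in>K. (x, y) \<in> (rel K)\<^sup>*)"

definition comp :: "'a set \<Rightarrow> 'a \<Rightarrow> 'a set" where
  "comp S x = {y. (x, y) \<in> (rel S)\<^sup>*}"

lemma rel_sym: "(x, y) \<in> (rel S)\<^sup>* \<Longrightarrow> (y, x) \<in> (rel S)\<^sup>*"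
proof -
  have "sym_on UNIV (rel S)" unfolding rel_def by (auto intro: symI sym)
  then show "(x, y) \<in> (rel S)\<^sup>* \<Longrightarrow> (y, x) \<in> (rel S)\<^sup>*"
    using sym_rtrancl by (metis symE)
qed

lemma comp_self: "x \<in> comp S x"
  unfolding comp_def by simp

lemma comp_subset: "x \<in> S \<Longrightarrow> comp S x \<subseteq> S"
proof
  fix y assume "x \<in> S" "y \<in> comp S x"
  then have "(x, y) \<in> (rel S)\<^sup>*" unfolding comp_def by simp
  then show "y \<in> S" using \<open>x \<in> S\<close> by induction (auto simp: rel_def)
qed

lemma comp_closed: "x \<in> S \<Longrightarrow> y \<in> comp S x \<Longrightarrow> E y z \<Longrightarrow> z \<in> S \<Longrightarrow> z \<in> comp S x"
  using comp_subset[of x S] unfolding comp_def rel_def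
  by (auto intro: rtrancl.rtrancl_into_rtrancl)

lemma conn_closed:
  assumes "conn K" "x \<in> K" "x \<in> A" "\<And>y z. y \<in> K \<Longrightarrow> y \<in> A \<Longrightarrow> z \<in> K \<Longrightarrow> E y z \<Longrightarrow> z \<in> A"
  shows "K \<subseteq> A"
proof
  fix y assume "y \<in> K"
  then have "(x, y) \<in> (rel K)\<^sup>*" using assms(1,2) unfolding conn_def by blast
  then show "y \<in> A" by induction (use assms in \<open>auto simp: rel_def\<close>)
qed

lemma conn_comp:
  assumes "x \<in> S"
  shows "conn (comp S x)"
proof -
  have *: "(x, y) \<in> (rel (comp S x))\<^sup>*" if "(x, y) \<in> (rel S)\<^sup>*" for y
    using that
  proof induction
    case (step y z)
    then have "y \<in> comp S x" "z \<in> comp S x"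
      by (auto simp: comp_def intro: rtrancl.rtrancl_into_rtrancl)
    then have "(y, z) \<in> rel (comp S x)" using step(2) by (simp add: rel_def)
    with step(3) show ?case by (rule rtrancl.rtrancl_into_rtrancl)
  qed simp
  show ?thesis
    unfolding conn_def
  proof (intro ballI)
    fix y z assume "y \<in> comp S x" "z \<in> comp S x"
    then have "(x, y) \<in> (rel (comp S x))\<^sup>*" "(x, z) \<in> (rel (comp S x))\<^sup>*"
      using * by (auto simp: comp_def)
    then show "(y, z) \<in> (rel (comp S x))\<^sup>*"
      using rel_sym rtrancl_trans by metis
  qed
qed

lemma conn_subset_comp:
  assumes "conn K" "K \<subseteq> S" "x \<in> K"
  shows "K \<subseteq> comp S x"
  by (rule conn_closed[OF assms(1,3) comp_self]) (use assms comp_closed in blast)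

lemma comp_eq:
  assumes "x \<in> S" "y \<in> comp S x"
  shows "comp S y = comp S x"
proof -
  have "(x, y) \<in> (rel S)\<^sup>*" "(y, x) \<in> (rel S)\<^sup>*"
    using assms(2) rel_sym by (auto simp: comp_def)
  then show ?thesis unfolding comp_def by (auto intro: rtrancl_trans)
qed

lemma comp_edge:
  assumes "x \<in> S" "y \<in> S" "comp S x \<noteq> comp S y" "u \<in> comp S x" "w \<in> comp S y"
  shows "\<not> E u w"
proof
  assume "E u w"
  moreover have "w \<in> S" using comp_subset[OF assms(2)] assms(5) by blast
  ultimately have "w \<in> comp S x" using comp_closed[OF assms(1,4)] by blast
  then show False using comp_eq[OF assms(1)] comp_eq[OF assms(2,5)] assms(3) by blast
qed

text \<open>The path is a shortest one among all paths in \<open>K\<close> from \<open>A\<close> to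
  \<open>B\<close>, not only among those from \<open>a\<close> to \<open>b\<close>. Cutting it at an
  inner vertex of \<open>A\<close> or \<open>B\<close>, or along a chord, would shorten it.\<close>

lemma shortest_path:
  assumes K: "conn K" and A: "a \<in> A" "a \<in> K" and B: "b \<in> B" "b \<in> K"
  obtains p where "ipath p" "set p \<subseteq> K" "hd p \<in> A" "last p \<in> B"
    "\<And>y. y \<in> set p \<Longrightarrow> y \<in> A \<Longrightarrow> y = hd p" "\<And>y. y \<in> set p \<Longrightarrow> y \<in> B \<Longrightarrow> y = last p"
proof -
  define P where "P p \<longleftrightarrow> p \<noteq> [] \<and> successively E p \<and> set p \<subseteq> K \<and> hd p \<in> A \<and> last p \<in> B" for p
  have "(a, b) \<in> (rel K)\<^sup>*" using K A B unfolding conn_def by blast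
  then have "\<exists>p. p \<noteq> [] \<and> successively E p \<and> set p \<subseteq> K \<and> hd p = a \<and> last p = b"
  proof (induction rule: converse_rtrancl_induct)
    case base
    then show ?case using B by (intro exI[of _ "[b]"]) simp
  next
    case (step y z)
    then obtain p where p: "p \<noteq> []" "successively E p" "set p \<subseteq> K" "hd p = z" "last p = b" by blast
    then show ?case using step(1)
      by (intro exI[of _ "y # p"]) (auto simp: rel_def successively_Cons)
  qed
  then obtain p0 where "P p0" using A B unfolding P_def by auto
  then obtain p where p: "P p" and min: "\<And>q. P q \<Longrightarrow> length p \<le> length q"
    using ex_has_least_nat[of P p0 length] by blast
  let ?n = "length p"
  have ne: "p \<noteq> []" and succ: "successively E p" and sub: "set p \<subseteq> K"
    and hdA: "hd p \<in> A" and lastB: "last p \<in> B"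
    using p unfolding P_def by auto
  have edge: "E (p ! i) (p ! Suc i)" if "Suc i < ?n" for i
    using succ that by (simp add: successively_conv_nth)
  have st: "successively E (take k p)" "successively E (drop k p)" for k
    using succ successively_append_iff[of E "take k p" "drop k p"] by simp_all
  have inA: "i = 0" if "i < ?n" "p ! i \<in> A" for i
  proof -
    have "P (drop i p)"
      using that st[of i] sub lastB set_drop_subset[of i p] unfolding P_def
      by (auto simp: hd_drop_conv_nth)
    from min[OF this] show ?thesis using that by simp
  qed
  have inB: "Suc i = ?n" if "i < ?n" "p ! i \<in> B" for i
  proof -
    have "hd (take (Suc i) p) = hd p" using ne by (cases p) auto
    moreover have "last (take (Suc i) p) = p ! i" using that by (simp add: take_Suc_conv_app_nth)
    ultimately have "P (take (Suc i) p)"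
      using that st(1)[of "Suc i"] sub hdA ne set_take_subset[of "Suc i" p] unfolding P_def by auto
    from min[OF this] show ?thesis using that by simp
  qed
  have chord: "j \<le> Suc i" if "i < j" "j < ?n" "E (p ! i) (p ! j)" for i j
  proof -
    let ?q = "take (Suc i) p @ drop j p"
    have "last (take (Suc i) p) = p ! i" using that by (simp add: take_Suc_conv_app_nth)
    moreover have "hd (drop j p) = p ! j" using that by (simp add: hd_drop_conv_nth)
    ultimately have "successively E ?q"
      using st that(3) by (simp add: successively_append_iff)
    moreover have "hd ?q = hd p" using ne by (cases p) auto
    moreover have "last ?q = last p" using that by simp
    moreover have "set ?q \<subseteq> K" using sub set_take_subset[of "Suc i" p] set_drop_subset[of j p] by auto
    ultimately have "P ?q" using hdA lastB ne unfolding P_def by simp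
    from min[OF this] show ?thesis using that by simp
  qed
  \<comment> \<open>Either the chord argument applies to the first occurrence and the successor of
    the second, or the second is the last vertex and then the first already lies in
    \<open>B\<close>.\<close>
  have neq: "p ! i \<noteq> p ! j" if "i < j" "j < ?n" for i j
  proof
    assume eq: "p ! i = p ! j"
    show False
    proof (cases "Suc j < ?n")
      case True
      then have "E (p ! i) (p ! Suc j)" using edge[of j] eq by simp
      from chord[OF _ True this] that show False by simp
    next
      case False
      then have "j = ?n - 1" using that by simp
      then have "p ! j \<in> B" using lastB ne by (simp add: last_conv_nth)
      then have "Suc i = ?n" using inB[of i] eq that by simp
      then show False using that by simp
    qed
  qed
  have half: "E (p ! i) (p ! j) \<longleftrightarrow> j = Suc i" if "i < j" "j < ?n" for i j
    using chord[OF that] edge[of i] that by (auto simp: le_Suc_eq)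
  have "E (p ! i) (p ! j) \<longleftrightarrow> j = Suc i \<or> i = Suc j" if "i < ?n" "j < ?n" for i j
    using half[of i j] half[of j i] that irrefl E_commute[of "p ! i"]
    by (cases i j rule: linorder_cases) auto
  moreover have "distinct p"
    using neq by (metis distinct_conv_nth linorder_neqE_nat)
  ultimately have "ipath p" using ne unfolding ipath_def by blast
  moreover have "y = hd p" if "y \<in> set p" "y \<in> A" for y
    using that inA ne by (metis hd_conv_nth in_set_conv_nth)
  moreover have "y = last p" if "y \<in> set p" "y \<in> B" for y
    using that inB ne by (metis diff_Suc_1 in_set_conv_nth last_conv_nth)
  ultimately show ?thesis using that sub hdA lastB by blast
qed

definition nonfull :: "'a \<Rightarrow> 'a set \<Rightarrow> bool" where
  "nonfull v K \<longleftrightarrow> (\<exists>y\<in>K. opp v y \<and> \<not> E v y)"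

text \<open>This yields a leg of an \<open>S_3_3_3\<close> centred at \<open>v\<close>. If walks of
  length 2 inside \<open>K\<close> never lead from a neighbour of \<open>v\<close> to a
  non-neighbour, then the neighbours of \<open>v\<close> and the vertices next to them form a closed
  set, hence all of \<open>K\<close>.\<close>

lemma nonfull_path:
  assumes "conn K" "k \<in> K" "E v k" "nonfull v K"
  shows "\<exists>k1\<in>K. \<exists>k2\<in>K. \<exists>k3\<in>K. E v k1 \<and> E k1 k2 \<and> E k2 k3 \<and> \<not> E v k3"
proof (rule ccontr)
  assume none: "\<not> ?thesis"
  then have no: "E v k3" if "k1 \<in> K" "k2 \<in> K" "k3 \<in> K" "E v k1" "E k1 k2" "E k2 k3" for k1 k2 k3
    using none that by blast
  have "K \<subseteq> {z. if opp v z then E v z else \<exists>z0\<in>K. E v z0 \<and> E z0 z}"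
  proof (rule conn_closed[OF assms(1,2)])
    show "k \<in> {z. if opp v z then E v z else \<exists>z0\<in>K. E v z0 \<and> E z0 z}"
      using E_opp[OF assms(3)] assms(3) by simp
    fix y z assume yz: "y \<in> K" "z \<in> K" "E y z"
      and y: "y \<in> {z. if opp v z then E v z else \<exists>z0\<in>K. E v z0 \<and> E z0 z}"
    have o: "opp v z \<longleftrightarrow> \<not> opp v y" using E_opp[OF yz(3)] unfolding opp_def by blast
    show "z \<in> {z. if opp v z then E v z else \<exists>z0\<in>K. E v z0 \<and> E z0 z}"
    proof (cases "opp v y")
      case True
      then have "E v y" using y by simp
      then show ?thesis using yz o True by auto
    next
      case False
      then obtain z0 where "z0 \<in> K" "E v z0" "E z0 y" using y by auto
      then have "E v z" using no yz by blast
      then show ?thesis using o False by simp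
    qed
  qed
  then show False using assms(4) unfolding nonfull_def by (auto split: if_splits)
qed

text \<open>In a \<open>hex_graph\<close> such a cycle is induced, since a chord would close a
  4-cycle; see \<open>hex_opposite\<close>.\<close>

definition hex :: "'a \<Rightarrow> 'a \<Rightarrow> 'a \<Rightarrow> 'a \<Rightarrow> 'a \<Rightarrow> 'a \<Rightarrow> bool" where
  "hex a b c d e f \<longleftrightarrow> distinct [a, b, c, d, e, f] \<and>
     E a b \<and> E b c \<and> E c d \<and> E d e \<and> E e f \<and> E f a"

lemma hex_rot: "hex a b c d e f \<Longrightarrow> hex b c d e f a"
  unfolding hex_def by auto

lemma hex_flip: "hex a b c d e f \<Longrightarrow> hex b a f e d c"
  unfolding hex_def using sym by auto

lemma hex_sides:
  assumes "hex a b c d e f"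
  shows "c \<in> U \<longleftrightarrow> a \<in> U" "e \<in> U \<longleftrightarrow> a \<in> U" "b \<in> U \<longleftrightarrow> a \<notin> U" "d \<in> U \<longleftrightarrow> a \<notin> U" "f \<in> U \<longleftrightarrow> a \<notin> U"
  using assms bip unfolding hex_def by blast+

definition thin :: "'a \<Rightarrow> 'a \<Rightarrow> 'a \<Rightarrow> bool" where
  "thin c p q \<longleftrightarrow> (\<forall>y. E c y \<longrightarrow> y = p \<or> y = q)"

lemma thin_commute: "thin c p q \<longleftrightarrow> thin c q p"
  unfolding thin_def by blast

text \<open>\<open>P\<close> and \<open>Q\<close> are the poles of a theta graph that consists of all paths \<open>P, a, b, Q\<close>.  Only
  the edges \<open>P a1\<close> and \<open>Q b2\<close> are allowed to have further neighbours.\<close>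

definition good_theta :: "'a \<Rightarrow> 'a \<Rightarrow> 'a \<Rightarrow> 'a \<Rightarrow> 'a \<Rightarrow> 'a \<Rightarrow> bool" where
  "good_theta P Q a1 b1 a2 b2 \<longleftrightarrow> hex P a1 b1 Q b2 a2 \<and>
     (\<forall>a b. E P a \<and> E a b \<and> E b Q \<longrightarrow> (a \<noteq> a1 \<longrightarrow> thin a P b) \<and> (b \<noteq> b2 \<longrightarrow> thin b Q a)) \<and>
     (\<forall>x y. E a1 x \<and> E x y \<and> E y b2 \<longrightarrow> x = P \<or> x = b1)"

definition theta :: "'a \<Rightarrow> 'a \<Rightarrow> 'a set" where
  "theta P Q = {P, Q} \<union> {a. \<exists>b. E P a \<and> E a b \<and> E b Q} \<union> {b. \<exists>a. E P a \<and> E a b \<and> E b Q}"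

lemma theta_commute: "theta P Q = theta Q P"
  unfolding theta_def using sym by blast

end

section \<open>Graphs whose induced cycles are all hexagons\<close>

locale hex_graph = bip_graph U E for U :: "'a set" and E +
  fixes V :: "'a set"
  assumes finV: "finite V"
    and E_V: "E x y \<Longrightarrow> x \<in> V"
    and cycle_length: "icycle xs \<Longrightarrow> length xs = 6"
begin

lemma two_paths:
  assumes "ipath xs" "ipath ys" "set xs \<inter> set ys = {}" "3 \<le> length xs + length ys"
    and "\<And>x y. x \<in> set xs \<Longrightarrow> y \<in> set ys \<Longrightarrow>
      E x y \<longleftrightarrow> x = last xs \<and> y = hd ys \<or> x = hd xs \<and> y = last ys"
  shows "length xs + length ys = 6"
  using cycle_length[OF icycle_append[OF assms]] by simp

lemma ipath2: "E a b \<Longrightarrow> ipath [a, b]"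
  by (rule ipath_Cons[OF ipath_single]) (use irrefl in auto)

lemma ipath3: "E a b \<Longrightarrow> E b c \<Longrightarrow> a \<noteq> c \<Longrightarrow> ipath [a, b, c]"
  using no_triangle[of a b c] irrefl by (intro ipath_Cons[OF ipath2]) auto

lemma ipath4: "E a b \<Longrightarrow> E b c \<Longrightarrow> E c d \<Longrightarrow> a \<noteq> c \<Longrightarrow> b \<noteq> d \<Longrightarrow> \<not> E a d \<Longrightarrow> ipath [a, b, c, d]"
  using no_triangle[of a b c] E_commute[of c d] by (intro ipath_Cons[OF ipath3]) auto

text \<open>Otherwise \<open>a, b, c, d\<close> is a 4-cycle, induced because the graph is
  bipartite.\<close>

lemma common_nbr:
  assumes "E a b" "E b c" "E a d" "E d c" "a \<noteq> c"
  shows "b = d"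
proof (rule ccontr)
  assume "b \<noteq> d"
  have "length [a, b] + length [c, d] = 6"
    by (rule two_paths)
       (use assms \<open>b \<noteq> d\<close> irrefl no_triangle[of a b c] no_triangle[of b a d] ipath2[OF assms(1)]
          ipath2[OF sym[OF assms(4)]] sym[OF assms(1)] in auto)
  then show False by simp
qed

lemma hex_opposite: "hex a b c d e f \<Longrightarrow> \<not> E a d"
  using common_nbr[of a b c d] sym unfolding hex_def by auto

lemma hex_nbr:
  assumes "hex a b c d e f" "E a y" "y \<in> {a, b, c, d, e, f}"
  shows "y = b \<or> y = f"
  using assms hex_opposite[OF assms(1)] hex_sides[OF assms(1)] bip[OF assms(2)] by auto

text \<open>Two vertices of a hexagon on the same side have a common neighbour on it, so
  \<open>x\<close> would close a 4-cycle with them.\<close>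

lemma hex_one_nbr:
  assumes "hex a b c d e f" "x \<notin> {a, b, c, d, e, f}" "p \<in> {a, b, c, d, e, f}" "q \<in> {a, b, c, d, e, f}"
    and "E x p" "E x q"
  shows "p = q"
proof (rule ccontr)
  assume ne: "p \<noteq> q"
  have same: "p \<in> U \<longleftrightarrow> q \<in> U" using bip[OF assms(5)] bip[OF assms(6)] by blast
  have h: "E a b" "E b c" "E c d" "E d e" "E e f" "E f a" using assms(1) unfolding hex_def by auto
  have "\<exists>r\<in>{a, b, c, d, e, f}. E p r \<and> E r q"
    using assms(3,4) ne same hex_sides[OF assms(1)] h h[THEN sym] by auto
  then obtain r where "r \<in> {a, b, c, d, e, f}" "E p r" "E r q" by blast
  then show False using common_nbr[of p r q x] assms(2,5,6) ne sym by blast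
qed

end

text \<open>Below, a vertex of a hexagon is called fat if it has a neighbour off the hexagon.
  \<open>no_3c\<close> forbids three consecutive fat vertices and \<open>no_3nc\<close> three
  alternating ones; all further non-edges of these configurations follow from the two sides and the
  absence of 4-cycles.\<close>

locale x_graph = hex_graph U E V for U :: "'a set" and E V +
  assumes no_S333: "\<lbrakk>E c x1; E x1 x2; E x2 x3; \<not> E c x3; E c y1; E y1 y2; E y2 y3; \<not> E c y3;
       E c z1; E z1 z2; E z2 z3; \<not> E c z3;
       {x1, x2, x3} \<inter> {y1, y2, y3} = {}; {x1, x2, x3} \<inter> {z1, z2, z3} = {};
       {y1, y2, y3} \<inter> {z1, z2, z3} = {};
       \<And>x y. x \<in> {x1, x2, x3} \<Longrightarrow> y \<in> {y1, y2, y3} \<Longrightarrow> \<not> E x y;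
       \<And>x z. x \<in> {x1, x2, x3} \<Longrightarrow> z \<in> {z1, z2, z3} \<Longrightarrow> \<not> E x z;
       \<And>y z. y \<in> {y1, y2, y3} \<Longrightarrow> z \<in> {z1, z2, z3} \<Longrightarrow> \<not> E y z\<rbrakk> \<Longrightarrow> False"
    and no_3c: "\<lbrakk>hex a b c d e f; x \<notin> {a, b, c, d, e, f}; y \<notin> {a, b, c, d, e, f};
       z \<notin> {a, b, c, d, e, f}; E a x; E b y; E c z\<rbrakk> \<Longrightarrow> False"
    and no_3nc: "\<lbrakk>hex a b c d e f; x \<notin> {a, b, c, d, e, f}; y \<notin> {a, b, c, d, e, f};
       z \<notin> {a, b, c, d, e, f}; E a x; E c y; E e z\<rbrakk> \<Longrightarrow> False"
    and no_2l2: "\<lbrakk>hex a b c d e f; x \<notin> {a, b, c, d, e, f}; y \<notin> {a, b, c, d, e, f};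
       x' \<notin> {a, b, c, d, e, f}; y' \<notin> {a, b, c, d, e, f};
       E a x; E x x'; E b y; E y y'; \<not> E x' d; \<not> E y' e; \<not> E x' y'\<rbrakk> \<Longrightarrow> False"
begin

text \<open>\<open>a, x, x', d, e, y', y, b\<close> would be an induced cycle of length 8. Facts 1
  to 6 exclude the chords between its two halves.\<close>

lemma two_antipodal_paths:
  assumes h: "hex a b c d e f"
    and x: "E a x" "E x x'" "E x' d" "x \<noteq> b" "x \<noteq> f"
    and y: "E b y" "E y y'" "E y' e" "y \<noteq> a" "y \<noteq> c"
  shows False
proof -
  note hE = h[unfolded hex_def]
  note hn = hex_opposite[OF h] hex_opposite[OF hex_rot[OF h]]
  note sd = hex_sides[OF h] bip[OF x(1)] bip[OF x(2)] bip[OF y(1)] bip[OF y(2)]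
  have sd: "b \<in> U \<longleftrightarrow> a \<notin> U" "d \<in> U \<longleftrightarrow> a \<notin> U" "e \<in> U \<longleftrightarrow> a \<in> U"
    "x \<in> U \<longleftrightarrow> a \<notin> U" "x' \<in> U \<longleftrightarrow> a \<in> U" "y \<in> U \<longleftrightarrow> a \<in> U" "y' \<in> U \<longleftrightarrow> a \<notin> U"
    using hex_sides[OF h] bip[OF x(1)] bip[OF x(2)] bip[OF y(1)] bip[OF y(2)] by blast+
  have same: "\<not> E p q" if "(p \<in> U) = (q \<in> U)" for p q using bip that by blast
  have es: "E a b" "E b c" "E c d" "E d e" "E e f" "E f a"
    "E b a" "E c b" "E d c" "E e d" "E f e" "E a f"
    and ds: "a \<noteq> b" "a \<noteq> c" "a \<noteq> d" "a \<noteq> e" "a \<noteq> f" "b \<noteq> c" "b \<noteq> d" "b \<noteq> e" "b \<noteq> f" "c \<noteq> d" "d \<noteq> e"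
    using hE sym by auto
  note xy = x y x(1-3)[THEN sym] y(1-3)[THEN sym]
  have 1: "\<not> E a y'"
    using common_nbr[of a y' e f] common_nbr[of b y f a] es ds xy by metis
  have 2: "\<not> E x e" using common_nbr[of a x e f] es ds xy by metis
  have 3: "\<not> E x y" using common_nbr[of a x y b] es ds xy by metis
  have 4: "\<not> E x' b" using common_nbr[of x' b c d] common_nbr[of a x c b] es ds xy by metis
  have 5: "\<not> E d y" using common_nbr[of d y b c] es ds xy by metis
  have 6: "\<not> E x' y'" using common_nbr[of x' y' e d] es ds xy 2 5 sym by metis
  have p1: "ipath [a, x, x', d]"
    using x hn es ds 4 sym by (intro ipath4) (metis+)
  have p2: "ipath [e, y', y, b]"
    using xy hn es ds 1 sym by (intro ipath4) (metis+)
  have "length [a, x, x', d] + length [e, y', y, b] = 6"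
  proof (rule two_paths[OF p1 p2])
    show "set [a, x, x', d] \<inter> set [e, y', y, b] = {}"
      using ds xy sd 1 2 3 4 5 6 sym by auto
    show "E p q \<longleftrightarrow> p = last [a, x, x', d] \<and> q = hd [e, y', y, b] \<or>
        p = hd [a, x, x', d] \<and> q = last [e, y', y, b]"
      if "p \<in> set [a, x, x', d]" "q \<in> set [e, y', y, b]" for p q
    proof -
      have "d \<noteq> a" "d \<noteq> x'" "b \<noteq> e" "b \<noteq> y'" "x \<noteq> a" "e \<noteq> y'" "b \<noteq> y"
        using ds sd es 1 by auto
      moreover have "x \<noteq> d" "e \<noteq> y" "x' \<noteq> a" using hn xy by blast+
      ultimately show ?thesis
        using that 1 2 3 4 5 6 es sd same[of a e] same[of a y] same[of x y'] same[of x b]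
          same[of x' e] same[of x' y] same[of d y'] same[of d b]
        by auto
    qed
  qed simp
  then show False by simp
qed

section \<open>Good theta graphs\<close>

lemma theta_hex:
  assumes "E P a" "E a b" "E b Q" "E P a'" "E a' b'" "E b' Q" "\<not> E P Q" "a \<noteq> a'"
  shows "hex P a b Q b' a'"
proof -
  have "P \<noteq> b" "P \<noteq> b'" using assms sym by blast+
  moreover have "b \<noteq> b'" using common_nbr[of P a b a'] assms calculation sym by blast
  moreover have "a \<noteq> Q" "a' \<noteq> Q" using assms by auto
  moreover have "(a \<in> U) \<noteq> (P \<in> U)" "(a' \<in> U) \<noteq> (P \<in> U)" "(b \<in> U) = (P \<in> U)"
    "(b' \<in> U) = (P \<in> U)" "(Q \<in> U) \<noteq> (P \<in> U)"
    using assms bip by blast+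
  ultimately show ?thesis using assms sym unfolding hex_def by auto
qed

lemma not_thin_hex:
  assumes "hex a b c d e f" "\<not> thin a b f"
  shows "\<exists>y. E a y \<and> y \<notin> {a, b, c, d, e, f}"
  using assms hex_nbr[OF assms(1)] unfolding thin_def by blast

text \<open>This symmetry carries every fact about the open edge \<open>P a1\<close> over to
  \<open>Q b2\<close>. The last clause of \<open>good_theta\<close> bounds only the vertex next to
  \<open>a1\<close>; for the vertex next to \<open>b2\<close> the bound follows because two vertices
  have at most one common neighbour.\<close>

lemma good_theta_reverse:
  assumes "good_theta P Q a1 b1 a2 b2"
  shows "good_theta Q P b2 a2 b1 a1"
proof -
  have h: "hex P a1 b1 Q b2 a2" using assms unfolding good_theta_def by blast
  have es: "E P a1" "E a1 b1" "E b1 Q" "E Q b2" "E b2 a2" "E a2 P" and ds: "P \<noteq> b2" "a1 \<noteq> Q"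
    using h unfolding hex_def by auto
  have "hex Q b2 a2 P a1 b1" using h unfolding hex_def by auto
  moreover have "(b \<noteq> b2 \<longrightarrow> thin b Q a) \<and> (a \<noteq> a1 \<longrightarrow> thin a P b)" if "E Q b" "E b a" "E a P" for a b
    using assms that sym unfolding good_theta_def by blast
  moreover have "x = Q \<or> x = a2" if x: "E b2 x" "E x y" "E y a1" for x y
  proof -
    have "y = P \<or> y = b1" using assms x sym unfolding good_theta_def by blast
    then show ?thesis
    proof
      assume "y = P"
      then show ?thesis using common_nbr[of b2 x P a2] x es ds sym by blast
    next
      assume "y = b1"
      moreover have "b2 \<noteq> b1" using h unfolding hex_def by auto
      ultimately show ?thesis using common_nbr[of b2 x b1 Q] x es sym by blast
    qed
  qed
  ultimately show ?thesis unfolding good_theta_def by blast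
qed

text \<open>Because of a third path both poles are fat in every hexagon of the theta graph. So
  \<open>no_3c\<close> allows at most one fat inner vertex next to \<open>P\<close>, at most one
  next to \<open>Q\<close>, and not both on the same path. They become \<open>a1\<close> and
  \<open>b2\<close>. Another path \<open>a1, x, y, b2\<close> is excluded by
  \<open>two_antipodal_paths\<close>, applied with a third path between the poles.\<close>

lemma good_theta_of_three_paths:
  assumes h: "hex P a b Q b' a'" and x: "E P x" "E x y" "E y Q" "x \<noteq> a" "x \<noteq> a'"
  obtains a1 b1 a2 b2 where "good_theta P Q a1 b1 a2 b2" "\<not> thin a P b \<Longrightarrow> a1 = a"
proof -
  define T where "T p q \<longleftrightarrow> E P p \<and> E p q \<and> E q Q" for p q
  have nPQ: "\<not> E P Q" using hex_opposite[OF h] .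
  have T0: "T a b" "T a' b'" "T x y" "a \<noteq> a'" "x \<noteq> a" "x \<noteq> a'"
    using h x sym unfolding hex_def T_def by auto
  have hexT: "hex P p q Q q' p'" if "T p q" "T p' q'" "p \<noteq> p'" for p q p' q'
    using theta_hex that nPQ unfolding T_def by blast
  have third: "\<exists>r s. T r s \<and> r \<noteq> p \<and> r \<noteq> p'" for p p'
    using T0 by metis
  have out: "\<exists>z. E P z \<and> z \<notin> {P, p, q, Q, q', p'}" and outQ: "\<exists>z. E Q z \<and> z \<notin> {P, p, q, Q, q', p'}"
    if "T p q" "T p' q'" "p \<noteq> p'" for p q p' q'
  proof -
    obtain r s where r: "T r s" "r \<noteq> p" "r \<noteq> p'" using third by blast
    note hh = hexT[OF that]
    have "\<not> thin P p p'" using r unfolding T_def thin_def by blast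
    then show "\<exists>z. E P z \<and> z \<notin> {P, p, q, Q, q', p'}" using not_thin_hex[OF hh] by auto
    have "s \<noteq> q" "s \<noteq> q'"
      using hexT[OF that(1) r(1)] hexT[OF that(2) r(1)] r unfolding hex_def by auto
    then have "\<not> thin Q q' q" using r sym unfolding T_def thin_def by blast
    moreover have hQ: "hex Q q' p' P p q" using hh unfolding hex_def by auto
    ultimately show "\<exists>z. E Q z \<and> z \<notin> {P, p, q, Q, q', p'}"
      using not_thin_hex[OF hQ] by auto
  qed
  have outp: "\<exists>z. E p z \<and> z \<notin> {P, p, q, Q, q', p'}"
    if "T p q" "T p' q'" "p \<noteq> p'" "\<not> thin p P q" for p q p' q'
  proof -
    have "\<not> thin p q P" using that(4) thin_commute[of p P q] by simp
    from not_thin_hex[OF hex_rot[OF hexT[OF that(1-3)]] this] show ?thesis by auto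
  qed
  have outq: "\<exists>z. E q z \<and> z \<notin> {P, p, q, Q, q', p'}"
    if "T p q" "T p' q'" "p \<noteq> p'" "\<not> thin q Q p" for p q p' q'
    using not_thin_hex[OF hex_rot[OF hex_rot[OF hexT[OF that(1-3)]]] that(4)] by auto
  have one_a: "thin p' P q'" if t: "T p q" "T p' q'" "p \<noteq> p'" "\<not> thin p P q" for p q p' q'
  proof (rule ccontr)
    assume "\<not> thin p' P q'"
    then obtain z' where "E p' z'" "z' \<notin> {P, p, q, Q, q', p'}"
      using outp[OF t(2,1) t(3)[symmetric]] by blast
    moreover obtain z where "E p z" "z \<notin> {P, p, q, Q, q', p'}" using outp[OF t] by blast
    moreover obtain w where "E P w" "w \<notin> {P, p, q, Q, q', p'}" using out[OF t(1-3)] by blast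
    moreover have "hex p P p' q' Q q" using hexT[OF t(1-3)] sym unfolding hex_def by auto
    ultimately show False using no_3c[of p P p' q' Q q z w z'] by auto
  qed
  have one_b: "thin q' Q p'" if t: "T p q" "T p' q'" "p \<noteq> p'" "\<not> thin q Q p" for p q p' q'
  proof (rule ccontr)
    assume "\<not> thin q' Q p'"
    then obtain z' where "E q' z'" "z' \<notin> {P, p, q, Q, q', p'}"
      using outq[OF t(2,1) t(3)[symmetric]] by blast
    moreover obtain z where "E q z" "z \<notin> {P, p, q, Q, q', p'}" using outq[OF t] by blast
    moreover obtain w where "E Q w" "w \<notin> {P, p, q, Q, q', p'}" using outQ[OF t(1-3)] by blast
    moreover have "hex q Q q' p' P p" using hexT[OF t(1-3)] sym unfolding hex_def by auto
    ultimately show False using no_3c[of q Q q' p' P p z w z'] by auto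
  qed
  have one_ab: "thin q Q p" if t: "T p q" "\<not> thin p P q" for p q
  proof (rule ccontr)
    assume nt: "\<not> thin q Q p"
    obtain p' q' where p': "T p' q'" "p \<noteq> p'" using third by blast
    obtain z' where "E q z'" "z' \<notin> {P, p, q, Q, q', p'}"
      using outq[OF t(1) p' nt] by blast
    moreover obtain z where "E p z" "z \<notin> {P, p, q, Q, q', p'}" using outp[OF t(1) p' t(2)] by blast
    moreover obtain w where "E P w" "w \<notin> {P, p, q, Q, q', p'}" using out[OF t(1) p'] by blast
    ultimately show False using no_3c[OF hexT[OF t(1) p'], of w z z'] by auto
  qed
  have good: "good_theta P Q a1 b1 a2 b2"
    if t: "T a1 b1" "T a2 b2" "a1 \<noteq> a2"
      and ta: "\<And>p q. T p q \<Longrightarrow> p \<noteq> a1 \<Longrightarrow> thin p P q"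
      and tb: "\<And>p q. T p q \<Longrightarrow> q \<noteq> b2 \<Longrightarrow> thin q Q p" for a1 b1 a2 b2
  proof -
    obtain r s where r: "T r s" "r \<noteq> a1" "r \<noteq> a2" using third by blast
    note hh = hexT[OF t]
    have "x = P \<or> x = b1" if "E a1 x" "E x y" "E y b2" for x y
      using two_antipodal_paths[OF hh, of r s x y] r that unfolding T_def by blast
    then show ?thesis
      using hh ta tb unfolding good_theta_def T_def by blast
  qed
  have inj: "q \<noteq> q'" if "T p q" "T p' q'" "p \<noteq> p'" for p q p' q'
    using hexT[OF that] unfolding hex_def by auto
  obtain a1 b1 where a1: "T a1 b1" "\<And>p q. T p q \<Longrightarrow> p \<noteq> a1 \<Longrightarrow> thin p P q" "\<not> thin a P b \<Longrightarrow> a1 = a"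
    "\<not> thin a1 P b1 \<or> (\<forall>p q. T p q \<longrightarrow> thin p P q)"
  proof (cases "\<exists>p q. T p q \<and> \<not> thin p P q")
    case True
    then obtain p q where p: "T p q" "\<not> thin p P q" by blast
    show ?thesis by (rule that[OF p(1)]) (use p one_a T0 in blast)+
  next
    case False
    show ?thesis by (rule that[OF T0(1)]) (use False in blast)+
  qed
  show ?thesis
  proof (cases "\<exists>p q. T p q \<and> \<not> thin q Q p")
    case True
    then obtain p q where p: "T p q" "\<not> thin q Q p" by blast
    have tb: "thin q' Q p'" if "T p' q'" "q' \<noteq> q" for p' q'
    proof (cases "p' = p")
      case True
      then have "q = q'" using common_nbr[of p q Q q'] p that unfolding T_def
        using nPQ by blast
      then show ?thesis using that by simp
    next
      case False
      then show ?thesis using one_b[OF p(1) that(1)] p by blast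
    qed
    show ?thesis
    proof (cases "p = a1")
      case False
      then show ?thesis using that[OF good[OF a1(1) p(1) _ a1(2) tb]] a1(3) by blast
    next
      \<comment> \<open>The fat vertex next to \<open>Q\<close> lies on the path of
        \<open>a1\<close>. Then no inner vertex next to \<open>P\<close> is fat, and
        \<open>a1\<close> can be chosen anew on a different path.\<close>
      case True
      then have "b1 = q" using common_nbr[of p q Q b1] p a1 unfolding T_def
        using nPQ by blast
      then have at: "thin p' P q'" if "T p' q'" for p' q'
        using one_ab[OF p(1)] a1(4) True p that by blast
      obtain r s where r: "T r s" "r \<noteq> p" using third by blast
      have "thin a P b" using at T0 by blast
      then show ?thesis using that[OF good[OF r(1) p(1) r(2) at tb]] by blast
    qed
  next
    case False
    obtain r s where r: "T r s" "a1 \<noteq> r" using third by blast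
    show ?thesis using that[OF good[OF a1(1) r a1(2)]] a1(3) False by blast
  qed
qed

text \<open>Without a third path between \<open>P\<close> and \<open>Q\<close> the theta graph is
  the hexagon itself, and the thin vertices \<open>b1\<close> and \<open>a2\<close> leave just the
  two open edges.\<close>

lemma good_theta_of_hex:
  assumes h: "hex P a1 b1 Q b2 a2" and thin: "thin b1 a1 Q" "thin a2 P b2"
    and no3: "\<And>x y. E P x \<Longrightarrow> E x y \<Longrightarrow> E y Q \<Longrightarrow> x = a1 \<or> x = a2"
    and no3': "\<And>x y. E a1 x \<Longrightarrow> E x y \<Longrightarrow> E y b2 \<Longrightarrow> x = P \<or> x = b1"
  shows "good_theta P Q a1 b1 a2 b2"
proof -
  have es: "E P a1" "E a1 b1" "E b1 Q" "E Q b2" "E b2 a2" "E a2 P" and ds: "a1 \<noteq> Q" "a2 \<noteq> Q" "a1 \<noteq> a2" "b1 \<noteq> b2"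
    using h unfolding hex_def by auto
  have "(a \<noteq> a1 \<longrightarrow> thin a P b) \<and> (b \<noteq> b2 \<longrightarrow> thin b Q a)" if ab: "E P a" "E a b" "E b Q" for a b
  proof -
    consider "a = a1" | "a = a2" using no3 ab by blast
    then show ?thesis
    proof cases
      case 1
      then have "b = b1" using common_nbr[of a1 b Q b1] ab es ds by blast
      then show ?thesis using 1 thin thin_commute by blast
    next
      case 2
      then have "b = b2" using common_nbr[of a2 b Q b2] ab es ds sym by blast
      then show ?thesis using 2 thin by blast
    qed
  qed
  then show ?thesis using h no3' unfolding good_theta_def by blast
qed

text \<open>Three vertices of a hexagon, one from each antipodal pair, are either consecutive or
  alternating, so they cannot all be fat.\<close>

lemma hex_thin_pair:
  assumes h: "hex a b c d e f"
  shows "thin a b f \<and> thin d c e \<or> thin b a c \<and> thin e d f \<or> thin c b d \<and> thin f e a"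
proof -
  note h2 = hex_rot[OF h]
  note h3 = hex_rot[OF h2]
  note h4 = hex_rot[OF h3]
  note h5 = hex_rot[OF h4]
  note h6 = hex_rot[OF h5]
  let ?H = "{a, b, c, d, e, f}"
  define F where "F z \<longleftrightarrow> (\<exists>y. E z y \<and> y \<notin> ?H)" for z
  have 3: "\<not> (F p \<and> F q \<and> F r)" if "hex p q r p' q' r'" "{p, q, r, p', q', r'} = ?H" for p q r p' q' r'
    using no_3c[OF that(1)] unfolding that(2) F_def by blast
  have nc: "\<not> (F p \<and> F q \<and> F r)" if "hex p p' q q' r r'" "{p, p', q, q', r, r'} = ?H" for p q r p' q' r'
    using no_3nc[OF that(1)] unfolding that(2) F_def by blast
  have thinI: "thin p q r" if "\<not> F p" "hex p q a' b' c' r" "{p, q, a', b', c', r} = ?H" for p q r a' b' c'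
    using hex_nbr[OF that(2)] that(1) unfolding that(3) F_def thin_def by blast
  have "\<not> F a \<and> \<not> F d \<or> \<not> F b \<and> \<not> F e \<or> \<not> F c \<and> \<not> F f"
    using 3[OF h] 3[OF h2] 3[OF h3] 3[OF h4] 3[OF h5] 3[OF h6] nc[OF h] nc[OF h2] by auto
  moreover have "thin a b f" if "\<not> F a" using thinI[OF that h] by auto
  moreover have "thin b a c" if "\<not> F b" using thinI[OF that h2] thin_commute by auto
  moreover have "thin c b d" if "\<not> F c" using thinI[OF that h3] thin_commute by auto
  moreover have "thin d c e" if "\<not> F d" using thinI[OF that h4] thin_commute by auto
  moreover have "thin e d f" if "\<not> F e" using thinI[OF that h5] thin_commute by auto
  moreover have "thin f e a" if "\<not> F f" using thinI[OF that h6] thin_commute by auto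
  ultimately show ?thesis by blast
qed

text \<open>\<open>v\<close> carries further parts, so it has to lie on an open edge, and so does
  \<open>v'\<close> if it is fat as well. An antipodal pair with a third path between its vertices
  supplies the poles; if there is none, \<open>hex_thin_pair\<close> supplies the thin vertices for
  \<open>good_theta_of_hex\<close>.\<close>

lemma good_theta_at:
  assumes h: "hex v v' c d e f" and fat: "\<not> thin v v' f"
  obtains P Q a1 b1 a2 b2 where "good_theta P Q a1 b1 a2 b2" "v \<in> {P, a1}"
    "v' \<in> theta P Q" "c \<in> theta P Q" "\<not> thin v' v c \<Longrightarrow> {v, v'} = {P, a1}"
proof -
  have inner: "p \<in> theta x y" "q \<in> theta x y" if "E x p" "E p q" "E q y" for x y p q
    using that unfolding theta_def by blast+
  have pole: "x \<in> theta x y" "y \<in> theta x y" for x y unfolding theta_def by blast+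
  have es: "E v v'" "E v' c" "E c d" "E d e" "E f v" using h unfolding hex_def by auto
  note in_theta = inner[OF es(1,2,3)] inner[OF es(2,3,4)] inner[OF es(5,1,2)] pole
  define T where "T p q r \<longleftrightarrow> (\<exists>x y. E p x \<and> E x y \<and> E y q \<and> x \<notin> r)" for p q r
  consider "T v d {v', f}" | "T v' e {v, c}" | "T f c {v, e}"
    | "\<not> T v d {v', f}" "\<not> T v' e {v, c}" "\<not> T f c {v, e}" by blast
  then show ?thesis
  proof cases
    case 1
    then obtain x y where "E v x" "E x y" "E y d" "x \<noteq> v'" "x \<noteq> f" unfolding T_def by blast
    then obtain a1 b1 a2 b2 where "good_theta v d a1 b1 a2 b2" "\<not> thin v' v c \<Longrightarrow> a1 = v'"
      using good_theta_of_three_paths[OF h] by metis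
    then show ?thesis using that in_theta by blast
  next
    case 2
    then obtain x y where "E v' x" "E x y" "E y e" "x \<noteq> v" "x \<noteq> c" unfolding T_def by blast
    moreover have "hex v' v f e d c" using hex_flip[OF h] .
    ultimately obtain a1 b1 a2 b2 where "good_theta v' e a1 b1 a2 b2" "\<not> thin v v' f \<Longrightarrow> a1 = v"
      using good_theta_of_three_paths by metis
    then show ?thesis using that fat in_theta by blast
  next
    case 3
    then obtain x y where x: "E f x" "E x y" "E y c" "x \<noteq> v" "x \<noteq> e" unfolding T_def by blast
    have hf: "hex f v v' c d e" using h unfolding hex_def by auto
    obtain a1 b1 a2 b2 where g: "good_theta f c a1 b1 a2 b2" "\<not> thin v f v' \<Longrightarrow> a1 = v"
      using good_theta_of_three_paths[OF hf x] by metis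
    then have a1: "a1 = v" using fat thin_commute by blast
    \<comment> \<open>Otherwise \<open>f\<close>, \<open>v\<close>, \<open>v'\<close> are three
      consecutive fat vertices: \<open>f\<close> is a pole with a third path.\<close>
    have "thin v' v c" 
    proof (rule ccontr)
      assume nt: "\<not> thin v' v c"
      note h2 = hex_flip[OF h]
      obtain z where "E v z" "z \<notin> {v, v', c, d, e, f}" using not_thin_hex[OF h fat] by blast
      moreover obtain z' where "E v' z'" "z' \<notin> {v, v', c, d, e, f}"
        using not_thin_hex[OF hex_flip[OF h] nt] by auto
      moreover have "\<not> thin f v e" using x unfolding thin_def by blast
      then obtain w where "E f w" "w \<notin> {v, v', c, d, e, f}"
        using not_thin_hex[OF hf] by auto
      ultimately show False using no_3c[OF hf, of w z z'] by auto
    qed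
    then show ?thesis using that[OF g(1)] a1 in_theta by blast
  next
    case 4
    have "thin v v' f \<and> thin d c e \<or> thin v' v c \<and> thin e d f \<or> thin c v' d \<and> thin f e v"
      using hex_thin_pair[OF h] .
    then consider "thin v' v c" "thin e d f" | "thin c v' d" "thin f e v" using fat by blast
    then show ?thesis
    proof cases
      case 1
      have hh: "hex v f e d c v'" using h sym unfolding hex_def by auto
      have "good_theta v d f e v' c"
      proof (rule good_theta_of_hex[OF hh])
        show "thin e f d" using 1 thin_commute by blast
        show "thin v' v c" using 1 by blast
        show "\<And>x y. E v x \<Longrightarrow> E x y \<Longrightarrow> E y d \<Longrightarrow> x = f \<or> x = v'" using 4 unfolding T_def by blast
        show "\<And>x y. E f x \<Longrightarrow> E x y \<Longrightarrow> E y c \<Longrightarrow> x = v \<or> x = e" using 4 unfolding T_def by blast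
      qed
      then show ?thesis using that 1 in_theta by blast
    next
      case 2
      have "good_theta v d v' c f e"
      proof (rule good_theta_of_hex[OF h])
        show "thin c v' d" using 2 by blast
        show "thin f v e" using 2 thin_commute by blast
        show "\<And>x y. E v x \<Longrightarrow> E x y \<Longrightarrow> E y d \<Longrightarrow> x = v' \<or> x = f" using 4 unfolding T_def by blast
        show "\<And>x y. E v' x \<Longrightarrow> E x y \<Longrightarrow> E y e \<Longrightarrow> x = v \<or> x = c" using 4 unfolding T_def by blast
      qed
      then show ?thesis using that in_theta by blast
    qed
  qed
qed

text \<open>If the consecutive vertices \<open>f\<close>, \<open>a\<close>, \<open>b\<close>,
  \<open>c\<close> are thin, the hexagon itself serves; otherwise a fat one among them is passed to
  \<open>good_theta_at\<close>.\<close>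

lemma good_theta_exists:
  assumes h: "hex a b c d e f"
  obtains P Q a1 b1 a2 b2 where "good_theta P Q a1 b1 a2 b2" "{P, a1} \<inter> {a, b, c, d, e, f} \<noteq> {}"
proof -
  note result = that
  note h2 = hex_rot[OF h]
  note h3 = hex_rot[OF h2]
  note h4 = hex_rot[OF h3]
  note h5 = hex_rot[OF h4]
  note h6 = hex_rot[OF h5]
  have use_fat: thesis if pq: "hex p q r s t u" "\<not> thin p q u" "p \<in> {a, b, c, d, e, f}" for p q r s t u
  proof -
    obtain P Q a1 b1 a2 b2 where "good_theta P Q a1 b1 a2 b2" "p \<in> {P, a1}"
      using good_theta_at[OF pq(1,2)] by metis
    then show thesis using result[of P Q a1 b1 a2 b2] pq(3) by blast
  qed
  show thesis
  proof (cases "thin a b f \<and> thin b a c \<and> thin c b d \<and> thin f e a")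
    case True
    have "good_theta a d b c f e"
    proof (rule good_theta_of_hex[OF h])
      show "thin c b d" "thin f a e" using True thin_commute by blast+
      show "\<And>x y. E a x \<Longrightarrow> E x y \<Longrightarrow> E y d \<Longrightarrow> x = b \<or> x = f" using True unfolding thin_def by blast
      show "\<And>x y. E b x \<Longrightarrow> E x y \<Longrightarrow> E y e \<Longrightarrow> x = a \<or> x = c" using True unfolding thin_def by blast
    qed
    then show thesis using that by blast
  next
    case False
    then show thesis
      using use_fat[OF h] use_fat[OF h2] use_fat[OF h3] use_fat[OF h6] thin_commute by blast
  qed
qed

end

section \<open>The parts attached to a theta graph or a vertex\<close>

context x_graph
begin

section \<open>Hexagons through a vertex or over an edge\<close>

lemma E_V2: "E x y \<Longrightarrow> y \<in> V"
  using E_V sym by blast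

lemma ipath_nth: "ipath p \<Longrightarrow> Suc i < length p \<Longrightarrow> E (p ! i) (p ! Suc i)"
  unfolding ipath_def by auto

text \<open>A shortest path in \<open>K\<close> from \<open>k\<close> to another neighbour of
  \<open>v\<close> closes through \<open>v\<close> to an induced cycle, hence has five
  vertices.\<close>

lemma hex_through:
  assumes K: "conn K" and v: "v \<notin> K" and k: "k \<in> K" "k' \<in> K" "k \<noteq> k'" "E v k" "E v k'"
  obtains r s q s' r' where "hex v r s q s' r'" "{r, s, q, s', r'} \<subseteq> K"
proof -
  obtain p where p: "ipath p" "set p \<subseteq> K" "hd p \<in> {k}" "last p \<in> {z. E v z} - {k}"
    and pA: "\<And>y. y \<in> set p \<Longrightarrow> y \<in> {k} \<Longrightarrow> y = hd p"
    and pB: "\<And>y. y \<in> set p \<Longrightarrow> y \<in> {z. E v z} - {k} \<Longrightarrow> y = last p"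
    using shortest_path[OF K, of k "{k}" k' "{z. E v z} - {k}"] k by blast
  have ne: "p \<noteq> []" using p(1) unfolding ipath_def by blast
  have Ev: "E v y \<longleftrightarrow> y = hd p \<or> y = last p" if "y \<in> set p" for y
    using pB[OF that] p(3,4) k by auto
  have "hd p \<noteq> last p" using p(3,4) by auto
  then have "2 \<le> length p" using ne by (cases p rule: list.exhaust; cases "tl p") auto
  then have "length [v] + length p = 6"
    using two_paths[OF ipath_single p(1), of v] Ev p(2) v by auto
  then have len: "length p = 5" by simp
  then obtain r s q s' r' where pp: "p = [r, s, q, s', r']"
    by (auto simp: numeral_eq_Suc length_Suc_conv)
  have "E v r" "E v r'" using Ev[of r] Ev[of r'] pp by auto
  moreover have "E r s" "E s q" "E q s'" "E s' r'"
    using ipath_nth[OF p(1), of 0] ipath_nth[OF p(1), of 1] ipath_nth[OF p(1), of 2]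
      ipath_nth[OF p(1), of 3] pp by auto
  moreover have "distinct p" using p(1) unfolding ipath_def by blast
  ultimately have "hex v r s q s' r'" using p(2) v sym unfolding hex_def pp by auto
  then show ?thesis using that p(2) pp by simp
qed

text \<open>A shortest path in \<open>Y\<close> between the neighbourhoods of \<open>p\<close> and
  \<open>a\<close> closes over the edge to an induced cycle, hence has four vertices.\<close>

lemma hex_over_edge:
  assumes Y: "conn Y" and pa: "E p a" "p \<notin> Y" "a \<notin> Y" and y: "y1 \<in> Y" "E p y1" "y2 \<in> Y" "E a y2"
  obtains u1 w1 w2 u2 where "hex p a u2 w2 w1 u1" "{u1, w1, w2, u2} \<subseteq> Y"
proof -
  obtain q where q: "ipath q" "set q \<subseteq> Y" "hd q \<in> {z. E p z}" "last q \<in> {z. E a z}"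
    and qA: "\<And>y. y \<in> set q \<Longrightarrow> y \<in> {z. E p z} \<Longrightarrow> y = hd q"
    and qB: "\<And>y. y \<in> set q \<Longrightarrow> y \<in> {z. E a z} \<Longrightarrow> y = last q"
    using shortest_path[OF Y, of y1 "{z. E p z}" y2 "{z. E a z}"] y by blast
  have ne: "q \<noteq> []" using q(1) unfolding ipath_def by blast
  have Ep: "E p y \<longleftrightarrow> y = hd q" and Ea: "E a y \<longleftrightarrow> y = last q" if "y \<in> set q" for y
    using qA[OF that] qB[OF that] q(3,4) by auto
  have "p \<noteq> a" using pa irrefl by blast
  then have "length [a, p] + length q = 6"
    using two_paths[OF ipath2[OF sym[OF pa(1)]] q(1)] Ep Ea q(2) pa ne
    by (cases q) auto
  then have "length q = 4" by simp
  then obtain u1 w1 w2 u2 where qq: "q = [u1, w1, w2, u2]"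
    by (auto simp: numeral_eq_Suc length_Suc_conv)
  have "E p u1" "E a u2" using Ep[of u1] Ea[of u2] qq by auto
  moreover have "E u1 w1" "E w1 w2" "E w2 u2"
    using ipath_nth[OF q(1), of 0] ipath_nth[OF q(1), of 1] ipath_nth[OF q(1), of 2] qq by auto
  moreover have "distinct q" using q(1) unfolding ipath_def by blast
  ultimately have "hex p a u2 w2 w1 u1" using q(2) pa sym \<open>p \<noteq> a\<close> unfolding hex_def qq by auto
  then show ?thesis using that q(2) qq by simp
qed

section \<open>How the rest of the graph is attached to a theta graph\<close>

lemma good_theta_basic:
  assumes "good_theta P Q a1 b1 a2 b2"
  shows "E P a1" "E a1 b1" "E b1 Q" "E P a2" "E a2 b2" "E b2 Q" "\<not> E P Q" "\<not> E a1 b2" "\<not> E b1 a2"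
    "distinct [P, a1, b1, Q, b2, a2]" "{P, a1, b1, Q, b2, a2} \<subseteq> theta P Q"
    "hex P a1 b1 Q b2 a2"
proof -
  show h: "hex P a1 b1 Q b2 a2" using assms unfolding good_theta_def by blast
  then show es: "E P a1" "E a1 b1" "E b1 Q" "E P a2" "E a2 b2" "E b2 Q"
    using sym unfolding hex_def by blast+
  show "distinct [P, a1, b1, Q, b2, a2]" using h unfolding hex_def by blast
  show "\<not> E P Q" using hex_opposite[OF h] .
  show "\<not> E a1 b2" using hex_opposite[OF hex_rot[OF h]] .
  show "\<not> E b1 a2" using hex_opposite[OF hex_rot[OF hex_rot[OF h]]] .
  show "{P, a1, b1, Q, b2, a2} \<subseteq> theta P Q" using es unfolding theta_def by blast
qed

lemma theta_exit:
  assumes g: "good_theta P Q a1 b1 a2 b2" and x: "x \<in> theta P Q" "E x y" "y \<notin> theta P Q"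
  shows "x \<in> {P, a1, Q, b2}"
proof (rule ccontr)
  assume no: "x \<notin> {P, a1, Q, b2}"
  then consider b where "E P x" "E x b" "E b Q" | a where "E P a" "E a x" "E x Q"
    using x(1) unfolding theta_def by blast
  then show False
  proof cases
    case 1
    then have "thin x P b" using g no unfolding good_theta_def by blast
    then have "y = P \<or> y = b" using x(2) unfolding thin_def by blast
    then show False using x(3) 1 unfolding theta_def by blast
  next
    case 2
    then have "thin x Q a" using g no unfolding good_theta_def by blast
    then have "y = Q \<or> y = a" using x(2) unfolding thin_def by blast
    then show False using x(3) 2 unfolding theta_def by blast
  qed
qed

text \<open>A path outside the theta graph from one of its two open edges to the other would close up
  with the two sides of the hexagon to cycles of different lengths, or be a further path between
  the poles.\<close>

lemma no_ear:
  assumes g: "good_theta P Q a1 b1 a2 b2" and K: "conn K" "K \<inter> theta P Q = {}"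
    and y: "y \<in> K" "E P y \<or> E a1 y" and z: "z \<in> K" "E Q z \<or> E b2 z"
  shows False
proof -
  note gb = good_theta_basic[OF g]
  obtain p where p: "ipath p" "set p \<subseteq> K" "hd p \<in> {z. E P z \<or> E a1 z}" "last p \<in> {z. E Q z \<or> E b2 z}"
    and pA: "\<And>y. y \<in> set p \<Longrightarrow> y \<in> {z. E P z \<or> E a1 z} \<Longrightarrow> y = hd p"
    and pB: "\<And>y. y \<in> set p \<Longrightarrow> y \<in> {z. E Q z \<or> E b2 z} \<Longrightarrow> y = last p"
    using shortest_path[OF K(1), of y "{z. E P z \<or> E a1 z}" z "{z. E Q z \<or> E b2 z}"] y z by blast
  have ne: "p \<noteq> []" using p(1) unfolding ipath_def by blast
  have out: "w \<notin> theta P Q" if "w \<in> set p" for w using that p(2) K(2) by blast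
  have hp: "hd p \<in> set p" "last p \<in> set p" using ne by auto
  have nb: "\<not> E b1 w" "\<not> E a2 w" if "w \<in> set p" for w
    using theta_exit[OF g _ _ out[OF that]] gb(10,11) by auto
  have one: "s = t" if "w \<in> set p" "E s w" "E t w" "{s, t} \<subseteq> {P, a1, b1, Q, b2, a2}" for s t w
  proof (rule hex_one_nbr[OF gb(12)])
    show "w \<notin> {P, a1, b1, Q, b2, a2}" using out[OF that(1)] gb(11) by blast
    show "E w s" "E w t" using that(2,3) sym by blast+
    show "s \<in> {P, a1, b1, Q, b2, a2}" "t \<in> {P, a1, b1, Q, b2, a2}" using that(4) by simp_all
  qed
  have oneP: "\<not> (E P w \<and> E a1 w)" "\<not> (E Q w \<and> E b2 w)" if "w \<in> set p" for w
    using one[OF that, of P a1] one[OF that, of Q b2] gb(10) by auto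
  note es = gb(1-6) gb(1-6)[THEN sym]
  have dsj: "set xs \<inter> set p = {}" if "set xs \<subseteq> {P, a1, b1, Q, b2, a2}" for xs
    using that out gb(11) by blast
  have P_iff: "E P w \<longleftrightarrow> w = hd p" if "w \<in> set p" "E P (hd p)" for w
    using pA[OF that(1)] that by auto
  have a_iff: "E a1 w \<longleftrightarrow> w = hd p" if "w \<in> set p" "E a1 (hd p)" for w
    using pA[OF that(1)] that by auto
  have P_no: "\<not> E P w" if "w \<in> set p" "E a1 (hd p)" for w
    using pA[OF that(1)] that oneP hp by auto
  have a_no: "\<not> E a1 w" if "w \<in> set p" "E P (hd p)" for w
    using pA[OF that(1)] that oneP hp by auto
  have Q_iff: "E Q w \<longleftrightarrow> w = last p" if "w \<in> set p" "E Q (last p)" for w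
    using pB[OF that(1)] that by auto
  have b_iff: "E b2 w \<longleftrightarrow> w = last p" if "w \<in> set p" "E b2 (last p)" for w
    using pB[OF that(1)] that by auto
  have Q_no: "\<not> E Q w" if "w \<in> set p" "E b2 (last p)" for w
    using pB[OF that(1)] that oneP hp by auto
  have b_no: "\<not> E b2 w" if "w \<in> set p" "E Q (last p)" for w
    using pB[OF that(1)] that oneP hp by auto
  have lp: "1 \<le> length p" using ne by (cases p) auto
  consider "E P (hd p)" "E Q (last p)" | "E P (hd p)" "E b2 (last p)"
    | "E a1 (hd p)" "E Q (last p)" | "E a1 (hd p)" "E b2 (last p)"
    using p(3,4) by blast
  then show False
  proof cases
    case 1
    have "ipath [Q, b1, a1, P]" using es gb(7,10) sym by (intro ipath4) auto
    then have "length [Q, b1, a1, P] + length p = 6"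
      by (rule two_paths[OF _ p(1) dsj]) (use 1 P_iff a_no Q_iff nb gb(10) lp in auto)
    then obtain u w where "p = [u, w]" by (auto simp: numeral_eq_Suc length_Suc_conv)
    moreover from this have "E u w" using ipath_nth[OF p(1), of 0] by simp
    ultimately have "u \<in> theta P Q" using 1 sym unfolding theta_def by auto
    then show False using out[of u] \<open>p = [u, w]\<close> by simp
  next
    case 2
    have "ipath [b2, a2, P]" using es gb(10) by (intro ipath3) auto
    then have "length [b2, a2, P] + length p = 6"
      by (rule two_paths[OF _ p(1) dsj]) (use 2 P_iff b_iff nb gb(10) lp in auto)
    moreover have "ipath [b2, Q, b1, a1, P]"
    proof (rule ipath_Cons)
      show "ipath [Q, b1, a1, P]" using es gb(7,10) sym by (intro ipath4) auto
      show "E b2 y \<longleftrightarrow> y = hd [Q, b1, a1, P]" if "y \<in> set [Q, b1, a1, P]" for y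
        using that es gb(8,10) sym no_triangle[of b2 Q b1] no_triangle[of b2 a2 P] by auto
    qed (use gb(10) in auto)
    then have "length [b2, Q, b1, a1, P] + length p = 6"
      by (rule two_paths[OF _ p(1) dsj]) (use 2 P_iff a_no Q_no b_iff nb gb(10) lp in auto)
    ultimately show False by simp
  next
    case 3
    have "ipath [Q, b1, a1]" using es gb(10) by (intro ipath3) auto
    then have "length [Q, b1, a1] + length p = 6"
      by (rule two_paths[OF _ p(1) dsj]) (use 3 a_iff Q_iff nb gb(10) lp in auto)
    moreover have "ipath [Q, b2, a2, P, a1]"
    proof (rule ipath_Cons)
      show "ipath [b2, a2, P, a1]" using es gb(8,10) sym by (intro ipath4) auto
      show "E Q y \<longleftrightarrow> y = hd [b2, a2, P, a1]" if "y \<in> set [b2, a2, P, a1]" for y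
        using that es gb(7,10) sym no_triangle[of Q b2 a2] no_triangle[of Q b1 a1] by auto
    qed (use gb(10) in auto)
    then have "length [Q, b2, a2, P, a1] + length p = 6"
      by (rule two_paths[OF _ p(1) dsj]) (use 3 P_no a_iff Q_iff b_no nb gb(10) lp in auto)
    ultimately show False by simp
  next
    case 4
    have "ipath [b2, a2, P, a1]" using es gb(8,10) sym by (intro ipath4) auto
    then have "length [b2, a2, P, a1] + length p = 6"
      by (rule two_paths[OF _ p(1) dsj]) (use 4 a_iff P_no b_iff nb gb(10) lp in auto)
    then obtain u w where pw: "p = [u, w]" by (auto simp: numeral_eq_Suc length_Suc_conv)
    then have "E a1 u" "E u w" "E w b2" using ipath_nth[OF p(1), of 0] 4 sym by auto
    then have "u = P \<or> u = b1" using g unfolding good_theta_def by blast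
    then show False using out[of u] pw gb(11) by auto
  qed
qed

text \<open>The union of the components outside \<open>T\<close> that are attached to the edge
  \<open>p a\<close>.\<close>

definition near :: "'a set \<Rightarrow> 'a \<Rightarrow> 'a \<Rightarrow> 'a set" where
  "near T p a = {x \<in> V - T. \<exists>y\<in>comp (- T) x. E p y \<or> E a y}"

lemma near_subset: "near T p a \<subseteq> V - T"
  unfolding near_def by blast

lemma near_closed:
  assumes "x \<in> near T p a" "E x y" "y \<notin> T"
  shows "y \<in> near T p a"
proof -
  have x: "x \<in> - T" using assms(1) unfolding near_def by blast
  have "y \<in> comp (- T) x" using comp_closed[OF x comp_self assms(2)] assms(3) by simp
  then have "comp (- T) y = comp (- T) x" by (rule comp_eq[OF x])
  then show ?thesis using assms E_V2[OF assms(2)] unfolding near_def by simp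
qed

lemma near_comp:
  assumes "x \<in> near T p a"
  shows "comp (- T) x \<subseteq> near T p a"
proof -
  have x: "x \<in> - T" using assms unfolding near_def by blast
  show ?thesis
    by (rule conn_closed[OF conn_comp[OF x] comp_self assms])
      (use near_closed comp_subset[OF x] in blast)
qed

text \<open>Otherwise the component of \<open>x\<close> touches both open edges, against
  \<open>no_ear\<close>.\<close>

lemma near_nbr:
  assumes g: "good_theta P Q a1 b1 a2 b2" and x: "x \<in> near (theta P Q) P a1"
    and t: "E x t" "t \<in> theta P Q"
  shows "t \<in> {P, a1}"
proof (rule ccontr)
  assume "t \<notin> {P, a1}"
  have xT: "x \<notin> theta P Q" using x near_subset by blast
  then have "t \<in> {Q, b2}" using theta_exit[OF g t(2) sym[OF t(1)]] \<open>t \<notin> {P, a1}\<close> by blast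
  moreover obtain y where "y \<in> comp (- theta P Q) x" "E P y \<or> E a1 y" using x unfolding near_def by blast
  moreover have "comp (- theta P Q) x \<inter> theta P Q = {}" using comp_subset[of x "- theta P Q"] xT by blast
  ultimately show False
    using no_ear[OF g conn_comp[of x "- theta P Q"], of y x] xT comp_self t(1) sym by blast
qed

section \<open>Branches: components left after the removal of a vertex\<close>

definition branch :: "'a \<Rightarrow> 'a set \<Rightarrow> bool" where
  "branch v C \<longleftrightarrow> conn C \<and> C \<subseteq> V \<and> v \<notin> C \<and> (\<forall>x\<in>C. \<forall>y. E x y \<longrightarrow> y \<in> C \<or> y = v) \<and> (\<exists>k\<in>C. E v k)"

lemma branch_eq_comp:
  assumes "branch v C" "x \<in> C" "C \<subseteq> B" "v \<notin> B"
  shows "comp B x = C"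
proof
  show "C \<subseteq> comp B x" using conn_subset_comp assms unfolding branch_def by blast
  have x: "x \<in> B" using assms by blast
  show "comp B x \<subseteq> C"
    by (rule conn_closed[OF conn_comp[OF x] comp_self assms(2)])
      (use assms comp_subset[OF x] in \<open>unfold branch_def, blast\<close>)
qed

lemma branch_disjoint:
  assumes "branch v C" "branch v C'" "C \<noteq> C'"
  shows "C \<inter> C' = {}"
proof (rule ccontr)
  assume "C \<inter> C' \<noteq> {}"
  then obtain x where "x \<in> C" "x \<in> C'" by blast
  then have "comp (- {v}) x = C" "comp (- {v}) x = C'"
    using branch_eq_comp[OF assms(1), of x "- {v}"] branch_eq_comp[OF assms(2), of x "- {v}"]
      assms(1,2) unfolding branch_def by blast+
  then show False using assms(3) by simp
qed

lemma conn_branch: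
  assumes D: "conn D" "D \<subseteq> V" "r \<in> D" and cl: "\<And>x y. x \<in> D \<Longrightarrow> x \<noteq> r \<Longrightarrow> E x y \<Longrightarrow> y \<in> D"
    and x: "x \<in> D" "x \<noteq> r"
  shows "branch r (comp (D - {r}) x)"
proof -
  let ?C = "comp (D - {r}) x"
  have xD: "x \<in> D - {r}" using x by blast
  note sub = comp_subset[OF xD]
  have cl': "y \<in> ?C \<or> y = r" if "z \<in> ?C" "E z y" for z y
    using comp_closed[OF xD that] cl[of z y] sub that by blast
  have "\<exists>k\<in>?C. E r k"
  proof (rule ccontr)
    assume no: "\<not> ?thesis"
    have "D \<subseteq> ?C"
      by (rule conn_closed[OF D(1) x(1) comp_self]) (use cl' no sym in blast)
    then show False using D(3) sub by blast
  qed
  then show ?thesis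
    using conn_comp[OF xD] sub D(2) cl' unfolding branch_def by blast
qed

text \<open>A leg of an \<open>S_3_3_3\<close> at \<open>v\<close>, kept in reserve outside
  \<open>K\<close>.\<close>

definition tail :: "'a \<Rightarrow> 'a set \<Rightarrow> bool" where
  "tail v K \<longleftrightarrow> (\<exists>x1 x2 x3. E v x1 \<and> E x1 x2 \<and> E x2 x3 \<and> \<not> E v x3 \<and> {x1, x2, x3} \<inter> K = {})"

lemma tailI: "E v x1 \<Longrightarrow> E x1 x2 \<Longrightarrow> E x2 x3 \<Longrightarrow> \<not> E v x3 \<Longrightarrow> {x1, x2, x3} \<inter> K = {} \<Longrightarrow> tail v K"
  unfolding tail_def by blast

text \<open>Each nonfull branch contains a leg and the tail is the third one. No edges run between
  the legs, since a branch is attached only at \<open>v\<close>.\<close>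

lemma no_three_branches:
  assumes 1: "branch v K1" "nonfull v K1" and 2: "branch v K2" "nonfull v K2" and ne: "K1 \<noteq> K2"
    and t: "tail v (K1 \<union> K2)"
  shows False
proof -
  obtain x1 x2 x3 where x: "E v x1" "E x1 x2" "E x2 x3" "\<not> E v x3" "{x1, x2, x3} \<inter> (K1 \<union> K2) = {}"
    using t unfolding tail_def by blast
  have xv: "v \<notin> {x1, x2, x3}" using x irrefl no_triangle[of v x1 x2] sym by blast
  obtain k where k: "conn K1" "k \<in> K1" "E v k" using 1(1) unfolding branch_def by blast
  obtain k1 k2 k3 where K1: "k1 \<in> K1" "k2 \<in> K1" "k3 \<in> K1" "E v k1" "E k1 k2" "E k2 k3" "\<not> E v k3"
    using nonfull_path[OF k 1(2)] by blast
  obtain l where l: "conn K2" "l \<in> K2" "E v l" using 2(1) unfolding branch_def by blast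
  obtain l1 l2 l3 where K2: "l1 \<in> K2" "l2 \<in> K2" "l3 \<in> K2" "E v l1" "E l1 l2" "E l2 l3" "\<not> E v l3"
    using nonfull_path[OF l 2(2)] by blast
  have d: "K1 \<inter> K2 = {}" using branch_disjoint[OF 1(1) 2(1) ne] .
  have c1: "\<not> E p q" if "p \<in> K1" "q \<notin> K1" "q \<noteq> v" for p q using 1(1) that unfolding branch_def by blast
  have c2: "\<not> E p q" if "p \<in> K2" "q \<notin> K2" "q \<noteq> v" for p q using 2(1) that unfolding branch_def by blast
  have v: "v \<notin> K2" using 2(1) unfolding branch_def by blast
  show False
  proof (rule no_S333[OF K1(4-7) K2(4-7) x(1-4)])
    show "{k1, k2, k3} \<inter> {l1, l2, l3} = {}" "{k1, k2, k3} \<inter> {x1, x2, x3} = {}"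
      "{l1, l2, l3} \<inter> {x1, x2, x3} = {}" using K1 K2 x(5) d by blast+
    show "\<not> E p q" if "p \<in> {k1, k2, k3}" "q \<in> {l1, l2, l3}" for p q
      using c1[of p q] that K1 K2 d v by blast
    show "\<not> E p q" if "p \<in> {k1, k2, k3}" "q \<in> {x1, x2, x3}" for p q
      using c1[of p q] that K1 x(5) xv by blast
    show "\<not> E p q" if "p \<in> {l1, l2, l3}" "q \<in> {x1, x2, x3}" for p q
      using c2[of p q] that K2 x(5) xv by blast
  qed
qed

text \<open>In the part outside \<open>M\<close>, two neighbours of a vertex on the side of
  \<open>r\<close> would both be neighbours of \<open>r\<close> too and close a 4-cycle. So this
  part is a star forest, and all of its side opposite to \<open>r\<close> is to be exposed, as
  \<open>rep_join\<close> does.\<close>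

lemma rep_add_full:
  assumes "rep M {z. E r z}" "finite B" "r \<notin> B" "M \<subseteq> B"
    and no: "\<And>x y. x \<in> M \<Longrightarrow> y \<in> B - M \<Longrightarrow> \<not> E x y"
    and full: "\<And>y. y \<in> B - M \<Longrightarrow> opp r y \<Longrightarrow> E r y"
  shows "rep B {z. E r z}"
proof -
  let ?F = "B - M"
  have "y = z" if "u \<in> ?F" "y \<in> ?F" "z \<in> ?F" "(u \<in> U) = (r \<in> U)" "E u y" "E u z" for u y z
  proof -
    have "opp r y" "opp r z" using that bip unfolding opp_def by blast+
    then have "E r y" "E r z" using full that by blast+
    moreover have "r \<noteq> u" using that(1) assms(3) by blast
    ultimately show ?thesis using common_nbr[of r y u z] that sym by blast
  qed
  then have F: "rep ?F {}" using rep_star_forest[of ?F "r \<in> U"] assms(2) by blast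
  have "rep (M \<union> ?F) ({z. E r z} \<inter> M \<union> {z \<in> ?F. (z \<in> U) = (r \<notin> U)})"
    by (rule rep_join[OF assms(1) F]) (use no bip in blast)+
  moreover have "M \<union> ?F = B" using assms(4) by blast
  moreover have "({z. E r z} \<inter> M \<union> {z \<in> ?F. (z \<in> U) = (r \<notin> U)}) \<inter> B = {z. E r z} \<inter> B"
    using full bip assms(4) unfolding opp_def by blast
  ultimately show ?thesis using rep_cong by metis
qed

text \<open>The only nonfull branch, if there is one, keeps its own layout; all others together form
  a full part.\<close>

lemma rep_branches:
  assumes B: "finite B" "r \<notin> B"
    and br: "\<And>x. x \<in> B \<Longrightarrow> branch r (comp B x)"
    and uniq: "\<And>C C'. branch r C \<Longrightarrow> branch r C' \<Longrightarrow> C \<subseteq> B \<Longrightarrow> C' \<subseteq> B \<Longrightarrow> nonfull r C \<Longrightarrow> nonfull r C' \<Longrightarrow> C = C'"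
    and reps: "\<And>C. branch r C \<Longrightarrow> C \<subseteq> B \<Longrightarrow> nonfull r C \<Longrightarrow> rep C {z. E r z}"
  shows "rep B {z. E r z}"
proof (cases "\<exists>x\<in>B. nonfull r (comp B x)")
  case False
  have "rep {} {z. E r z}" by (rule rep_empty)
  then show ?thesis
  proof (rule rep_add_full[OF _ B])
    show "E r y" if "y \<in> B - {}" "opp r y" for y
      using False that comp_self unfolding nonfull_def by blast
  qed auto
next
  case True
  then obtain x where x: "x \<in> B" "nonfull r (comp B x)" by blast
  let ?M = "comp B x"
  have sub: "?M \<subseteq> B" using comp_subset[OF x(1)] .
  show ?thesis
  proof (rule rep_add_full[OF reps[OF br[OF x(1)] sub x(2)] B sub])
    show "\<not> E p q" if "p \<in> ?M" "q \<in> B - ?M" for p q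
      using comp_closed[OF x(1) that(1), of q] that(2) by blast
    show "E r y" if y: "y \<in> B - ?M" "opp r y" for y
    proof (rule ccontr)
      assume "\<not> E r y"
      then have "nonfull r (comp B y)" using y comp_self unfolding nonfull_def by blast
      then have "comp B y = ?M" using uniq[OF br br] x y sub comp_subset[of y B] by blast
      then show False using y comp_self by blast
    qed
  qed
qed

text \<open>\<open>r\<close> is the only entrance to \<open>K\<close>, so \<open>K\<close> minus
  \<open>r\<close> splits into branches at \<open>r\<close>. They are laid out as seen from
  \<open>r\<close>, and \<open>r\<close> is then placed at the end.\<close>

lemma rep_single:
  assumes K: "branch v K" and r: "r \<in> K" "E v r" "\<And>k. k \<in> K \<Longrightarrow> E v k \<Longrightarrow> k = r"
    and uniq: "\<And>C C'. branch r C \<Longrightarrow> branch r C' \<Longrightarrow> C \<subseteq> K - {r} \<Longrightarrow> C' \<subseteq> K - {r} \<Longrightarrow>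
      nonfull r C \<Longrightarrow> nonfull r C' \<Longrightarrow> C = C'"
    and reps: "\<And>C. branch r C \<Longrightarrow> C \<subseteq> K - {r} \<Longrightarrow> nonfull r C \<Longrightarrow> rep C {z. E r z}"
  shows "rep K {z. E v z}"
proof -
  have fin: "finite K" using K finV finite_subset unfolding branch_def by blast
  have "rep (K - {r}) {z. E r z}"
  proof (rule rep_branches)
    fix x assume x: "x \<in> K - {r}"
    show "branch r (comp (K - {r}) x)"
    proof (rule conn_branch)
      show "conn K" "K \<subseteq> V" using K unfolding branch_def by blast+
      show "z \<in> K" if "y \<in> K" "y \<noteq> r" "E y z" for y z
        using K r(3)[OF that(1)] that sym unfolding branch_def by blast
    qed (use x r(1) in auto)
  next
    show "finite (K - {r})" "r \<notin> K - {r}" using fin by simp_all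
  qed (fact uniq, fact reps)
  then have "rep (insert r (K - {r})) (insert r {z \<in> {z. E r z}. \<not> opp z r})"
    by (rule rep_add_end) (use E_opp sym in auto)
  moreover have "insert r (K - {r}) = K" using r(1) by blast
  moreover have "insert r {z \<in> {z. E r z}. \<not> opp z r} \<inter> K = {z. E v z} \<inter> K"
    using r E_opp opp_commute by blast
  ultimately show ?thesis using rep_cong by metis
qed

text \<open>After removal of \<open>X\<close> the theta graph is still connected through
  \<open>Q\<close>, so membership in \<open>K\<close> spreads from \<open>t\<close> to
  \<open>Q\<close> and from there everywhere.\<close>

lemma theta_subset:
  assumes g: "good_theta P Q a1 b1 a2 b2" and cl: "\<And>x y. x \<in> K \<Longrightarrow> E x y \<Longrightarrow> y \<in> K \<or> y \<in> X"
    and X: "X \<subseteq> {P, a1}" and t: "t \<in> K" "t \<in> theta P Q" "t \<notin> X"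
  shows "theta P Q - X \<subseteq> K"
proof -
  note gb = good_theta_basic[OF g]
  have nX: "z \<notin> X" if "E z Q" for z
    using that X gb(3,7) no_triangle[of a1 b1 Q] gb(2) by blast
  have QX: "Q \<notin> X" "a2 \<notin> X" using X gb(10) by auto
  have b_in: "b \<in> K" if "Q \<in> K" "E b Q" for b using cl[of Q b] that nX sym by blast
  have Q: "Q \<in> K"
  proof -
    have from_b: "Q \<in> K" if "b \<in> K" "E b Q" for b using cl[of b Q] that QX by blast
    have from_a: "Q \<in> K" if "a \<in> K" "E a b" "E b Q" for a b using cl[of a b] from_b nX that by blast
    consider "t = Q" | "t = P" | b where "E t b" "E b Q" | "E t Q"
      using t(2) unfolding theta_def by blast
    then show ?thesis
    proof cases
      case 2
      then have "a2 \<in> K" using cl[of P a2] t gb(4) QX by blast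
      then show ?thesis using from_a gb by blast
    qed (use t from_a from_b in auto)
  qed
  have a_in: "a \<in> K" if "E P a" "E a b" "E b Q" "a \<notin> X" for a b
    using cl[of b a] b_in[OF Q] that sym by blast
  have "P \<in> K" if "P \<notin> X"
    using cl[of a2 P] a_in[OF gb(4-6) QX(2)] gb(4) sym that by blast
  then show ?thesis using Q b_in[OF Q] a_in unfolding theta_def by blast
qed

text \<open>The pole \<open>Q\<close> and \<open>b2\<close> see the far part. The edge
  \<open>P a1\<close> is left out, and what its ends would see becomes the exposed set, ready for
  the next gluing.\<close>

lemma theta_rep:
  assumes g: "good_theta P Q a1 b1 a2 b2"
    and L: "rep (near (theta P Q) Q b2) {z. E Q z \<or> E b2 z}"
  shows "rep (theta P Q - {P, a1} \<union> near (theta P Q) Q b2) {z. E P z \<or> E a1 z}"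
proof -
  note gb = good_theta_basic[OF g]
  let ?T = "theta P Q" and ?L = "near (theta P Q) Q b2"
  define A where "A = {a. \<exists>b. E P a \<and> E a b \<and> E b Q}"
  \<comment> \<open>The choice is unique: a second \<open>b\<close> would close a 4-cycle with
    \<open>a\<close> and \<open>Q\<close>.\<close>
  define f where "f a = (SOME b. E a b \<and> E b Q)" for a
  have f: "E P a" "E a (f a)" "E (f a) Q" if "a \<in> A" for a
    using that someI_ex[of "\<lambda>b. E a b \<and> E b Q"] unfolding A_def f_def by blast+
  have AQ: "a \<noteq> Q" if "a \<in> A" for a using f[OF that] gb(7) by blast
  have fu: "f a = b" if "a \<in> A" "E a b" "E b Q" for a b
    using common_nbr[of a "f a" Q b] f[OF that(1)] that AQ by blast
  have A12: "a1 \<in> A" "a2 \<in> A" using gb unfolding A_def by blast+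
  have f12: "f a1 = b1" "f a2 = b2" using fu A12 gb by blast+
  have cross: "E a (f b) \<longleftrightarrow> a = b" if "a \<in> A" "b \<in> A" for a b
  proof
    assume "E a (f b)"
    then show "a = b" using common_nbr[of P a "f b" b] f[OF that(1)] f[OF that(2)] gb(7) by blast
  qed (use f that in blast)
  have inj: "inj_on f A" using cross f unfolding inj_on_def by metis
  have AT: "A \<subseteq> ?T" "f ` A \<subseteq> ?T" using f unfolding A_def theta_def by blast+
  have Tset: "?T = {P, Q} \<union> A \<union> f ` A"
  proof -
    have "b \<in> f ` A" if "E P a" "E a b" "E b Q" for a b
    proof -
      have "a \<in> A" using that unfolding A_def by blast
      then show ?thesis using fu that by blast
    qed
    then show ?thesis using AT unfolding theta_def A_def by blast
  qed
  have Lsub: "?L \<inter> ?T = {}" "?L \<subseteq> V" using near_subset by blast+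
  have nbL: "t \<in> {Q, b2}" if "z \<in> ?L" "E z t" "t \<in> ?T" for z t
    using near_nbr[OF good_theta_reverse[OF g]] that theta_commute by metis
  have "\<not> E a1 Q" using no_triangle[OF gb(2,3)] .
  then have PA: "P \<notin> A" "P \<notin> f ` A" "Q \<notin> A" "Q \<notin> f ` A" "a1 \<notin> f ` A"
    using f(1,3) irrefl gb(7) AQ by blast+
  have finA: "finite A" using finV E_V2 finite_subset[of A V] unfolding A_def by blast
  have "rep (insert Q (?L \<union> f ` A \<union> (A - {a1}))) (insert (f a1) (A - {a1}))"
  proof (rule rep_theta_step[OF L finA A12 _ inj])
    show "a1 \<noteq> a2" using gb by auto
    show "(a \<in> U) = (Q \<in> U)" "(f a \<in> U) \<noteq> (Q \<in> U)" if "a \<in> A" for a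
      using f[OF that] bip by blast+
    show "A \<inter> ?L = {}" "f ` A \<inter> ?L = {}" "Q \<notin> ?L" "Q \<notin> A"
      using AT Lsub PA gb(11) by blast+
    show "E a (f b) \<longleftrightarrow> a = b" if "a \<in> A" "b \<in> A" for a b using cross that .
    show "E Q (f a)" if "a \<in> A" for a using f[OF that] sym by blast
    show "E z Q \<longleftrightarrow> z \<in> {z. E Q z \<or> E b2 z}" if "z \<in> ?L" "opp z Q" for z
      using that sym bip gb(6) unfolding opp_def by blast
    show "E z (f a2) \<longleftrightarrow> z \<in> {z. E Q z \<or> E b2 z}" if "z \<in> ?L" "opp z (f a2)" for z
      using that sym bip gb(6) unfolding opp_def f12 by blast
    show "\<not> E z a" if "z \<in> ?L" "a \<in> A" "a \<noteq> a1" for z a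
    proof
      assume "E z a"
      then have "a = Q \<or> a = b2" using nbL that AT by blast
      then show False using that f[OF that(2)] gb PA sym no_triangle[of P a2 b2] by blast
    qed
    show "\<not> E z (f a)" if "z \<in> ?L" "a \<in> A" "a \<noteq> a2" for z a
    proof
      assume "E z (f a)"
      then have "f a = Q \<or> f a = b2" using nbL that AT by blast
      then show False using that f[OF that(2)] irrefl f12 inj A12 unfolding inj_on_def by metis
    qed
  qed
  moreover have "insert Q (?L \<union> f ` A \<union> (A - {a1})) = ?T - {P, a1} \<union> ?L"
    unfolding Tset using PA gb(10) Lsub(1) gb(11) by auto
  moreover have "insert (f a1) (A - {a1}) \<inter> (?T - {P, a1} \<union> ?L) = {z. E P z \<or> E a1 z} \<inter> (?T - {P, a1} \<union> ?L)"
  proof -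
    have "\<not> E P z" "\<not> E a1 z" if "z \<in> ?L" for z
      using nbL[OF that, of P] nbL[OF that, of a1] gb(10,11) sym by auto
    moreover have "\<not> E P z" if "z \<in> f ` A" for z using that f no_triangle by blast
    moreover have "E a1 z \<longleftrightarrow> z = f a1" if "z \<in> f ` A" for z using that cross A12 by blast
    moreover have "\<not> E a1 z" if "z \<in> A" for z using that f(1) gb(1) no_triangle sym by blast
    moreover have "\<not> E a1 Q" using gb no_triangle by blast
    moreover have "f a1 \<in> f ` A" using A12 by blast
    ultimately show ?thesis unfolding Tset using gb(7) f(1) Lsub(1) AT by blast
  qed
  ultimately show ?thesis using rep_cong by metis
qed

end

section \<open>Layouts along the linear structure\<close>

context x_graph
begin

section \<open>Depth of the parts at an open edge\<close>

lemma conn_nbr: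
  assumes "conn C" "y \<in> C" "z \<in> C" "w \<in> C" "z \<noteq> w"
  shows "\<exists>y'\<in>C. E y y'"
proof (rule ccontr)
  assume no: "\<not> ?thesis"
  have "C \<subseteq> {y}" by (rule conn_closed[OF assms(1,2)]) (use no in auto)
  then show False using assms(3-5) by blast
qed

text \<open>This is the way in which C_6^{+2l2} is used: parts of depth 2 cannot hang at both ends
  of an open edge.\<close>

lemma no_deep:
  assumes g: "good_theta P Q a1 b1 a2 b2"
    and x: "E P x" "E x x'" and y: "E a1 y" "E y y'"
    and out: "x \<notin> {P, a1, b1, Q, b2, a2}" "x' \<notin> {P, a1, b1, Q, b2, a2}"
      "y \<notin> {P, a1, b1, Q, b2, a2}" "y' \<notin> {P, a1, b1, Q, b2, a2}"
    and "\<not> E x' Q" "\<not> E y' b2" "\<not> E x' y'"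
  shows False
  using no_2l2[OF good_theta_basic(12)[OF g], of x y x' y'] assms by blast

lemma near_not_far:
  assumes g: "good_theta P Q a1 b1 a2 b2" and "x \<in> near (theta P Q) P a1"
  shows "\<not> E x Q" "\<not> E x b2" "x \<notin> theta P Q"
proof -
  have "Q \<in> theta P Q" "b2 \<in> theta P Q" "Q \<notin> {P, a1}" "b2 \<notin> {P, a1}"
    using good_theta_basic(10,11)[OF g] by auto
  then show "\<not> E x Q" "\<not> E x b2" using near_nbr[OF assms] by blast+
  show "x \<notin> theta P Q" using assms(2) near_subset by blast
qed

text \<open>A component touching both ends has depth 2 at each of them. Any other component with an
  edge has depth 2 at one end, and \<open>no_deep\<close> applies with the joint component at the
  opposite end.\<close>

lemma near_isolated:
  assumes g: "good_theta P Q a1 b1 a2 b2"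
    and Y: "x \<in> near (theta P Q) P a1" "y1 \<in> comp (- theta P Q) x" "y2 \<in> comp (- theta P Q) x"
      "E P y1" "E a1 y2"
    and z: "z \<in> near (theta P Q) P a1" "z \<notin> comp (- theta P Q) x"
    and w: "w \<in> near (theta P Q) P a1"
  shows "\<not> E z w"
proof
  assume zw: "E z w"
  let ?T = "theta P Q"
  let ?Y = "comp (- ?T) x" and ?C = "comp (- ?T) z"
  note gb = good_theta_basic[OF g]
  have xT: "x \<in> - ?T" and zT: "z \<in> - ?T" and wT: "w \<in> - ?T"
    using near_not_far(3)[OF g] Y(1) z(1) w by auto
  have ne: "?Y \<noteq> ?C" using z(2) comp_self[of z] by metis
  have w': "w \<in> ?C" using comp_closed[OF zT comp_self zw wT] .
  have zw': "z \<noteq> w" using zw irrefl by blast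
  have y12: "y1 \<noteq> y2" using Y(4,5) gb(1) no_triangle[of P a1 y1] by blast
  have nY: "v \<in> near ?T P a1" if "v \<in> ?Y" for v using near_comp[OF Y(1)] that by blast
  have nC: "v \<in> near ?T P a1" if "v \<in> ?C" for v using near_comp[OF z(1)] that by blast
  have out: "v \<notin> {P, a1, b1, Q, b2, a2}" if "v \<in> near ?T P a1" for v
    using near_not_far(3)[OF g that] gb(11) by blast
  obtain y1' where y1': "y1' \<in> ?Y" "E y1 y1'" using conn_nbr[OF conn_comp[OF xT] Y(2) Y(2,3) y12] by blast
  obtain y2' where y2': "y2' \<in> ?Y" "E y2 y2'" using conn_nbr[OF conn_comp[OF xT] Y(3) Y(2,3) y12] by blast
  obtain c where c: "c \<in> ?C" "E P c \<or> E a1 c" using z(1) unfolding near_def by blast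
  obtain c' where c': "c' \<in> ?C" "E c c'"
    using conn_nbr[OF conn_comp[OF zT] c(1) comp_self w' zw'] by blast
  have no: "\<not> E u v" "\<not> E v u" if "u \<in> ?Y" "v \<in> ?C" for u v
    using comp_edge[OF xT zT ne that] sym by blast+
  from c(2) show False
  proof
    assume "E P c"
    then show False
      by (rule no_deep[OF g _ c'(2) Y(5) y2'(2)])
        (use out nY nC near_not_far[OF g] c c' Y y2' no in blast)+
  next
    assume "E a1 c"
    then show False
      by (rule no_deep[OF g Y(4) y1'(2) _ c'(2)])
        (use out nY nC near_not_far[OF g] c c' Y y1' no in blast)+
  qed
qed

section \<open>The simultaneous induction over branches and theta graphs\<close>

definition branch_claim :: "'a \<Rightarrow> 'a set \<Rightarrow> bool" where
  "branch_claim v K \<longleftrightarrow> (branch v K \<and> tail v K \<longrightarrow> rep K {z. E v z})"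

definition theta_claim :: "'a \<Rightarrow> 'a \<Rightarrow> 'a \<Rightarrow> 'a \<Rightarrow> 'a \<Rightarrow> 'a \<Rightarrow> bool" where
  "theta_claim P Q a1 b1 a2 b2 \<longleftrightarrow> (good_theta P Q a1 b1 a2 b2 \<longrightarrow>
     rep (near (theta P Q) P a1) {z. E P z \<or> E a1 z})"

lemma theta_rep_claim:
  assumes g: "good_theta P Q a1 b1 a2 b2" and "theta_claim Q P b2 a2 b1 a1"
  shows "rep (theta P Q - {P, a1} \<union> near (theta P Q) Q b2) {z. E P z \<or> E a1 z}"
  using theta_rep[OF g] assms(2) good_theta_reverse[OF g] theta_commute
  unfolding theta_claim_def by metis

lemma far_subset:
  assumes g: "good_theta P Q a1 b1 a2 b2" and cl: "\<And>x y. x \<in> K \<Longrightarrow> E x y \<Longrightarrow> y \<in> K \<or> y \<in> X"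
    and X: "X \<subseteq> {P, a1}" and T: "theta P Q - X \<subseteq> K"
  shows "near (theta P Q) Q b2 \<subseteq> K"
proof
  note gb = good_theta_basic[OF g]
  let ?T = "theta P Q"
  fix x assume x: "x \<in> near ?T Q b2"
  then have xT: "x \<in> - ?T" using near_subset by blast
  obtain y where y: "y \<in> comp (- ?T) x" "E Q y \<or> E b2 y" using x unfolding near_def by blast
  have sub: "comp (- ?T) x \<subseteq> - ?T" using comp_subset[OF xT] .
  have XT: "X \<subseteq> ?T" using X gb(11) by blast
  have "Q \<in> K" "b2 \<in> K" using T X gb(10,11) by auto
  then have yK: "y \<in> K" using cl y sub XT by blast
  have "comp (- ?T) x \<subseteq> K"
    by (rule conn_closed[OF conn_comp[OF xT] y(1) yK]) (use cl sub XT in blast)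
  then show "x \<in> K" using comp_self[of x] by blast
qed

lemma outside_near_or_far:
  assumes g: "good_theta P Q a1 b1 a2 b2" and K: "conn K" "K \<subseteq> V"
    and z: "z \<in> K" "z \<notin> theta P Q" and t: "t \<in> K" "t \<in> theta P Q"
  shows "z \<in> near (theta P Q) P a1 \<or> z \<in> near (theta P Q) Q b2"
proof -
  let ?T = "theta P Q"
  have zT: "z \<in> - ?T" using z(2) by blast
  have "\<exists>x\<in>comp (- ?T) z. \<exists>t\<in>?T. E x t"
  proof (rule ccontr)
    assume no: "\<not> ?thesis"
    have "K \<subseteq> comp (- ?T) z"
      by (rule conn_closed[OF K(1) z(1) comp_self]) (use no comp_closed[OF zT] in blast)
    then show False using t comp_subset[OF zT] by blast
  qed
  then obtain x t where xt: "x \<in> comp (- ?T) z" "t \<in> ?T" "E t x" using sym by blast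
  moreover have "x \<notin> ?T" using xt(1) comp_subset[OF zT] by blast
  ultimately have "t \<in> {P, a1, Q, b2}" using theta_exit[OF g] by blast
  then show ?thesis using xt(1,3) z K(2) unfolding near_def by blast
qed

text \<open>If \<open>v\<close> has a single neighbour in \<open>K\<close>, this neighbour is peeled
  off. Otherwise a hexagon through \<open>v\<close> yields a good theta graph with \<open>v\<close>
  on its open edge. Its far part is smaller than \<open>K\<close>, and the other end
  \<open>c\<close> of the open edge is placed last.\<close>

lemma branch_step:
  assumes K: "branch v K" and tl: "tail v K"
    and IHb: "\<And>v' K'. card K' < card K \<Longrightarrow> branch_claim v' K'"
    and IHt: "\<And>P Q a1 b1 a2 b2. card (near (theta P Q) P a1) < card K \<Longrightarrow> theta_claim P Q a1 b1 a2 b2"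
  shows "rep K {z. E v z}"
proof -
  have Kc: "conn K" "K \<subseteq> V" "v \<notin> K" and Kcl: "\<And>x y. x \<in> K \<Longrightarrow> E x y \<Longrightarrow> y \<in> K \<or> y = v"
    using K unfolding branch_def by blast+
  have fin: "finite K" using Kc(2) finV finite_subset by blast
  obtain r where r: "r \<in> K" "E v r" using K unfolding branch_def by blast
  obtain x1 x2 x3 where x: "E v x1" "E x1 x2" "E x2 x3" "\<not> E v x3" and xK: "x1 \<notin> K" "x2 \<notin> K" "x3 \<notin> K"
    using tl unfolding tail_def by auto
  have xv: "x1 \<noteq> v" "x2 \<noteq> v" "x3 \<noteq> v" using x irrefl no_triangle[of v x1 x2] sym by blast+
  show ?thesis
  proof (cases "\<forall>k\<in>K. E v k \<longrightarrow> k = r")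
    case True
    have tl': "tail r C" if "C \<subseteq> K - {r}" for C
    proof (rule tailI[OF sym[OF r(2)] x(1,2)])
      show "\<not> E r x2" using Kcl[OF r(1), of x2] xK xv by blast
      show "{v, x1, x2} \<inter> C = {}" using that Kc(3) xK by blast
    qed
    show ?thesis
    proof (rule rep_single[OF K r])
      show "k = r" if "k \<in> K" "E v k" for k using True that by blast
      show "C = C'" if "branch r C" "branch r C'" "C \<subseteq> K - {r}" "C' \<subseteq> K - {r}"
        "nonfull r C" "nonfull r C'" for C C'
      proof (rule ccontr)
        assume "C \<noteq> C'"
        then show False
          by (rule no_three_branches[OF that(1,5,2,6)]) (rule tl', use that in blast)
      qed
      show "rep C {z. E r z}" if "branch r C" "C \<subseteq> K - {r}" for C
      proof -
        have "C \<subset> K" using that(2) r(1) by blast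
        then have "card C < card K" using fin by (simp add: psubset_card_mono)
        then show ?thesis using IHb[of C r] that tl' unfolding branch_claim_def by blast
      qed
    qed
  next
    case False
    then obtain k where k: "k \<in> K" "E v k" "k \<noteq> r" by blast
    obtain r0 s q s' r' where hx: "hex v r0 s q s' r'" and hK: "{r0, s, q, s', r'} \<subseteq> K"
      using hex_through[OF Kc(1,3) r(1) k(1) k(3)[symmetric] r(2) k(2)] .
    have fat: "\<not> thin v r0 r'" using x(1) xK(1) hK unfolding thin_def by blast
    obtain P Q a1 b1 a2 b2 where g: "good_theta P Q a1 b1 a2 b2" and vP: "v \<in> {P, a1}"
      and r0: "r0 \<in> theta P Q"
      using good_theta_at[OF hx fat] by metis
    note gb = good_theta_basic[OF g]
    let ?T = "theta P Q" and ?R = "near (theta P Q) Q b2" and ?L = "near (theta P Q) P a1"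
    have r0v: "r0 \<noteq> v" "r0 \<in> K" using hK Kc(3) by auto
    have TK: "?T - {v} \<subseteq> K"
      by (rule theta_subset[OF g, of K "{v}" r0]) (use Kcl vP r0v r0 in auto)
    have RK: "?R \<subseteq> K"
      by (rule far_subset[OF g, of K "{v}"]) (use Kcl vP TK in auto)
    have QK: "Q \<in> K" using TK gb(10,11) vP by auto
    have "Q \<notin> ?R" using near_subset gb(11) by blast
    then have "card ?R < card K" using RK QK fin by (intro psubset_card_mono) auto
    then have "theta_claim Q P b2 a2 b1 a1" using IHt[of Q P b2] theta_commute by metis
    note rep1 = theta_rep_claim[OF g this]
    \<comment> \<open>The \<open>t\<close> form a leg from \<open>v\<close> inside the theta graph
      that avoids the open edge.\<close>
    obtain c t1 t2 t3 where c: "{v, c} = {P, a1}" "v \<noteq> c" "E v c"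
      and t: "E v t1" "E t1 t2" "E t2 t3" "\<not> E v t3" "{t1, t2, t3} \<subseteq> ?T - {P, a1}"
    proof (cases "v = P")
      case True
      then show ?thesis using that[of a1 a2 b2 Q] gb(1,4-7,10,11) by auto
    next
      case False
      then have "v = a1" using vP by blast
      then show ?thesis using that[of P b1 Q b2] gb(1-3,6,8,10,11) sym by auto
    qed
    have cK: "c \<in> K" using TK c(1,2) gb(11) by blast
    have xout: "x1 \<notin> {P, a1, b1, Q, b2, a2}" "x2 \<notin> {P, a1, b1, Q, b2, a2}"
      using TK gb(11) xK xv by blast+
    have xE: "\<not> E p x1" "\<not> E p x2" "\<not> E p x3" if "p \<in> K" for p
      using Kcl[OF that] xK xv by blast+
    have LK: "comp (- ?T) z \<subseteq> K" if "z \<in> K" "z \<notin> ?T" for z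
    proof -
      have zT: "z \<in> - ?T" using that by blast
      have "v \<in> ?T" using vP gb(11) by blast
      then show ?thesis
        by (intro conn_closed[OF conn_comp[OF zT] comp_self that(1)])
          (use Kcl comp_subset[OF zT] in blast)
    qed
    \<comment> \<open>A component inside \<open>K\<close> near the open edge cannot touch
      \<open>v\<close>: as \<open>K\<close> is connected it would also touch \<open>c\<close>, which
      makes it nonfull at \<open>v\<close>. Its leg, the leg in the theta graph and the tail would
      form an \<open>S_3_3_3\<close>.\<close>
    have no_both: False if z: "z \<in> K" "z \<in> ?L" and y: "y1 \<in> comp (- ?T) z" "E v y1" for z y1
    proof -
      let ?C = "comp (- ?T) z"
      have zT: "z \<in> - ?T" using near_not_far(3)[OF g z(2)] by blast
      have sub: "?C \<subseteq> K" "?C \<subseteq> - ?T" using LK[OF z(1)] zT comp_subset[OF zT] by blast+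
      have C: "conn ?C" using conn_comp[OF zT] .
      have near: "u \<in> ?L" if "u \<in> ?C" for u using near_comp[OF z(2)] that by blast
      have nbr: "u = v \<or> u = c \<or> u \<in> ?C" if "w \<in> ?C" "E w u" for w u
        using near_nbr[OF g near[OF that(1)] that(2)] comp_closed[OF zT that] c(1) by blast
      have "\<exists>y2\<in>?C. E c y2"
      proof (rule ccontr)
        assume no: "\<not> ?thesis"
        have "K \<subseteq> ?C"
          by (rule conn_closed[OF Kc(1) _ y(1)]) (use sub y nbr no Kc(3) sym in blast)+
        moreover have "c \<notin> ?C" using sub(2) c(1) gb(11) by blast
        ultimately show False using cK by blast
      qed
      then obtain y2 where y2: "y2 \<in> ?C" "E c y2" by blast
      have "y1 \<noteq> y2" using y(2) y2(2) c(3) no_triangle[of v c y2] by blast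
      then obtain y3 where y3: "y3 \<in> ?C" "E y2 y3" using conn_nbr[OF C y2(1) y(1) y2(1)] by blast
      have "\<not> E v y3"
      proof
        assume "E v y3"
        moreover have "v \<noteq> y2" using sub(1) y2(1) Kc(3) by blast
        ultimately have "y3 = c" using common_nbr[of v y3 y2 c] y2(2) y3(2) c(3) sym by blast
        then show False using y3(1) sub(2) c(1) gb(11) by blast
      qed
      moreover have "opp v y3" using c(3) y2(2) y3(2) bip unfolding opp_def by blast
      ultimately have "nonfull v ?C" using y3(1) unfolding nonfull_def by blast
      then obtain k1 k2 k3 where kk: "k1 \<in> ?C" "k2 \<in> ?C" "k3 \<in> ?C" "E v k1" "E k1 k2" "E k2 k3" "\<not> E v k3"
        using nonfull_path[OF C y(1,2)] by blast
      have tK: "{t1, t2, t3} \<subseteq> K" using t(5) TK vP by blast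
      show False
      proof (rule no_S333[OF kk(4-7) t(1-4) x])
        show "{k1, k2, k3} \<inter> {t1, t2, t3} = {}" using kk sub t(5) by blast
        show "{k1, k2, k3} \<inter> {x1, x2, x3} = {}" using kk sub xK by blast
        show "{t1, t2, t3} \<inter> {x1, x2, x3} = {}" using tK xK by blast
        show "\<not> E p u" if "p \<in> {k1, k2, k3}" "u \<in> {t1, t2, t3}" for p u
          using nbr[of p u] that kk(1-3) t(5) c(1) sub(2) by blast
        show "\<not> E p u" if "p \<in> {k1, k2, k3}" "u \<in> {x1, x2, x3}" for p u
          using xE[of p] that kk(1-3) sub(1) by blast
        show "\<not> E p u" if "p \<in> {t1, t2, t3}" "u \<in> {x1, x2, x3}" for p u
          using xE[of p] that tK by blast
      qed
    qed
    let ?A = "?T - {P, a1} \<union> ?R"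
    let ?B = "K - {c} - ?A"
    have cT: "c \<in> {P, a1}" "c \<in> ?T" and RT: "?R \<inter> ?T = {}"
      using c(1) gb(11) near_subset by blast+
    have AK: "?A \<subseteq> K - {c}"
    proof
      fix z assume "z \<in> ?A"
      then show "z \<in> K - {c}" using TK RK vP cT RT by auto
    qed
    have pv: "u = v \<or> u = c" if "u \<in> {P, a1}" for u
      using that unfolding c(1)[symmetric] by simp
    have Bnear: "z \<in> ?L" "z \<notin> ?T" if "z \<in> ?B" for z
    proof -
      show zT: "z \<notin> ?T" using that pv Kc(3) by blast
      show "z \<in> ?L" using outside_near_or_far[OF g Kc(1,2) _ zT QK] gb(11) that by blast
    qed
    \<comment> \<open>A component touching only \<open>c\<close> and containing an edge has depth 2
      at \<open>c\<close>, while the tail has depth 2 at \<open>v\<close>, against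
      \<open>no_deep\<close>. So the leftover vertices have no neighbour in \<open>K\<close> except
      \<open>c\<close>.\<close>
    have Biso: "\<not> E z w" if z: "z \<in> ?B" and w: "w \<in> K - {c}" for z w
    proof
      assume zw: "E z w"
      let ?C = "comp (- ?T) z"
      have zT: "z \<in> - ?T" and zL: "z \<in> ?L" using Bnear[OF z] by auto
      have wT: "w \<in> - ?T" using near_nbr[OF g zL zw] w pv Kc(3) by blast
      have w': "w \<in> ?C" using comp_closed[OF zT comp_self zw wT] .
      have C: "conn ?C" using conn_comp[OF zT] .
      obtain y where y: "y \<in> ?C" "E P y \<or> E a1 y" using zL unfolding near_def by blast
      then have "E v y \<or> E c y" using c(1) by (auto simp: doubleton_eq_iff)
      then have Ey: "E c y" using no_both[of z y] z zL y(1) by blast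
      have "z \<noteq> w" using zw irrefl by blast
      then obtain y' where y': "y' \<in> ?C" "E y y'" using conn_nbr[OF C y(1) comp_self w'] by blast
      have nl: "u \<in> ?L" if "u \<in> ?C" for u using near_comp[OF zL] that by blast
      have out: "u \<notin> {P, a1, b1, Q, b2, a2}" if "u \<in> ?C" for u
        using near_not_far(3)[OF g nl[OF that]] gb(11) by blast
      have yK: "y' \<in> K" using LK[of z] z zT y'(1) by blast
      have b2K: "b2 \<in> K" using TK gb(10,11) vP by auto
      show False
      proof (cases "v = P")
        case True
        then have "c = a1" using c(1,2) by (auto simp: doubleton_eq_iff)
        then show False
          using no_deep[OF g _ x(2) _ y'(2) xout out[OF y(1)] out[OF y'(1)]]
            x(1) Ey True xE(2)[OF QK] xE(2)[OF yK] near_not_far[OF g nl[OF y'(1)]] sym by blast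
      next
        case False
        then have "v = a1" "c = P" using c(1,2) by (auto simp: doubleton_eq_iff)
        then show False
          using no_deep[OF g _ y'(2) _ x(2) out[OF y(1)] out[OF y'(1)] xout]
            x(1) Ey xE(2)[OF b2K] xE(2)[OF yK] near_not_far[OF g nl[OF y'(1)]] sym by blast
      qed
    qed
    have "rep (?A \<union> ?B) {z. E P z \<or> E a1 z}"
      by (rule rep_isolated_set[OF _ rep1]) (use fin Biso AK in auto)
    moreover have "?A \<union> ?B = K - {c}" using AK by blast
    ultimately have "rep (K - {c}) {z. E P z \<or> E a1 z}" by simp
    moreover have "{z. E P z \<or> E a1 z} = {z. E v z \<or> E c z}"
      using c(1) by (auto simp: doubleton_eq_iff)
    ultimately have "rep (K - {c}) {z. E v z \<or> E c z}" by simp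
    \<comment> \<open>As \<open>v\<close> and \<open>c\<close> are adjacent, the exposed vertices on
      the side of \<open>c\<close> are exactly the neighbours of \<open>v\<close>, and
      \<open>c\<close> is one as well.\<close>
    then have "rep (insert c (K - {c})) (insert c {z \<in> {z. E v z \<or> E c z}. \<not> opp z c})"
      by (rule rep_add_end) (use c(3) bip sym in \<open>unfold opp_def, blast+\<close>)
    moreover have "insert c (K - {c}) = K" using cK by blast
    moreover have "insert c {z \<in> {z. E v z \<or> E c z}. \<not> opp z c} \<inter> K = {z. E v z} \<inter> K"
      using c(3) bip unfolding opp_def by blast
    ultimately show ?thesis using rep_cong by metis
  qed
qed

text \<open>At the end \<open>a\<close> there are only isolated vertices. Everything else consists
  of branches at \<open>p\<close>, with a tail through the theta graph. A single branch may fill the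
  whole near part, so \<open>IHb\<close> includes equal size. The names \<open>p\<close>,
  \<open>a\<close> leave open which end is \<open>P\<close>.\<close>

lemma theta_step_disjoint:
  fixes p a :: 'a
  assumes g: "good_theta P Q a1 b1 a2 b2" and pa: "{p, a} = {P, a1}"
    and t: "E p t1" "E t1 t2" "E t2 t3" "\<not> E p t3" "{t1, t2, t3} \<subseteq> theta P Q - {P, a1}"
    and no: "\<And>x y1 y2. x \<in> near (theta P Q) P a1 \<Longrightarrow> y1 \<in> comp (- theta P Q) x \<Longrightarrow>
      y2 \<in> comp (- theta P Q) x \<Longrightarrow> E p y1 \<Longrightarrow> \<not> E a y2"
    and iso: "\<And>x y w. x \<in> near (theta P Q) P a1 \<Longrightarrow> y \<in> comp (- theta P Q) x \<Longrightarrow> E a y \<Longrightarrow>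
      w \<in> near (theta P Q) P a1 \<Longrightarrow> \<not> E x w"
    and IHb: "\<And>v' K'. card K' \<le> card (near (theta P Q) P a1) \<Longrightarrow> branch_claim v' K'"
  shows "rep (near (theta P Q) P a1) {z. E P z \<or> E a1 z}"
proof -
  let ?T = "theta P Q" and ?L = "near (theta P Q) P a1"
  note gb = good_theta_basic[OF g]
  define B where "B = {x \<in> ?L. \<exists>y\<in>comp (- ?T) x. E p y}"
  have BL: "B \<subseteq> ?L" unfolding B_def by blast
  have LT: "?L \<inter> ?T = {}" "?L \<subseteq> V" using near_subset by blast+
  have finL: "finite ?L" using LT(2) finV finite_subset by blast
  have pT: "p \<in> ?T" "a \<in> ?T" using pa gb(11) by blast+
  have Ba: "\<not> E a y" if "y \<in> B" for y
    using that no comp_self unfolding B_def by blast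
  have compB: "comp (- ?T) x \<subseteq> B" if "x \<in> B" for x
  proof
    fix y assume y: "y \<in> comp (- ?T) x"
    have xL: "x \<in> ?L" and xT: "x \<in> - ?T" using that BL LT by blast+
    have "comp (- ?T) y = comp (- ?T) x" using comp_eq[OF xT y] .
    moreover have "y \<in> ?L" using near_comp[OF xL] y by blast
    ultimately show "y \<in> B" using that unfolding B_def by simp
  qed
  have Bcl: "y \<in> B \<or> y = p" if "x \<in> B" "E x y" for x y
  proof (cases "y \<in> ?T")
    case True
    then have "y \<in> {p, a}" using near_nbr[OF g _ that(2)] that(1) BL pa by blast
    then show ?thesis using Ba[OF that(1)] that(2) sym by blast
  next
    case False
    have "x \<in> - ?T" using that(1) BL LT by blast
    then have "y \<in> comp (- ?T) x" using comp_closed[of x "- ?T" x y] comp_self that(2) False by simp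
    then show ?thesis using compB[OF that(1)] by blast
  qed
  have pB: "p \<notin> B" using BL LT pT by blast
  have repB: "rep B {z. E p z}"
  proof (rule rep_branches[OF _ pB])
    show "finite B" using BL finL finite_subset by blast
    show "branch p (comp B x)" if x: "x \<in> B" for x
    proof -
      have xT: "x \<in> - ?T" using x BL LT by blast
      obtain y where "y \<in> comp (- ?T) x" "E p y" using x unfolding B_def by blast
      moreover have "comp (- ?T) x \<subseteq> comp B x"
        using conn_subset_comp[OF conn_comp[OF xT] compB[OF x] comp_self] .
      moreover have "y \<in> comp B x \<or> y = p" if "z \<in> comp B x" "E z y" for z y
        using comp_closed[OF x that] Bcl[of z y] that comp_subset[OF x] by blast
      moreover have "comp B x \<subseteq> B" using comp_subset[OF x] .
      ultimately show ?thesis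
        using conn_comp[OF x] BL LT(2) pB unfolding branch_def by blast
    qed
    have tl: "tail p C" if "C \<subseteq> B" for C
      by (rule tailI[OF t(1-4)]) (use t(5) that BL LT in blast)
    show "C = C'" if "branch p C" "branch p C'" "C \<subseteq> B" "C' \<subseteq> B" "nonfull p C" "nonfull p C'" for C C'
    proof (rule ccontr)
      assume "C \<noteq> C'"
      then show False
        by (rule no_three_branches[OF that(1,5,2,6)]) (rule tl, use that in blast)
    qed
    show "rep C {z. E p z}" if "branch p C" "C \<subseteq> B" for C
    proof -
      have "card C \<le> card ?L" using that(2) BL finL by (intro card_mono) auto
      then show ?thesis using IHb[of C p] that tl unfolding branch_claim_def by blast
    qed
  qed
  have iso': "\<not> E z w" if zw: "z \<in> ?L - B" "w \<in> ?L" for z w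
  proof -
    have "\<exists>y\<in>comp (- ?T) z. E P y \<or> E a1 y" using zw(1) unfolding near_def by blast
    then obtain y where y: "y \<in> comp (- ?T) z" "E p y \<or> E a y"
      using pa by (auto simp: doubleton_eq_iff)
    then have "\<not> E p y" using zw(1) unfolding B_def by blast
    then show ?thesis using iso[of z y w] zw y by blast
  qed
  have "rep (B \<union> (?L - B)) {z. E P z \<or> E a1 z}"
  proof (rule rep_isolated_set[OF _ repB])
    show "{z. E P z \<or> E a1 z} \<inter> B = {z. E p z} \<inter> B"
      using Ba pa by (auto simp: doubleton_eq_iff)
  qed (use finL BL iso' in auto)
  moreover have "B \<union> (?L - B) = ?L" using BL by blast
  ultimately show ?thesis by simp
qed

text \<open>The joint component contains a hexagon over \<open>P a1\<close>. Both ends are fat in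
  it, because of \<open>a2\<close> and \<open>b1\<close>, so it yields a good theta graph with the
  same open edge that otherwise lies inside the component. Seen from either theta graph, the other
  one belongs to a component touching both ends, so \<open>near_isolated\<close> leaves only
  isolated vertices besides.\<close>

lemma theta_step_joint:
  assumes g: "good_theta P Q a1 b1 a2 b2"
    and Y: "x \<in> near (theta P Q) P a1" "y1 \<in> comp (- theta P Q) x" "y2 \<in> comp (- theta P Q) x"
      "E P y1" "E a1 y2"
    and IHt: "\<And>P' Q' a1' b1' a2' b2'. card (near (theta P' Q') P' a1') < card (near (theta P Q) P a1) \<Longrightarrow>
      theta_claim P' Q' a1' b1' a2' b2'"
  shows "rep (near (theta P Q) P a1) {z. E P z \<or> E a1 z}"
proof -
  let ?T = "theta P Q" and ?L = "near (theta P Q) P a1"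
  note gb = good_theta_basic[OF g]
  let ?Y = "comp (- ?T) x"
  have LT: "?L \<inter> ?T = {}" "?L \<subseteq> V" using near_subset by blast+
  have finL: "finite ?L" using LT(2) finV finite_subset by blast
  have xT: "x \<in> - ?T" using Y(1) LT by blast
  have YL: "?Y \<subseteq> ?L" using near_comp[OF Y(1)] .
  have Yc: "conn ?Y" using conn_comp[OF xT] .
  have PY: "P \<notin> ?Y" "a1 \<notin> ?Y" using YL LT gb(11) by blast+
  have Ycl: "y \<in> ?Y \<or> y \<in> {P, a1}" if "z \<in> ?Y" "E z y" for z y
    using near_nbr[OF g _ that(2)] comp_closed[OF xT that] that(1) YL by blast
  obtain u1 w1 w2 u2 where hx: "hex P a1 u2 w2 w1 u1" and uY: "{u1, w1, w2, u2} \<subseteq> ?Y"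
    using hex_over_edge[OF Yc gb(1) PY Y(2,4,3,5)] .
  have "a2 \<noteq> a1" "a2 \<noteq> u1" "b1 \<noteq> P" "b1 \<noteq> u2" using gb(10,11) uY YL LT by auto
  then have fat: "\<not> thin P a1 u1" "\<not> thin a1 P u2" using gb(2,4) unfolding thin_def by blast+
  obtain P' Q' a1' b1' a2' b2' where g': "good_theta P' Q' a1' b1' a2' b2'"
    and eq: "{P, a1} = {P', a1'}" and u2: "u2 \<in> theta P' Q'"
    using good_theta_at[OF hx fat(1)] fat(2) by metis
  note gb' = good_theta_basic[OF g']
  let ?T' = "theta P' Q'" and ?R = "near (theta P' Q') Q' b2'" and ?L' = "near (theta P' Q') P' a1'"
  have u2Y: "u2 \<in> ?Y" using uY by blast
  have TY: "?T' - {P, a1} \<subseteq> ?Y"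
    by (rule theta_subset[OF g', of ?Y "{P, a1}" u2]) (use Ycl eq u2 u2Y PY in blast)+
  have RY: "?R \<subseteq> ?Y"
    by (rule far_subset[OF g', of ?Y "{P, a1}"]) (use Ycl eq TY in auto)
  have QY: "Q' \<in> ?Y" using TY gb'(10,11) eq by auto
  have "Q' \<notin> ?R" using near_subset gb'(11) by blast
  then have "card ?R < card ?L" using RY QY YL finL by (intro psubset_card_mono) auto
  then have "theta_claim Q' P' b2' a2' b1' a1'" using IHt[of Q' P' b2'] theta_commute by metis
  note rep1 = theta_rep_claim[OF g' this]
  have Neq: "{z. E P' z \<or> E a1' z} = {z. E P z \<or> E a1 z}"
    using eq by (auto simp: doubleton_eq_iff)
  let ?A = "?T' - {P, a1} \<union> ?R"
  have rep2: "rep ?A {z. E P z \<or> E a1 z}" using rep1 unfolding Neq eq .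
  have AY: "?A \<subseteq> ?Y" using TY RY by blast
  have T'P: "P \<in> ?T'" "a1 \<in> ?T'" using eq gb'(11) by blast+
  have T'T: "?T' \<inter> ?T \<subseteq> {P, a1}" using TY YL LT by blast
  have a2T': "a2 \<in> - ?T'" "b1 \<in> - ?T'" "b2 \<in> - ?T'" "Q \<in> - ?T'"
    using T'T gb(10,11) by auto
  have inY0: "a2 \<in> comp (- ?T') a2" "b1 \<in> comp (- ?T') a2"
  proof -
    show "a2 \<in> comp (- ?T') a2" by (rule comp_self)
    then have "b2 \<in> comp (- ?T') a2" using comp_closed[OF a2T'(1)] gb(5) a2T' by blast
    then have "Q \<in> comp (- ?T') a2" using comp_closed[OF a2T'(1)] gb(6) a2T' by blast
    then show "b1 \<in> comp (- ?T') a2" using comp_closed[OF a2T'(1)] gb(3) a2T' sym by blast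
  qed
  have "E P' a2 \<or> E a1' a2" using gb(4) eq by (auto simp: doubleton_eq_iff)
  then have a2L': "a2 \<in> ?L'" using a2T'(1) inY0(1) E_V2[OF gb(4)] unfolding near_def by blast
  obtain p1 p2 where p: "p1 \<in> comp (- ?T') a2" "p2 \<in> comp (- ?T') a2" "E P' p1" "E a1' p2"
    using inY0 gb(2,4) eq by (auto simp: doubleton_eq_iff)
  have Yiso: "\<not> E z w" if z: "z \<in> ?Y" "z \<notin> ?A" and w: "w \<in> ?L" for z w
  proof
    assume zw: "E z w"
    have wP: "w \<notin> {P, a1}" using w LT gb(11) by blast
    then have wY: "w \<in> ?Y" using Ycl[OF z(1) zw] by blast
    have zT': "z \<in> - ?T'" using z PY by blast
    have "z \<in> V" using z(1) YL LT by blast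
    then have zL': "z \<in> ?L'"
      using outside_near_or_far[OF g' Yc _ z(1) _ QY] z zT' YL LT(2) gb'(11) by blast
    have "w \<notin> ?T'" using near_nbr[OF g' zL' zw] wP eq by blast
    then have wL': "w \<in> ?L'" using near_closed[OF zL' zw] by blast
    have "comp (- ?T') z \<subseteq> ?Y"
      by (rule conn_closed[OF conn_comp[OF zT'] comp_self z(1)])
        (use Ycl comp_subset[OF zT'] T'P in blast)
    moreover have "a2 \<notin> ?Y" using YL LT gb(11) by blast
    ultimately have "z \<notin> comp (- ?T') a2"
      using comp_eq[OF a2T'(1), of z] comp_self[of a2 "- ?T'"] by blast
    then show False using near_isolated[OF g' a2L' p zL' _ wL'] zw by blast
  qed
  have iso: "\<not> E z w" if "z \<in> ?L - ?A" "w \<in> ?L" for z w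
  proof (cases "z \<in> ?Y")
    case True
    then show ?thesis using Yiso that by blast
  next
    case False
    then show ?thesis using near_isolated[OF g Y _ False that(2)] that(1) by blast
  qed
  have AL: "?A \<subseteq> ?L" using AY YL by blast
  have "rep (?A \<union> (?L - ?A)) {z. E P z \<or> E a1 z}"
    by (rule rep_isolated_set[OF _ rep2]) (use finL AL iso in blast)+
  moreover have "?A \<union> (?L - ?A) = ?L" using AL by blast
  ultimately show ?thesis by simp
qed

text \<open>If no component touches both ends, \<open>no_deep\<close> forbids components with an
  edge at both ends at once, so one end carries only isolated vertices.\<close>

lemma theta_step:
  assumes g: "good_theta P Q a1 b1 a2 b2"
    and IHb: "\<And>v' K'. card K' \<le> card (near (theta P Q) P a1) \<Longrightarrow> branch_claim v' K'"
    and IHt: "\<And>P' Q' a1' b1' a2' b2'. card (near (theta P' Q') P' a1') < card (near (theta P Q) P a1) \<Longrightarrow>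
      theta_claim P' Q' a1' b1' a2' b2'"
  shows "rep (near (theta P Q) P a1) {z. E P z \<or> E a1 z}"
proof (cases "\<exists>x\<in>near (theta P Q) P a1. \<exists>y1\<in>comp (- theta P Q) x. \<exists>y2\<in>comp (- theta P Q) x. E P y1 \<and> E a1 y2")
  case True
  then show ?thesis using theta_step_joint[OF g _ _ _ _ _ IHt] by blast
next
  case False
  let ?T = "theta P Q" and ?L = "near (theta P Q) P a1"
  note gb = good_theta_basic[OF g]
  have no: "\<not> E a1 y2" if "x \<in> ?L" "y1 \<in> comp (- ?T) x" "y2 \<in> comp (- ?T) x" "E P y1" for x y1 y2
    using False that by blast
  have no': "\<not> E P y2" if "x \<in> ?L" "y1 \<in> comp (- ?T) x" "y2 \<in> comp (- ?T) x" "E a1 y1" for x y1 y2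
    using False that by blast
  have out: "v \<notin> {P, a1, b1, Q, b2, a2}" if "v \<in> ?L" for v
    using near_not_far(3)[OF g that] gb(11) by blast
  have either: False if p: "x \<in> ?L" "y \<in> comp (- ?T) x" "E P y" "w \<in> ?L" "E x w"
    and a: "x' \<in> ?L" "y' \<in> comp (- ?T) x'" "E a1 y'" "w' \<in> ?L" "E x' w'" for x y w x' y' w'
  proof -
    have xT: "x \<in> - ?T" "w \<in> - ?T" "x' \<in> - ?T" "w' \<in> - ?T" using p a near_not_far(3)[OF g] by auto
    have "w \<in> comp (- ?T) x" "w' \<in> comp (- ?T) x'"
      using comp_closed[OF xT(1) comp_self p(5) xT(2)] comp_closed[OF xT(3) comp_self a(5) xT(4)] .
    moreover have "x \<noteq> w" "x' \<noteq> w'" using p a irrefl by blast+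
    ultimately obtain y1 y1' where y1: "y1 \<in> comp (- ?T) x" "E y y1" "y1' \<in> comp (- ?T) x'" "E y' y1'"
      using conn_nbr[OF conn_comp[OF xT(1)] p(2) comp_self] conn_nbr[OF conn_comp[OF xT(3)] a(2) comp_self]
      by metis
    have ne: "comp (- ?T) x \<noteq> comp (- ?T) x'" using no p a by blast
    have nL: "u \<in> ?L" if "u \<in> comp (- ?T) x \<or> u \<in> comp (- ?T) x'" for u
      using near_comp[OF p(1)] near_comp[OF a(1)] that by blast
    show False
      by (rule no_deep[OF g p(3) y1(2) a(3) y1(4)])
        (use out nL p a y1 near_not_far[OF g] comp_edge[OF xT(1,3) ne] in blast)+
  qed
  consider "\<And>x y w. x \<in> ?L \<Longrightarrow> y \<in> comp (- ?T) x \<Longrightarrow> E a1 y \<Longrightarrow> w \<in> ?L \<Longrightarrow> \<not> E x w"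
    | "\<And>x y w. x \<in> ?L \<Longrightarrow> y \<in> comp (- ?T) x \<Longrightarrow> E P y \<Longrightarrow> w \<in> ?L \<Longrightarrow> \<not> E x w"
    using either by blast
  then show ?thesis
  proof cases
    case 1
    show ?thesis
      by (rule theta_step_disjoint[OF g refl gb(4-7) _ no 1 IHb]) (use gb(10,11) in auto)
  next
    case 2
    have "{a1, P} = {P, a1}" by blast
    then show ?thesis
      by (rule theta_step_disjoint[OF g _ gb(2,3) sym[OF gb(6)] gb(8) _ no' 2 IHb])
        (use gb(10,11) in auto)
  qed
qed

text \<open>At equal size branches come first: \<open>branch_step\<close> uses only smaller sizes,
  whereas \<open>theta_step\<close> uses branches of size \<open>n\<close> too.\<close>

lemma claims:
  "(\<forall>K v. card K = n \<longrightarrow> branch_claim v K) \<and>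
   (\<forall>P Q a1 b1 a2 b2. card (near (theta P Q) P a1) = n \<longrightarrow> theta_claim P Q a1 b1 a2 b2)"
proof (induction n rule: less_induct)
  case (less n)
  have IHb: "branch_claim v K" if "card K < n" for v K using less[OF that] by blast
  have IHt: "theta_claim P Q a1 b1 a2 b2" if "card (near (theta P Q) P a1) < n" for P Q a1 b1 a2 b2
    using less[OF that] by blast
  have b: "branch_claim v K" if "card K = n" for v K
    unfolding branch_claim_def using branch_step[of v K] IHb IHt that by blast
  have b': "branch_claim v K" if "card K \<le> n" for v K
    using b IHb that by (cases "card K = n") auto
  have "theta_claim P Q a1 b1 a2 b2" if "card (near (theta P Q) P a1) = n" for P Q a1 b1 a2 b2
    unfolding theta_claim_def using theta_step[of P Q a1 b1 a2 b2] b' IHt that by blast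
  then show ?case using b by blast
qed

lemma branch_rep: "branch v K \<Longrightarrow> tail v K \<Longrightarrow> rep K {z. E v z}"
  using claims unfolding branch_claim_def by blast

lemma near_rep:
  "good_theta P Q a1 b1 a2 b2 \<Longrightarrow> rep (near (theta P Q) P a1) {z. E P z \<or> E a1 z}"
  using claims unfolding theta_claim_def by blast

section \<open>Whole components\<close>

lemma rep_of_rest:
  assumes C: "rep C {}" "C \<subseteq> S" and D: "rep (S - C) {}" and cl: "\<And>x y. x \<in> C \<Longrightarrow> E x y \<Longrightarrow> y \<in> C"
  shows "rep S {}"
proof -
  have "rep (C \<union> (S - C) \<union> {}) {}"
    by (rule rep_mid[OF C(1) D]) (use cl in blast)+
  then show ?thesis using C(2) by (simp add: Un_absorb1)
qed

text \<open>\<open>{P, a1}\<close> is the middle of \<open>rep_mid\<close>, between the near part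
  and the rest of the theta graph with the far part.\<close>

lemma rep_theta_component:
  assumes g: "good_theta P Q a1 b1 a2 b2"
  shows "rep (near (theta P Q) P a1 \<union> (theta P Q - {P, a1} \<union> near (theta P Q) Q b2) \<union> {P, a1}) {}"
proof -
  let ?T = "theta P Q"
  let ?L = "near ?T P a1" and ?R = "near ?T Q b2"
  note gb = good_theta_basic[OF g]
  have "rep (near (theta Q P) Q b2) {z. E Q z \<or> E b2 z}"
    using near_rep[OF good_theta_reverse[OF g]] .
  then have R: "rep (?T - {P, a1} \<union> ?R) {z. E P z \<or> E a1 z}"
    using theta_rep[OF g] theta_commute by metis
  have T: "?L \<inter> ?T = {}" "?R \<inter> ?T = {}" using near_subset by blast+
  have Lnb: "t \<in> {P, a1}" if "z \<in> ?L" "E z t" "t \<in> ?T" for z t using near_nbr[OF g that] .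
  have LR: "z \<notin> ?R" if "z \<in> ?L" for z
  proof
    assume "z \<in> ?R"
    then obtain y where y: "y \<in> comp (- ?T) z" "E Q y \<or> E b2 y" unfolding near_def by blast
    then have "y \<in> ?L" using near_comp[OF that] by blast
    then show False using near_not_far[OF g] y(2) sym by blast
  qed
  have side: "E z t \<longleftrightarrow> z \<in> {z. E P z \<or> E a1 z}" if "t \<in> {P, a1}" "opp z t" for z t
    using that gb(1) bip sym unfolding opp_def by blast
  show ?thesis
  proof (rule rep_mid[OF near_rep[OF g] R])
    show "?L \<inter> (?T - {P, a1} \<union> ?R) = {}" using T LR by blast
    show "?L \<inter> {P, a1} = {}" "(?T - {P, a1} \<union> ?R) \<inter> {P, a1} = {}" using T gb(11) by blast+
    show "\<not> E x y" if "x \<in> ?L" "y \<in> ?T - {P, a1} \<union> ?R" for x y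
      using Lnb[OF that(1), of y] near_closed[OF that(1), of y] LR[of y] T that(2) by blast
    show "E s t" if "s \<in> {P, a1}" "t \<in> {P, a1}" "opp s t" for s t
      using that gb(1) sym unfolding opp_def by blast
  qed (use side in auto)
qed

text \<open>The induction of \<open>branch_step\<close> in a hexagon-free part where no tail is at
  hand: \<open>uniq\<close> supplies what \<open>tail\<close> and \<open>no_three_branches\<close>
  supply there.\<close>

lemma rep_forest_branch:
  assumes S: "\<And>x y. x \<in> S \<Longrightarrow> E x y \<Longrightarrow> y \<in> S"
    and nohex: "\<And>a b c d e f. a \<in> S \<Longrightarrow> \<not> hex a b c d e f"
    and uniq: "\<And>v C C'. v \<in> S \<Longrightarrow> branch v C \<Longrightarrow> branch v C' \<Longrightarrow> nonfull v C \<Longrightarrow> nonfull v C' \<Longrightarrow> C = C'"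
  shows "branch v K \<Longrightarrow> K \<subseteq> S \<Longrightarrow> v \<in> S \<Longrightarrow> rep K {z. E v z}"
proof (induction "card K" arbitrary: K v rule: less_induct)
  case less
  have K: "conn K" "v \<notin> K" "finite K"
    using less.prems finV finite_subset unfolding branch_def by blast+
  obtain r where r: "r \<in> K" "E v r" using less.prems unfolding branch_def by blast
  have one: "k = r" if k: "k \<in> K" "E v k" for k
  proof (rule ccontr)
    assume ne: "k \<noteq> r"
    obtain r0 s q s' r' where "hex v r0 s q s' r'"
      by (rule hex_through[OF K(1,2) k(1) r(1) ne k(2) r(2)])
    then show False using nohex less.prems(3) by blast
  qed
  have rS: "r \<in> S" using r less.prems(2) by blast
  show ?case
  proof (rule rep_single[OF less.prems(1) r])
    show "k = r" if "k \<in> K" "E v k" for k using one that .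
    show "C = C'" if "branch r C" "branch r C'" "nonfull r C" "nonfull r C'" for C C'
      using uniq[OF rS that] .
    show "rep C {z. E r z}" if "branch r C" "C \<subseteq> K - {r}" for C
    proof (rule less.hyps[OF _ that(1) _ rS])
      show "card C < card K" using that(2) r(1) K(3) by (intro psubset_card_mono) auto
      show "C \<subseteq> S" using that(2) less.prems(2) by blast
    qed
  qed
qed

text \<open>A component, of a good theta graph if there is a hexagon and of a suitable vertex
  otherwise, is split off; the rest is a smaller closed set.\<close>

lemma rep_closed:
  assumes "S \<subseteq> V" "\<And>x y. x \<in> S \<Longrightarrow> E x y \<Longrightarrow> y \<in> S"
  shows "rep S {}"
  using assms
proof (induction "card S" arbitrary: S rule: less_induct)
  case less
  note SV = less.prems(1) and Scl = less.prems(2)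
  have finS: "finite S" using SV finV finite_subset by blast
  have reduce: "rep S {}" if C: "rep C {}" "C \<subseteq> S" "C \<noteq> {}" "\<And>x y. x \<in> C \<Longrightarrow> E x y \<Longrightarrow> y \<in> C" for C
  proof (rule rep_of_rest[OF C(1,2) _ C(4)])
    have "S - C \<subset> S" using C(2,3) by blast
    then have "card (S - C) < card S" using finS by (simp add: psubset_card_mono)
    then show "rep (S - C) {}"
      by (rule less.hyps) (use SV Scl C(4) sym in blast)+
  qed
  show ?case
  proof (cases "\<exists>a b c d e f. a \<in> S \<and> hex a b c d e f")
    case True
    then obtain a b c d e f where a: "a \<in> S" and h: "hex a b c d e f" by blast
    have hS: "{a, b, c, d, e, f} \<subseteq> S" using a h Scl unfolding hex_def by blast
    obtain P Q a1 b1 a2 b2 where g: "good_theta P Q a1 b1 a2 b2" and ne: "{P, a1} \<inter> {a, b, c, d, e, f} \<noteq> {}"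
      using good_theta_exists[OF h] .
    note gb = good_theta_basic[OF g]
    let ?T = "theta P Q"
    let ?L = "near ?T P a1" and ?R = "near ?T Q b2"
    let ?C = "?L \<union> (?T - {P, a1} \<union> ?R) \<union> {P, a1}"
    have PS: "P \<in> S" using ne hS gb(1) sym Scl by blast
    have TS: "?T \<subseteq> S" using PS Scl gb(1-3) unfolding theta_def by blast
    have nS: "near ?T p q \<subseteq> S" if "p \<in> S" "q \<in> S" for p q
    proof
      fix x assume x: "x \<in> near ?T p q"
      then have xT: "x \<in> - ?T" using near_subset by blast
      obtain y where y: "y \<in> comp (- ?T) x" "E p y \<or> E q y" using x unfolding near_def by blast
      then have "y \<in> S" using that Scl by blast
      then have "comp (- ?T) x \<subseteq> S"
        by (intro conn_closed[OF conn_comp[OF xT] y(1)]) (use Scl in blast)+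
      then show "x \<in> S" using comp_self[of x] by blast
    qed
    have CS: "?C \<subseteq> S" using TS nS[of P a1] nS[of Q b2] gb(11) by blast
    have PT: "P \<in> ?T" "a1 \<in> ?T" using gb(11) by auto
    have "y \<in> ?C" if xy: "x \<in> ?C" "E x y" for x y
    proof (cases "y \<in> ?T")
      case False
      consider "x \<in> ?L" | "x \<in> ?R" | "x \<in> ?T" using xy(1) PT by auto
      then show ?thesis
      proof cases
        case 1
        then show ?thesis using near_closed[OF 1 that(2) False] by blast
      next
        case 2
        then show ?thesis using near_closed[OF 2 that(2) False] by blast
      next
        case 3
        then have "x \<in> {P, a1, Q, b2}" using theta_exit[OF g 3 that(2) False] by blast
        then show ?thesis
          using that(2) False E_V2[OF that(2)] comp_self[of y "- ?T"] unfolding near_def by blast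
      qed
    qed blast
    then show ?thesis
      by (intro reduce[OF rep_theta_component[OF g] CS]) blast+
  next
    case nohex: False
    show ?thesis
    proof (cases "S = {}")
      case True
      then show ?thesis using rep_empty by simp
    next
      case False
      \<comment> \<open>\<open>v\<close> is the middle of \<open>rep_mid\<close>, with
        \<open>C2\<close> on one side and all other branches on the other, so at most one of the
        latter may be nonfull.\<close>
      have star: "rep S {}"
        if v: "v \<in> S" and C2: "C2 = {} \<or> branch v C2 \<and> nonfull v C2" "rep C2 {z. E v z}"
          and un: "\<And>C C'. branch v C \<Longrightarrow> branch v C' \<Longrightarrow> C \<noteq> C2 \<Longrightarrow> C' \<noteq> C2 \<Longrightarrow> nonfull v C \<Longrightarrow>
            nonfull v C' \<Longrightarrow> C = C'"
          and reps: "\<And>C. branch v C \<Longrightarrow> C \<noteq> C2 \<Longrightarrow> nonfull v C \<Longrightarrow> rep C {z. E v z}" for v C2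
      proof -
        let ?D = "comp S v"
        let ?B = "?D - {v} - C2"
        have Dc: "conn ?D" "?D \<subseteq> S" using conn_comp[OF v] comp_subset[OF v] by blast+
        have Dcl: "y \<in> ?D" if "x \<in> ?D" "E x y" for x y
          using comp_closed[OF v that] Scl Dc(2) that by blast
        have vD: "v \<in> ?D" by (rule comp_self)
        have C2D: "C2 \<subseteq> ?D - {v}"
        proof (cases "C2 = {}")
          case ne: False
          then have br: "branch v C2" using C2(1) by blast
          then obtain k where k: "k \<in> C2" "E v k" unfolding branch_def by blast
          have "C2 \<subseteq> ?D"
          proof (rule conn_closed[OF _ k(1)])
            show "conn C2" using br unfolding branch_def by blast
            show "k \<in> ?D" using Dcl[OF vD k(2)] .
            show "z \<in> ?D" if "y \<in> ?D" "E y z" for y z using Dcl that .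
          qed
          moreover have "v \<notin> C2" using br unfolding branch_def by blast
          ultimately show ?thesis by blast
        qed simp
        have C2cl: "y \<in> C2 \<or> y = v" if "x \<in> C2" "E x y" for x y
          using C2(1) that unfolding branch_def by blast
        have finD: "finite ?D" using Dc(2) finS finite_subset by blast
        have brB: "branch v (comp ?B x) \<and> comp ?B x \<noteq> C2" if x: "x \<in> ?B" for x
        proof -
          have br: "branch v (comp (?D - {v}) x)"
            by (rule conn_branch[OF Dc(1) _ vD]) (use Dc(2) SV Dcl x in blast)+
          have xD: "x \<in> ?D - {v}" using x by blast
          have sub: "comp (?D - {v}) x \<subseteq> ?B"
          proof -
            have "comp (?D - {v}) x \<subseteq> - C2"
              by (rule conn_closed[OF conn_comp[OF xD] comp_self])
                (use x C2cl comp_subset[OF xD] sym in blast)+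
            then show ?thesis using comp_subset[OF xD] by blast
          qed
          have "comp ?B x = comp (?D - {v}) x"
            by (rule branch_eq_comp[OF br comp_self sub]) blast
          then show ?thesis using br sub comp_self[of x "?D - {v}"] x by auto
        qed
        have repB: "rep ?B {z. E v z}"
        proof (rule rep_branches)
          show "finite ?B" "v \<notin> ?B" using finD by auto
          show "branch v (comp ?B x)" if "x \<in> ?B" for x using brB[OF that] by blast
          have neC2: "C \<noteq> C2" if "branch v C" "C \<subseteq> ?B" for C
            using that unfolding branch_def by blast
          show "C = C'" if "branch v C" "branch v C'" "C \<subseteq> ?B" "C' \<subseteq> ?B" "nonfull v C" "nonfull v C'" for C C'
            using un[OF that(1,2) neC2[OF that(1,3)] neC2[OF that(2,4)] that(5,6)] .
          show "rep C {z. E v z}" if "branch v C" "C \<subseteq> ?B" "nonfull v C" for C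
            using reps[OF that(1) neC2[OF that(1,2)] that(3)] .
        qed
        have "rep (?B \<union> C2 \<union> {v}) {}"
        proof (rule rep_mid[OF repB C2(2)])
          show "\<not> E a b" if "a \<in> ?B" "b \<in> C2" for a b
            using C2cl[OF that(2), of a] that(1) sym by blast
          show "E s t" if "s \<in> {v}" "t \<in> {v}" "opp s t" for s t
            using that unfolding opp_def by blast
        qed (use C2D sym in auto)
        moreover have "?B \<union> C2 \<union> {v} = ?D" using C2D vD by blast
        ultimately have "rep ?D {}" by simp
        then show ?thesis by (rule reduce) (use Dc(2) vD Dcl in blast)+
      qed
      show ?thesis
      \<comment> \<open>With two nonfull branches at \<open>v\<close>, every branch at
        \<open>v\<close> has a tail in one of them, so \<open>branch_rep\<close> applies and a third
        nonfull one besides these is limited by \<open>no_three_branches\<close>. If no such vertex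
        exists, any vertex serves as the middle and \<open>rep_forest_branch\<close>
        applies.\<close>
      proof (cases "\<exists>v C C'. v \<in> S \<and> branch v C \<and> branch v C' \<and> C \<noteq> C' \<and> nonfull v C \<and> nonfull v C'")
        case True
        then obtain v C1 C2 where v: "v \<in> S" and br: "branch v C1" "branch v C2" "C1 \<noteq> C2"
          and nf: "nonfull v C1" "nonfull v C2" by blast
        have tl: "tail v C" if t: "nonfull v C'" "branch v C'" "C \<inter> C' = {}" for C C'
        proof -
          obtain k where k: "conn C'" "k \<in> C'" "E v k" using t(2) unfolding branch_def by blast
          obtain k1 k2 k3 where "k1 \<in> C'" "k2 \<in> C'" "k3 \<in> C'" "E v k1" "E k1 k2" "E k2 k3" "\<not> E v k3"
            using nonfull_path[OF k t(1)] by blast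
          then show ?thesis using t(3) by (intro tailI) auto
        qed
        have reps: "rep C {z. E v z}" if "branch v C" "branch v C'" "C \<noteq> C'" "nonfull v C'" for C C'
          using branch_rep[OF that(1) tl[OF that(4,2) branch_disjoint[OF that(1-3)]]] .
        show ?thesis
        proof (rule star[OF v, of C2])
          show "rep C2 {z. E v z}" using reps[OF br(2,1) br(3)[symmetric] nf(1)] .
          show "C = C'" if c: "branch v C" "branch v C'" "C \<noteq> C2" "C' \<noteq> C2" "nonfull v C" "nonfull v C'" for C C'
          proof (rule ccontr)
            assume ne: "C \<noteq> C'"
            have "(C \<union> C') \<inter> C2 = {}"
              using branch_disjoint[OF c(1) br(2) c(3)] branch_disjoint[OF c(2) br(2) c(4)] by blast
            then show False
              using no_three_branches[OF c(1,5,2,6) ne] tl[OF nf(2) br(2)] by blast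
          qed
          show "rep C {z. E v z}" if "branch v C" "C \<noteq> C2" for C
            using reps[OF that(1) br(2) that(2) nf(2)] .
        qed (use br nf in blast)
      next
        case uniq: False
        obtain v where v: "v \<in> S" using False by blast
        show ?thesis
        proof (rule star[OF v, of "{}"])
          show "rep C {z. E v z}" if br: "branch v C" for C
          proof (rule rep_forest_branch[OF _ _ _ br _ v])
            obtain k where k: "conn C" "k \<in> C" "E v k" using br unfolding branch_def by blast
            show "C \<subseteq> S" by (rule conn_closed[OF k(1,2)]) (use Scl v k in blast)+
          qed (use Scl nohex uniq in blast)+
          show "C = C'" if "branch v C" "branch v C'" "nonfull v C" "nonfull v C'" for C C'
            using uniq v that by blast
        qed (use rep_empty in auto)
      qed
    qed
  qed
qed

lemma layout_exists: "\<exists>x h. layout V x h"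
proof -
  have "rep V {}" by (rule rep_closed) (use E_V2 in blast)+
  then show ?thesis unfolding rep_def by blast
qed

end

section \<open>The forbidden subgraphs and the unit disks\<close>

lemma contains_induced_list:
  assumes xs: "distinct xs" "set xs \<subseteq> verts G" and H: "verts H = {..<length xs}"
    and sing: "\<And>i. {i} \<notin> edges H" "\<And>v. {v} \<notin> edges G"
    and adj: "\<And>i j. i < j \<Longrightarrow> j < length xs \<Longrightarrow> {xs ! i, xs ! j} \<in> edges G \<longleftrightarrow> {i, j} \<in> edges H"
  shows "contains_induced G H"
proof -
  have "{i, j} \<in> edges H \<longleftrightarrow> {xs ! i, xs ! j} \<in> edges (induced_subgraph G (set xs))"
    if "i < length xs" "j < length xs" for i j
    using adj[of i j] adj[of j i] sing that
    by (cases i j rule: linorder_cases) (auto simp: induced_subgraph_def insert_commute)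
  moreover have "bij_betw ((!) xs) {..<length xs} (set xs)"
    using bij_betw_nth[OF xs(1)] by simp
  ultimately have "graph_iso H (induced_subgraph G (set xs))"
    unfolding graph_iso_def H by (intro exI[of _ "(!) xs"]) (auto simp: induced_subgraph_def)
  then show ?thesis using xs(2) unfolding contains_induced_def by blast
qed

lemma cycle_6_edges: "edges (cycle_graph 6) = {{0, 1}, {1, 2}, {2, 3}, {3, 4}, {4, 5}, {5, 0}}"
proof -
  have "edges (cycle_graph 6) = (\<lambda>i. {i, Suc i mod 6}) ` {..<6}"
    unfolding cycle_graph_def by auto
  also have "{..<6::nat} = {0, 1, 2, 3, 4, 5}" by auto
  finally show ?thesis by (simp del: One_nat_def)
qed

lemma less_pairs:
  fixes P :: "nat \<Rightarrow> nat \<Rightarrow> bool"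
  assumes "list_all (\<lambda>j. list_all (\<lambda>i. P i j) [0..<j]) [0..<n]" "i < j" "j < n"
  shows "P i j"
  using assms by (auto simp: list_all_iff)

text \<open>With the bound in successor form, \<open>simplified\<close> unfolds the premise into its
  36 or 45 pairs, so that an adjacency table is checked by simplification.\<close>

lemmas less_pairs_9 = less_pairs[where n = "Suc (Suc (Suc (Suc (Suc (Suc (Suc (Suc (Suc 0))))))))", simplified]
lemmas less_pairs_10 = less_pairs[where n = "Suc (Suc (Suc (Suc (Suc (Suc (Suc (Suc (Suc (Suc 0)))))))))", simplified]

context hex_graph
begin

lemma same_side: "(x \<in> U) = (y \<in> U) \<Longrightarrow> \<not> E x y"
  using bip by blast

lemma table_S333:
  assumes x: "E c x1" "E x1 x2" "E x2 x3" "\<not> E c x3" and y: "E c y1" "E y1 y2" "E y2 y3" "\<not> E c y3"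
    and z: "E c z1" "E z1 z2" "E z2 z3" "\<not> E c z3"
    and d: "{x1, x2, x3} \<inter> {y1, y2, y3} = {}" "{x1, x2, x3} \<inter> {z1, z2, z3} = {}"
       "{y1, y2, y3} \<inter> {z1, z2, z3} = {}"
    and xy: "\<And>x y. x \<in> {x1, x2, x3} \<Longrightarrow> y \<in> {y1, y2, y3} \<Longrightarrow> \<not> E x y"
    and xz: "\<And>x z. x \<in> {x1, x2, x3} \<Longrightarrow> z \<in> {z1, z2, z3} \<Longrightarrow> \<not> E x z"
    and yz: "\<And>y z. y \<in> {y1, y2, y3} \<Longrightarrow> z \<in> {z1, z2, z3} \<Longrightarrow> \<not> E y z"
  defines "xs \<equiv> [c, x1, x2, x3, y1, y2, y3, z1, z2, z3]"
  shows "distinct xs" "i < j \<Longrightarrow> j < length xs \<Longrightarrow> E (xs ! i) (xs ! j) \<longleftrightarrow> {i, j} \<in> edges S_3_3_3"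
proof -
  have sd: "x1 \<in> U \<longleftrightarrow> c \<notin> U" "x2 \<in> U \<longleftrightarrow> c \<in> U" "x3 \<in> U \<longleftrightarrow> c \<notin> U"
    "y1 \<in> U \<longleftrightarrow> c \<notin> U" "y2 \<in> U \<longleftrightarrow> c \<in> U" "y3 \<in> U \<longleftrightarrow> c \<notin> U"
    "z1 \<in> U \<longleftrightarrow> c \<notin> U" "z2 \<in> U \<longleftrightarrow> c \<in> U" "z3 \<in> U \<longleftrightarrow> c \<notin> U"
    using x y z bip by blast+
  have "c \<noteq> x2" "c \<noteq> y2" "c \<noteq> z2" "x1 \<noteq> x3" "y1 \<noteq> y3" "z1 \<noteq> z3" using x y z by auto
  moreover have "c \<noteq> x1" "c \<noteq> x3" "c \<noteq> y1" "c \<noteq> y3" "c \<noteq> z1" "c \<noteq> z3" "x1 \<noteq> x2" "x2 \<noteq> x3"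
    "y1 \<noteq> y2" "y2 \<noteq> y3" "z1 \<noteq> z2" "z2 \<noteq> z3"
    using sd by auto
  ultimately show "distinct xs" using d unfolding xs_def by auto
  show "E (xs ! i) (xs ! j) \<longleftrightarrow> {i, j} \<in> edges S_3_3_3" if "i < j" "j < length xs"
  proof (rule less_pairs_10[OF _ that(1)])
    show "j < Suc (Suc (Suc (Suc (Suc (Suc (Suc (Suc (Suc (Suc 0)))))))))" using that(2) by (simp add: xs_def)
  qed (use x y z xy xz yz sd in \<open>simp add: xs_def S_3_3_3_def doubleton_eq_iff same_side numeral_eq_Suc\<close>)
qed

lemma hex_table:
  assumes h: "hex a b c d e f"
  shows "E a b" "E b c" "E c d" "E d e" "E e f" "E a f" "\<not> E a d" "\<not> E b e" "\<not> E c f"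
    "distinct [a, b, c, d, e, f]"
  using h sym hex_opposite[OF h] hex_opposite[OF hex_rot[OF h]] hex_opposite[OF hex_rot[OF hex_rot[OF h]]]
  unfolding hex_def by blast+

lemma hex_pendant:
  assumes h: "hex a b c d e f" and x: "x \<notin> {a, b, c, d, e, f}" "E a x"
  shows "\<not> E c x" "\<not> E e x"
  using hex_one_nbr[OF h x(1), of a c] hex_one_nbr[OF h x(1), of a e] x(2) hex_table(10)[OF h] sym by auto

lemma table_3c:
  assumes h: "hex a b c d e f" and o: "x \<notin> {a, b, c, d, e, f}" "y \<notin> {a, b, c, d, e, f}"
       "z \<notin> {a, b, c, d, e, f}" and p: "E a x" "E b y" "E c z"
  defines "xs \<equiv> [a, b, c, d, e, f, x, y, z]"
  shows "distinct xs" "i < j \<Longrightarrow> j < length xs \<Longrightarrow> E (xs ! i) (xs ! j) \<longleftrightarrow> {i, j} \<in> edges C6_3c"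
proof -
  note ht = hex_table[OF h]
  have sd: "b \<in> U \<longleftrightarrow> a \<notin> U" "c \<in> U \<longleftrightarrow> a \<in> U" "d \<in> U \<longleftrightarrow> a \<notin> U" "e \<in> U \<longleftrightarrow> a \<in> U" "f \<in> U \<longleftrightarrow> a \<notin> U"
    "x \<in> U \<longleftrightarrow> a \<notin> U" "y \<in> U \<longleftrightarrow> a \<in> U" "z \<in> U \<longleftrightarrow> a \<notin> U"
    using hex_sides[OF h] p bip by blast+
  have n: "\<not> E c x" "\<not> E e x" "\<not> E d y" "\<not> E f y" "\<not> E e z" "\<not> E a z"
    using hex_pendant[OF h, of x] hex_pendant[OF hex_rot[OF h], of y]
      hex_pendant[OF hex_rot[OF hex_rot[OF h]], of z] o p by auto
  have m: "\<not> E x y" "\<not> E y z"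
    using common_nbr[of a x y b] common_nbr[of b y z c] common_nbr[of c z y b] p ht o sym by blast+
  have "x \<noteq> z" using n p by blast
  moreover have "x \<noteq> y" "y \<noteq> z" using sd by auto
  ultimately show "distinct xs" using ht o unfolding xs_def by auto
  show "E (xs ! i) (xs ! j) \<longleftrightarrow> {i, j} \<in> edges C6_3c" if "i < j" "j < length xs"
  proof (rule less_pairs_9[OF _ that(1)])
    show "j < Suc (Suc (Suc (Suc (Suc (Suc (Suc (Suc (Suc 0))))))))" using that(2) by (simp add: xs_def)
  qed (use ht p n m sd in \<open>unfold C6_3c_def cycle_6_edges, simp add: xs_def doubleton_eq_iff same_side numeral_eq_Suc\<close>)
qed

lemma table_3nc:
  assumes h: "hex a b c d e f" and o: "x \<notin> {a, b, c, d, e, f}" "y \<notin> {a, b, c, d, e, f}"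
       "z \<notin> {a, b, c, d, e, f}" and p: "E a x" "E c y" "E e z"
  defines "xs \<equiv> [a, b, c, d, e, f, x, y, z]"
  shows "distinct xs" "i < j \<Longrightarrow> j < length xs \<Longrightarrow> E (xs ! i) (xs ! j) \<longleftrightarrow> {i, j} \<in> edges C6_3nc"
proof -
  note ht = hex_table[OF h]
  note h3 = hex_rot[OF hex_rot[OF h]]
  have sd: "b \<in> U \<longleftrightarrow> a \<notin> U" "c \<in> U \<longleftrightarrow> a \<in> U" "d \<in> U \<longleftrightarrow> a \<notin> U" "e \<in> U \<longleftrightarrow> a \<in> U" "f \<in> U \<longleftrightarrow> a \<notin> U"
    "x \<in> U \<longleftrightarrow> a \<notin> U" "y \<in> U \<longleftrightarrow> a \<notin> U" "z \<in> U \<longleftrightarrow> a \<notin> U"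
    using hex_sides[OF h] p bip by blast+
  have n: "\<not> E c x" "\<not> E e x" "\<not> E e y" "\<not> E a y" "\<not> E a z" "\<not> E c z"
    using hex_pendant[OF h, of x] hex_pendant[OF h3, of y]
      hex_pendant[OF hex_rot[OF hex_rot[OF h3]], of z] o p by auto
  have "x \<noteq> z" "x \<noteq> y" "y \<noteq> z" using n p by blast+
  then show "distinct xs" using ht o unfolding xs_def by auto
  show "E (xs ! i) (xs ! j) \<longleftrightarrow> {i, j} \<in> edges C6_3nc" if "i < j" "j < length xs"
  proof (rule less_pairs_9[OF _ that(1)])
    show "j < Suc (Suc (Suc (Suc (Suc (Suc (Suc (Suc (Suc 0))))))))" using that(2) by (simp add: xs_def)
  qed (use ht p n sd in \<open>unfold C6_3nc_def cycle_6_edges, simp add: xs_def doubleton_eq_iff same_side numeral_eq_Suc\<close>)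
qed

text \<open>The three non-edges \<open>q\<close> are those that neither the two sides nor the
  absence of 4-cycles forces.\<close>

lemma table_2l2:
  assumes h: "hex a b c d e f" and o: "x \<notin> {a, b, c, d, e, f}" "y \<notin> {a, b, c, d, e, f}"
       "x' \<notin> {a, b, c, d, e, f}" "y' \<notin> {a, b, c, d, e, f}"
    and p: "E a x" "E x x'" "E b y" "E y y'" and q: "\<not> E x' d" "\<not> E y' e" "\<not> E x' y'"
  defines "xs \<equiv> [a, b, c, d, e, f, x, x', y, y']"
  shows "distinct xs" "i < j \<Longrightarrow> j < length xs \<Longrightarrow> E (xs ! i) (xs ! j) \<longleftrightarrow> {i, j} \<in> edges C6_2l2"
proof -
  note ht = hex_table[OF h]
  have sd: "b \<in> U \<longleftrightarrow> a \<notin> U" "c \<in> U \<longleftrightarrow> a \<in> U" "d \<in> U \<longleftrightarrow> a \<notin> U" "e \<in> U \<longleftrightarrow> a \<in> U" "f \<in> U \<longleftrightarrow> a \<notin> U"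
    "x \<in> U \<longleftrightarrow> a \<notin> U" "x' \<in> U \<longleftrightarrow> a \<in> U" "y \<in> U \<longleftrightarrow> a \<in> U" "y' \<in> U \<longleftrightarrow> a \<notin> U"
    using hex_sides[OF h] p bip by blast+
  have n: "\<not> E c x" "\<not> E e x" "\<not> E d y" "\<not> E f y"
    using hex_pendant[OF h, of x] hex_pendant[OF hex_rot[OF h], of y] o p by auto
  have q': "\<not> E d x'" "\<not> E e y'" using q sym by blast+
  have m: "\<not> E x y" using common_nbr[of a x y b] p ht o sym by blast
  have k: "\<not> E b x'" "\<not> E f x'"
    using common_nbr[of a x x' b] common_nbr[of a x x' f] p ht o by auto
  have k': "\<not> E a y'" "\<not> E c y'"
    using common_nbr[of b y y' a] common_nbr[of b y y' c] p ht o sym by auto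
  have "x \<noteq> y'" "x' \<noteq> y" using m p sym by blast+
  moreover have "x \<noteq> x'" "x \<noteq> y" "x' \<noteq> y'" "y \<noteq> y'" using sd by auto
  ultimately show "distinct xs" using ht o unfolding xs_def by auto
  show "E (xs ! i) (xs ! j) \<longleftrightarrow> {i, j} \<in> edges C6_2l2" if "i < j" "j < length xs"
  proof (rule less_pairs_10[OF _ that(1)])
    show "j < Suc (Suc (Suc (Suc (Suc (Suc (Suc (Suc (Suc (Suc 0)))))))))" using that(2) by (simp add: xs_def)
  qed (use ht p q q' n m k k' sd in \<open>unfold C6_2l2_def cycle_6_edges, simp add: xs_def doubleton_eq_iff same_side numeral_eq_Suc\<close>)
qed

end

lemma x_graph_of_class_X:
  assumes B: "bipartite_graph U W G" and X: "G \<in> class_X"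
  shows "x_graph U (\<lambda>x y. {x, y} \<in> edges G) (verts G)"
proof -
  let ?E = "\<lambda>x y. {x, y} \<in> edges G"
  have sg: "simple_graph G" and VG: "verts G = U \<union> W" "U \<inter> W = {}"
    and iU: "\<And>u v. u \<in> U \<Longrightarrow> v \<in> U \<Longrightarrow> {u, v} \<notin> edges G"
    and iW: "\<And>u v. u \<in> W \<Longrightarrow> v \<in> W \<Longrightarrow> {u, v} \<notin> edges G"
    using B unfolding bipartite_graph_def independent_set_def by auto
  have EV: "x \<in> verts G" "y \<in> verts G" if "{x, y} \<in> edges G" for x y
    using sg that unfolding simple_graph_def by auto
  have sing: "{v} \<notin> edges G" for v
    using sg unfolding simple_graph_def by fastforce
  interpret bip_graph U ?E
  proof
    show "?E y x" if "?E x y" for x y using that by (simp add: insert_commute)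
    show "(x \<in> U) \<noteq> (y \<in> U)" if "?E x y" for x y
      using that iU iW EV[OF that] VG by blast
  qed
  interpret hex_graph U ?E "verts G"
  proof
    show "finite (verts G)" using sg unfolding simple_graph_def by blast
    show "x \<in> verts G" if "?E x y" for x y using EV that by blast
    show "length xs = 6" if c: "icycle xs" for xs
    proof (rule ccontr)
      let ?n = "length xs"
      assume "?n \<noteq> 6"
      moreover have n3: "3 \<le> ?n" and dist: "distinct xs"
        and adj: "\<And>i j. i < ?n \<Longrightarrow> j < ?n \<Longrightarrow> ?E (xs ! i) (xs ! j) \<longleftrightarrow> j = Suc i mod ?n \<or> i = Suc j mod ?n"
        using c unfolding icycle_def by auto
      moreover have "contains_induced G (cycle_graph ?n)"
      proof (rule contains_induced_list[OF dist])
        show "set xs \<subseteq> verts G"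
        proof
          fix v assume "v \<in> set xs"
          then obtain i where i: "i < ?n" "v = xs ! i" by (metis in_set_conv_nth)
          have "Suc i mod ?n < ?n" using n3 by (intro mod_less_divisor) linarith
          then have "?E v (xs ! (Suc i mod ?n))" using adj[of i "Suc i mod ?n"] i by simp
          then show "v \<in> verts G" using EV by blast
        qed
        show "{i} \<notin> edges (cycle_graph ?n)" for i
        proof
          assume "{i} \<in> edges (cycle_graph ?n)"
          then obtain k where "k < ?n" "k = Suc k mod ?n"
            unfolding cycle_graph_def by auto
          then show False using n3 by (cases "Suc k = ?n") auto
        qed
        show "?E (xs ! i) (xs ! j) \<longleftrightarrow> {i, j} \<in> edges (cycle_graph ?n)" if "i < j" "j < ?n" for i j
          using adj[of i j] that unfolding cycle_graph_def by (auto simp: doubleton_eq_iff)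
      qed (use sing in \<open>auto simp: cycle_graph_def\<close>)
      ultimately show False using X unfolding class_X_def by blast
    qed
  qed
  have contra: False
    if "distinct xs" "set xs \<subseteq> verts G" "verts H = {..<length xs}" "\<And>i. {i} \<notin> edges H"
      "\<And>i j. i < j \<Longrightarrow> j < length xs \<Longrightarrow> ?E (xs ! i) (xs ! j) \<longleftrightarrow> {i, j} \<in> edges H"
      "H \<in> {S_3_3_3, C6_3c, C6_3nc, C6_2l2}" for xs and H :: "nat graph"
    using contains_induced_list[OF that(1-4) sing that(5)] that(6) X unfolding class_X_def by blast
  have sing_H: "{i} \<notin> edges S_3_3_3" "{i} \<notin> edges C6_3c" "{i} \<notin> edges C6_3nc" "{i} \<notin> edges C6_2l2" for i
    by (auto simp: S_3_3_3_def C6_3c_def C6_3nc_def C6_2l2_def cycle_6_edges)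
  have verts_H: "verts S_3_3_3 = {..<10}" "verts C6_3c = {..<9}" "verts C6_3nc = {..<9}" "verts C6_2l2 = {..<10}"
    by (simp_all add: S_3_3_3_def C6_3c_def C6_3nc_def C6_2l2_def)
  have hV: "{a, b, c, d, e, f} \<subseteq> verts G" if "hex a b c d e f" for a b c d e f
    using that EV unfolding hex_def by blast
  show ?thesis
  proof
    fix c x1 x2 x3 y1 y2 y3 z1 z2 z3
    assume a: "?E c x1" "?E x1 x2" "?E x2 x3" "\<not> ?E c x3" "?E c y1" "?E y1 y2" "?E y2 y3" "\<not> ?E c y3"
      "?E c z1" "?E z1 z2" "?E z2 z3" "\<not> ?E c z3"
      "{x1, x2, x3} \<inter> {y1, y2, y3} = {}" "{x1, x2, x3} \<inter> {z1, z2, z3} = {}"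
      "{y1, y2, y3} \<inter> {z1, z2, z3} = {}"
      "\<And>x y. x \<in> {x1, x2, x3} \<Longrightarrow> y \<in> {y1, y2, y3} \<Longrightarrow> \<not> ?E x y"
      "\<And>x z. x \<in> {x1, x2, x3} \<Longrightarrow> z \<in> {z1, z2, z3} \<Longrightarrow> \<not> ?E x z"
      "\<And>y z. y \<in> {y1, y2, y3} \<Longrightarrow> z \<in> {z1, z2, z3} \<Longrightarrow> \<not> ?E y z"
    have V: "set [c, x1, x2, x3, y1, y2, y3, z1, z2, z3] \<subseteq> verts G"
      using EV a(1-3,5-7,9-11) by auto
    show False
      by (rule contra[OF table_S333(1)[OF a] V _ sing_H(1) table_S333(2)[OF a]]) (simp_all add: verts_H)
  next
    fix a b c d e f x y z
    assume h: "hex a b c d e f" "x \<notin> {a, b, c, d, e, f}" "y \<notin> {a, b, c, d, e, f}"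
       "z \<notin> {a, b, c, d, e, f}" "?E a x" "?E b y" "?E c z"
    have V: "set [a, b, c, d, e, f, x, y, z] \<subseteq> verts G" using hV[OF h(1)] EV h(5-7) by auto
    show False
      by (rule contra[OF table_3c(1)[OF h] V _ sing_H(2) table_3c(2)[OF h]]) (simp_all add: verts_H)
  next
    fix a b c d e f x y z
    assume h: "hex a b c d e f" "x \<notin> {a, b, c, d, e, f}" "y \<notin> {a, b, c, d, e, f}"
       "z \<notin> {a, b, c, d, e, f}" "?E a x" "?E c y" "?E e z"
    have V: "set [a, b, c, d, e, f, x, y, z] \<subseteq> verts G" using hV[OF h(1)] EV h(5-7) by auto
    show False
      by (rule contra[OF table_3nc(1)[OF h] V _ sing_H(3) table_3nc(2)[OF h]]) (simp_all add: verts_H)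
  next
    fix a b c d e f x y x' y'
    assume h: "hex a b c d e f" "x \<notin> {a, b, c, d, e, f}" "y \<notin> {a, b, c, d, e, f}"
       "x' \<notin> {a, b, c, d, e, f}" "y' \<notin> {a, b, c, d, e, f}"
       "?E a x" "?E x x'" "?E b y" "?E y y'" "\<not> ?E x' d" "\<not> ?E y' e" "\<not> ?E x' y'"
    have V: "set [a, b, c, d, e, f, x, x', y, y'] \<subseteq> verts G" using hV[OF h(1)] EV h(6-9) by auto
    show False
      by (rule contra[OF table_2l2(1)[OF h] V _ sing_H(4) table_2l2(2)[OF h]]) (simp_all add: verts_H)
  qed
qed

section \<open>From layouts to unit disks\<close>

lemma dist_vector_2:
  "dist (vector [a, b] :: real ^ 2) (vector [c, d]) \<le> 1 \<longleftrightarrow> (a - c)\<^sup>2 + (b - d)\<^sup>2 \<le> 1"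
  by (simp add: dist_vec_def L2_set_def sum_2 dist_real_def)

text \<open>The two sides are placed in small neighbourhoods of two points at distance 1.  To second
  order, the squared distance of a pair exceeds 1 by twice the value of the layout form.\<close>

lemma unit_disk_of_layout:
  assumes B: "bipartite_graph U W G"
    and lay: "bip_graph.layout U (\<lambda>x y. {x, y} \<in> edges G) (verts G) x h"
  shows "unit_disk_graph (complement G)"
proof -
  let ?E = "\<lambda>x y. {x, y} \<in> edges G"
  let ?V = "verts G"
  have fin: "finite ?V" and iU: "\<And>u v. u \<in> U \<Longrightarrow> v \<in> U \<Longrightarrow> \<not> ?E u v"
    and iW: "\<And>u v. u \<in> ?V - U \<Longrightarrow> v \<in> ?V - U \<Longrightarrow> \<not> ?E u v"
    and EV: "\<And>x y. ?E x y \<Longrightarrow> x \<in> ?V \<and> y \<in> ?V"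
    using B unfolding bipartite_graph_def simple_graph_def independent_set_def by auto
  interpret bip_graph U ?E
  proof
    show "?E b a" if "?E a b" for a b using that by (simp add: insert_commute)
    show "(a \<in> U) \<noteq> (b \<in> U)" if "?E a b" for a b
      using that iU[of a b] iW[of a b] EV[OF that] by blast
  qed
  \<comment> \<open>Across the sides the \<open>t^2\<close> coefficient of the squared distance is
    \<open>2 * (k w - k u) + (x u + x w)^2\<close>; the opposite signs in \<open>q\<close> turn the
    difference into a sum. The squares in \<open>k\<close> cancel those of the expansion, which
    leaves twice the form.\<close>
  define k where "k z = (if z \<in> U then (x z)\<^sup>2 / 2 - h z else h z - (x z)\<^sup>2 / 2)" for z
  define p where "p t z = (if z \<in> U then t\<^sup>2 * k z else 1 + t\<^sup>2 * k z)" for t z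
  define q where "q t z = (if z \<in> U then t * x z else - (t * x z))" for t z
  define D where "D t u v = (p t u - p t v)\<^sup>2 + (q t u - q t v)\<^sup>2" for t u v
  have Dsym: "D t u v = D t v u" for t u v unfolding D_def by (simp add: power2_commute)
  have cross: "\<forall>\<^sub>F t in at_right 0. \<not> ?E u w \<longleftrightarrow> D t u w \<le> 1"
    if uw: "u \<in> ?V" "w \<in> ?V" "u \<in> U" "w \<notin> U" for u w
  proof -
    define F where "F = h u + h w + x u * x w"
    have F: "if ?E u w then 0 < F else F < 0"
      using lay uw unfolding layout_def opp_def F_def by blast
    have D: "D t u w = 1 + t\<^sup>2 * (2 * F + t\<^sup>2 * (k w - k u)\<^sup>2)" for t
      unfolding D_def p_def q_def k_def F_def using uw by (simp add: power2_eq_square field_simps)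
    have lim: "((\<lambda>t. 2 * F + t\<^sup>2 * (k w - k u)\<^sup>2) \<longlongrightarrow> 2 * F + 0\<^sup>2 * (k w - k u)\<^sup>2) (at_right 0)"
      by (intro tendsto_intros)
    have pos: "\<forall>\<^sub>F t in at_right 0. (0::real) < t" by (simp add: eventually_at_right_less)
    show ?thesis
    proof (cases "?E u w")
      case True
      then have "\<forall>\<^sub>F t in at_right 0. 0 < 2 * F + t\<^sup>2 * (k w - k u)\<^sup>2"
        using order_tendstoD(1)[OF lim, of 0] F by simp
      with pos show ?thesis
      proof eventually_elim
        case (elim t)
        then have "0 < t\<^sup>2 * (2 * F + t\<^sup>2 * (k w - k u)\<^sup>2)" by simp
        then show ?case using True D[of t] by simp
      qed
    next
      case False
      then have "\<forall>\<^sub>F t in at_right 0. 2 * F + t\<^sup>2 * (k w - k u)\<^sup>2 < 0"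
        using order_tendstoD(2)[OF lim, of 0] F by simp
      with pos show ?thesis
      proof eventually_elim
        case (elim t)
        then have "t\<^sup>2 * (2 * F + t\<^sup>2 * (k w - k u)\<^sup>2) < 0" by (simp add: mult_pos_neg)
        then show ?case using False D[of t] by simp
      qed
    qed
  qed
  have same: "\<forall>\<^sub>F t in at_right 0. \<not> ?E u w \<longleftrightarrow> D t u w \<le> 1"
    if uw: "u \<in> ?V" "w \<in> ?V" "u \<in> U \<longleftrightarrow> w \<in> U" for u w
  proof -
    have D: "D t u w = (t\<^sup>2 * (k u - k w))\<^sup>2 + (t * (x u - x w))\<^sup>2" for t
      unfolding D_def p_def q_def using uw(3) by (simp add: algebra_simps power2_eq_square)
    have lim: "((\<lambda>t. (t\<^sup>2 * (k u - k w))\<^sup>2 + (t * (x u - x w))\<^sup>2) \<longlongrightarrow>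
        (0\<^sup>2 * (k u - k w))\<^sup>2 + (0 * (x u - x w))\<^sup>2) (at_right 0)"
      by (intro tendsto_intros)
    have "\<forall>\<^sub>F t in at_right 0. D t u w < 1"
      unfolding D using order_tendstoD(2)[OF lim, of 1] by simp
    moreover have "\<not> ?E u w" using uw bip by blast
    ultimately show ?thesis by (auto elim: eventually_mono)
  qed
  have "\<forall>\<^sub>F t in at_right 0. \<not> ?E u v \<longleftrightarrow> D t u v \<le> 1" if "u \<in> ?V" "v \<in> ?V" for u v
  proof -
    consider "u \<in> U \<longleftrightarrow> v \<in> U" | "u \<in> U" "v \<notin> U" | "v \<in> U" "u \<notin> U" by blast
    then show ?thesis
    proof cases
      case 3
      then show ?thesis using cross[of v u] that E_commute[of u v] Dsym[of _ u v] by simp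
    qed (use same cross that in auto)
  qed
  then have "\<forall>\<^sub>F t in at_right 0. \<forall>u\<in>?V. \<forall>v\<in>?V. \<not> ?E u v \<longleftrightarrow> D t u v \<le> 1"
    using fin by (simp add: eventually_ball_finite)
  then obtain t where t: "\<forall>u\<in>?V. \<forall>v\<in>?V. \<not> ?E u v \<longleftrightarrow> D t u v \<le> 1"
    using eventually_happens[of _ "at_right (0::real)"] trivial_limit_at_right_real by blast
  define \<phi> where "\<phi> z = (vector [p t z, q t z] :: real ^ 2)" for z
  have "{u, v} \<in> edges (complement G) \<longleftrightarrow> dist (\<phi> u) (\<phi> v) \<le> 1"
    if "u \<in> ?V" "v \<in> ?V" "u \<noteq> v" for u v
  proof -
    have "{u, v} \<in> edges (complement G) \<longleftrightarrow> \<not> ?E u v"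
      using that unfolding complement_def by (auto simp: doubleton_eq_iff insert_commute)
    then show ?thesis using t that unfolding \<phi>_def dist_vector_2 D_def by blast
  qed
  moreover have "simple_graph (complement G)"
    using fin unfolding simple_graph_def complement_def by auto
  moreover have "verts (complement G) = ?V" unfolding complement_def by simp
  ultimately show ?thesis unfolding unit_disk_graph_def by (intro conjI exI[of _ \<phi>]) auto
qed

theorem theorem24:
  fixes G :: "'a graph" and U W :: "'a set"
  assumes "bipartite_graph U W G"
    and "G \<in> class_X"
  shows "unit_disk_graph (complement G)"
proof -
  interpret x_graph U "\<lambda>x y. {x, y} \<in> edges G" "verts G"
    using x_graph_of_class_X[OF assms] .
  obtain x h where "layout (verts G) x h" using layout_exists by blast
  then show ?thesis by (rule unit_disk_of_layout[OF assms(1)])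
qed

end
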